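(* Let $G$ be an affine group scheme over $\vec{\mathcal C}$, with coordinate ring $\mathcal O(G)$ and augmentation ideal $\mathfrak m$. Then there are canonical isomorphisms in $\vec{\mathcal C}$ between the following objects. (i) The tangent space $\mathrm{Lie}(G)=\mathcal T_{G,e}=(\mathfrak m/\mathfrak m^2)^*$ to $G$ at the identity. (ii) The degree one distributions $\mathrm{Dist}_1^+(G)$ on $G$. (iii) The object of right invariant derivations of $\mathcal O(G)$, that is, the object of $\vec{\mathcal C}$ representing the functor that sends $X\in\vec{\mathcal C}$ to the set of actions $\beta_X\colon X\otimes\mathcal O(G)\to\mathcal O(G)$ by right invariant derivations (in particular, this representing object exists).
   Context: Setting: $k$ is an algebraically closed field; $\mathcal C$ is a finite symmetric tensor category over $k$ (a $k$-linear abelian category equivalent to finitely generated modules over a finite dimensional $k$-algebra, with biexact tensor product, symmetric braiding $s$, simple unit object $\mathbf 1$, and all objects rigid); $\vec{\mathcal C}$ is its ind-completion, to which $\otimes$ and $s$ extend. For $X\in\vec{\mathcal C}$, $X^*$ is the dual, i.e. the internal Hom from $X$ to $\mathbf 1$ (the usual dual when $X\in\mathcal C$). Identity maps are written $1$ or $\mathrm{Id}$. A commutative algebra over $\vec{\mathcal C}$ is a unital associative algebra $(A,\mu,\iota)$ in $\vec{\mathcal C}$ with $\mu\circ s=\mu$. An affine group scheme $G$ over $\vec{\mathcal C}$ is a functor from commutative algebras over $\vec{\mathcal C}$ to groups whose underlying set-valued functor is representable; the representing object $\mathcal O(G)$ is then a commutative Hopf algebra in $\vec{\mathcal C}$, with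 comultiplication $\Delta$, counit $\eta\colon\mathcal O(G)\to\mathbf 1$ (this is the identity $e\in G(\mathbf 1)$), and antipode. Put $\mathfrak m=\ker\eta$. Distributions: $\mathrm{Dist}_n(G)=(\mathcal O(G)/\mathfrak m^{n+1})^*$ for $n\ge 0$, and $\mathrm{Dist}_n^+(G)\subseteq \mathrm{Dist}_n(G)$ is the subobject vanishing on the unit of $\mathcal O(G)$ (the kernel of the map $\mathrm{Dist}_n(G)\to\mathbf 1$ dual to $\iota$). Derivations: a map $\beta_X\colon X\otimes\mathcal O(G)\to\mathcal O(G)$ is an action by derivations if $\beta_X\circ(1\otimes\mu)=\mu\circ(\beta_X\otimes 1+(1\otimes\beta_X)\circ(s\otimes 1))$ as maps $X\otimes\mathcal O(G)\otimes\mathcal O(G)\to\mathcal O(G)$. It is right invariant if $\Delta\circ\beta_X=(\beta_X\otimes 1)\circ(1\otimes\Delta)$. *)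

theory Defs
  imports "HOL-Library.Equipollence" "HOL-Algebra.Module" "HOL-Computational_Algebra.Polynomial"
begin

section \<open>Linear and abelian categories\<close>

text \<open>
  Kernels, cokernels, images, duals, colimits etc. are determined only up to unique isomorphism.
  They are therefore predicates (\<open>this arrow is a kernel of f\<close>), not operations.
\<close>

record ('o, 'a) cat =
  Obj :: "'o set"
  Arr :: "'a set"
  Dom :: "'a \<Rightarrow> 'o"
  Cod :: "'a \<Rightarrow> 'o"
  Id :: "'o \<Rightarrow> 'a"
  Comp :: "'a \<Rightarrow> 'a \<Rightarrow> 'a"  (infixr \<open>\<cdot>\<index>\<close> 70)

record ('o, 'a, 'k) lin_cat = "('o, 'a) cat" +
  Add :: "'a \<Rightarrow> 'a \<Rightarrow> 'a"  (infixl \<open>\<boxplus>\<index>\<close> 65)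
  Zero :: "'o \<Rightarrow> 'o \<Rightarrow> 'a"
  Scale :: "'k \<Rightarrow> 'a \<Rightarrow> 'a"  (infixr \<open>\<star>\<index>\<close> 72)

definition mor :: "('o, 'a, 'm) cat_scheme \<Rightarrow> 'o \<Rightarrow> 'o \<Rightarrow> 'a set" where
  "mor C X Y = {f \<in> Arr C. Dom C f = X \<and> Cod C f = Y}"

locale category =
  fixes C :: "('o, 'a, 'm) cat_scheme" (structure)
  assumes dom_obj: "f \<in> Arr C \<Longrightarrow> Dom C f \<in> Obj C"
    and cod_obj: "f \<in> Arr C \<Longrightarrow> Cod C f \<in> Obj C"
    and id_mor: "X \<in> Obj C \<Longrightarrow> Id C X \<in> mor C X X"
    and comp_mor: "f \<in> mor C X Y \<Longrightarrow> g \<in> mor C Y Z \<Longrightarrow> g \<cdot> f \<in> mor C X Z"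
    and comp_id_right: "f \<in> mor C X Y \<Longrightarrow> f \<cdot> Id C X = f"
    and comp_id_left: "f \<in> mor C X Y \<Longrightarrow> Id C Y \<cdot> f = f"
    and comp_assoc: "f \<in> mor C W X \<Longrightarrow> g \<in> mor C X Y \<Longrightarrow> h \<in> mor C Y Z \<Longrightarrow>
      (h \<cdot> g) \<cdot> f = h \<cdot> (g \<cdot> f)"

locale linear_category = category C
  for C :: "('o, 'a, 'k::field, 'm) lin_cat_scheme" (structure) +
  assumes zero_mor: "X \<in> Obj C \<Longrightarrow> Y \<in> Obj C \<Longrightarrow> Zero C X Y \<in> mor C X Y"
    and add_mor: "f \<in> mor C X Y \<Longrightarrow> g \<in> mor C X Y \<Longrightarrow> f \<boxplus> g \<in> mor C X Y"
    and scale_mor: "f \<in> mor C X Y \<Longrightarrow> c \<star> f \<in> mor C X Y"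
    and add_assoc: "f \<in> mor C X Y \<Longrightarrow> g \<in> mor C X Y \<Longrightarrow> h \<in> mor C X Y \<Longrightarrow>
      (f \<boxplus> g) \<boxplus> h = f \<boxplus> (g \<boxplus> h)"
    and add_commute: "f \<in> mor C X Y \<Longrightarrow> g \<in> mor C X Y \<Longrightarrow> f \<boxplus> g = g \<boxplus> f"
    and add_zero: "f \<in> mor C X Y \<Longrightarrow> f \<boxplus> Zero C X Y = f"
    and add_inverse: "f \<in> mor C X Y \<Longrightarrow> \<exists>g \<in> mor C X Y. f \<boxplus> g = Zero C X Y"
    and scale_add_right: "f \<in> mor C X Y \<Longrightarrow> g \<in> mor C X Y \<Longrightarrow>
      c \<star> (f \<boxplus> g) = c \<star> f \<boxplus> c \<star> g"
    and scale_add_left: "f \<in> mor C X Y \<Longrightarrow> (c + d) \<star> f = c \<star> f \<boxplus> d \<star> f"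
    and scale_scale: "f \<in> mor C X Y \<Longrightarrow> c \<star> (d \<star> f) = (c * d) \<star> f"
    and scale_one: "f \<in> mor C X Y \<Longrightarrow> 1 \<star> f = f"
    and comp_add_left: "f \<in> mor C X Y \<Longrightarrow> g \<in> mor C Y Z \<Longrightarrow> g' \<in> mor C Y Z \<Longrightarrow>
      (g \<boxplus> g') \<cdot> f = g \<cdot> f \<boxplus> g' \<cdot> f"
    and comp_add_right: "f \<in> mor C X Y \<Longrightarrow> f' \<in> mor C X Y \<Longrightarrow> g \<in> mor C Y Z \<Longrightarrow>
      g \<cdot> (f \<boxplus> f') = g \<cdot> f \<boxplus> g \<cdot> f'"
    and comp_scale_left: "f \<in> mor C X Y \<Longrightarrow> g \<in> mor C Y Z \<Longrightarrow> (c \<star> g) \<cdot> f = c \<star> (g \<cdot> f)"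
    and comp_scale_right: "f \<in> mor C X Y \<Longrightarrow> g \<in> mor C Y Z \<Longrightarrow> g \<cdot> (c \<star> f) = c \<star> (g \<cdot> f)"

context
  fixes C :: "('o, 'a, 'm) cat_scheme" (structure)
begin

definition is_inverse :: "'a \<Rightarrow> 'a \<Rightarrow> bool" where
  "is_inverse f g \<longleftrightarrow> f \<in> Arr C \<and> g \<in> mor C (Cod C f) (Dom C f) \<and>
     g \<cdot> f = Id C (Dom C f) \<and> f \<cdot> g = Id C (Cod C f)"

definition isos :: "'o \<Rightarrow> 'o \<Rightarrow> 'a set" where
  "isos X Y = {f \<in> mor C X Y. \<exists>g. is_inverse f g}"

definition inverse_arr :: "'a \<Rightarrow> 'a" where
  "inverse_arr f = (THE g. is_inverse f g)"

definition is_mono :: "'a \<Rightarrow> bool" where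
  "is_mono f \<longleftrightarrow> f \<in> Arr C \<and>
     (\<forall>W. \<forall>g \<in> mor C W (Dom C f). \<forall>h \<in> mor C W (Dom C f). f \<cdot> g = f \<cdot> h \<longrightarrow> g = h)"

definition is_epi :: "'a \<Rightarrow> bool" where
  "is_epi f \<longleftrightarrow> f \<in> Arr C \<and>
     (\<forall>W. \<forall>g \<in> mor C (Cod C f) W. \<forall>h \<in> mor C (Cod C f) W. g \<cdot> f = h \<cdot> f \<longrightarrow> g = h)"

end

context
  fixes C :: "('o, 'a, 'k::field, 'm) lin_cat_scheme" (structure)
begin

definition is_kernel :: "'a \<Rightarrow> 'a \<Rightarrow> bool" where
  "is_kernel f i \<longleftrightarrow> f \<in> Arr C \<and> i \<in> Arr C \<and> Cod C i = Dom C f \<and>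
     f \<cdot> i = Zero C (Dom C i) (Cod C f) \<and>
     (\<forall>W. \<forall>h \<in> mor C W (Dom C f). f \<cdot> h = Zero C W (Cod C f) \<longrightarrow>
        (\<exists>!u. u \<in> mor C W (Dom C i) \<and> i \<cdot> u = h))"

definition is_cokernel :: "'a \<Rightarrow> 'a \<Rightarrow> bool" where
  "is_cokernel f q \<longleftrightarrow> f \<in> Arr C \<and> q \<in> Arr C \<and> Dom C q = Cod C f \<and>
     q \<cdot> f = Zero C (Dom C f) (Cod C q) \<and>
     (\<forall>W. \<forall>h \<in> mor C (Cod C f) W. h \<cdot> f = Zero C (Dom C f) W \<longrightarrow>
        (\<exists>!u. u \<in> mor C (Cod C q) W \<and> u \<cdot> q = h))"

definition is_image :: "'a \<Rightarrow> 'a \<Rightarrow> bool" where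
  "is_image f i \<longleftrightarrow> (\<exists>q. is_cokernel f q \<and> is_kernel q i)"

definition is_simple :: "'o \<Rightarrow> bool" where
  "is_simple S \<longleftrightarrow> S \<in> Obj C \<and> Id C S \<noteq> Zero C S S \<and>
     (\<forall>f. is_mono C f \<and> Cod C f = S \<longrightarrow> f = Zero C (Dom C f) S \<or> f \<in> isos C (Dom C f) S)"

end

locale abelian_category = linear_category C
  for C :: "('o, 'a, 'k::field, 'm) lin_cat_scheme" (structure) +
  assumes zero_object: "\<exists>Z \<in> Obj C. Id C Z = Zero C Z Z"
    and biproduct: "X \<in> Obj C \<Longrightarrow> Y \<in> Obj C \<Longrightarrow>
      \<exists>P i j p q. i \<in> mor C X P \<and> j \<in> mor C Y P \<and> p \<in> mor C P X \<and> q \<in> mor C P Y \<and>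
        p \<cdot> i = Id C X \<and> q \<cdot> j = Id C Y \<and> p \<cdot> j = Zero C Y X \<and> q \<cdot> i = Zero C X Y \<and>
        i \<cdot> p \<boxplus> j \<cdot> q = Id C P"
    and has_kernel: "f \<in> Arr C \<Longrightarrow> \<exists>i. is_kernel C f i"
    and has_cokernel: "f \<in> Arr C \<Longrightarrow> \<exists>q. is_cokernel C f q"
    and mono_normal: "is_mono C f \<Longrightarrow> \<exists>g. is_kernel C g f"
    and epi_normal: "is_epi C f \<Longrightarrow> \<exists>g. is_cokernel C g f"


section \<open>Finite categories\<close>

text \<open>
  Finite dimensional, not necessarily commutative, algebras over the field \<^typ>\<open>'k\<close>
  and their left modules, on the records of HOL-Algebra.  Its locales \<open>algebra\<close> and \<open>module\<close>
  require commutative rings.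
\<close>

definition fd_algebra :: "('k::field, 'x) module \<Rightarrow> bool" where
  "fd_algebra A \<longleftrightarrow> ring A \<and>
     (\<forall>c. \<forall>x \<in> carrier A. c \<odot>\<^bsub>A\<^esub> x \<in> carrier A \<and> 1 \<odot>\<^bsub>A\<^esub> x = x) \<and>
     (\<forall>c d. \<forall>x \<in> carrier A. (c + d) \<odot>\<^bsub>A\<^esub> x = c \<odot>\<^bsub>A\<^esub> x \<oplus>\<^bsub>A\<^esub> d \<odot>\<^bsub>A\<^esub> x \<and>
        (c * d) \<odot>\<^bsub>A\<^esub> x = c \<odot>\<^bsub>A\<^esub> (d \<odot>\<^bsub>A\<^esub> x)) \<and>
     (\<forall>c. \<forall>x \<in> carrier A. \<forall>y \<in> carrier A.
        c \<odot>\<^bsub>A\<^esub> (x \<oplus>\<^bsub>A\<^esub> y) = c \<odot>\<^bsub>A\<^esub> x \<oplus>\<^bsub>A\<^esub> c \<odot>\<^bsub>A\<^esub> y \<and>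
        c \<odot>\<^bsub>A\<^esub> (x \<otimes>\<^bsub>A\<^esub> y) = (c \<odot>\<^bsub>A\<^esub> x) \<otimes>\<^bsub>A\<^esub> y \<and>
        c \<odot>\<^bsub>A\<^esub> (x \<otimes>\<^bsub>A\<^esub> y) = x \<otimes>\<^bsub>A\<^esub> (c \<odot>\<^bsub>A\<^esub> y)) \<and>
     (\<exists>B. finite B \<and> B \<subseteq> carrier A \<and>
        (\<forall>x \<in> carrier A. \<exists>c. x = (\<Oplus>\<^bsub>A\<^esub>b \<in> B. c b \<odot>\<^bsub>A\<^esub> b)))"

definition left_module :: "('k::field, 'x) module \<Rightarrow> ('x, 'y) module \<Rightarrow> bool" where
  "left_module A M \<longleftrightarrow> abelian_group M \<and>
     (\<forall>a \<in> carrier A. \<forall>x \<in> carrier M. a \<odot>\<^bsub>M\<^esub> x \<in> carrier M) \<and>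
     (\<forall>x \<in> carrier M. \<one>\<^bsub>A\<^esub> \<odot>\<^bsub>M\<^esub> x = x) \<and>
     (\<forall>a \<in> carrier A. \<forall>b \<in> carrier A. \<forall>x \<in> carrier M.
        (a \<oplus>\<^bsub>A\<^esub> b) \<odot>\<^bsub>M\<^esub> x = a \<odot>\<^bsub>M\<^esub> x \<oplus>\<^bsub>M\<^esub> b \<odot>\<^bsub>M\<^esub> x \<and>
        (a \<otimes>\<^bsub>A\<^esub> b) \<odot>\<^bsub>M\<^esub> x = a \<odot>\<^bsub>M\<^esub> (b \<odot>\<^bsub>M\<^esub> x)) \<and>
     (\<forall>a \<in> carrier A. \<forall>x \<in> carrier M. \<forall>y \<in> carrier M.
        a \<odot>\<^bsub>M\<^esub> (x \<oplus>\<^bsub>M\<^esub> y) = a \<odot>\<^bsub>M\<^esub> x \<oplus>\<^bsub>M\<^esub> a \<odot>\<^bsub>M\<^esub> y)"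

definition fg_left_module :: "('k::field, 'x) module \<Rightarrow> ('x, 'y) module \<Rightarrow> bool" where
  "fg_left_module A M \<longleftrightarrow> left_module A M \<and>
     (\<exists>S. finite S \<and> S \<subseteq> carrier M \<and>
        (\<forall>x \<in> carrier M. \<exists>c. c \<in> S \<rightarrow> carrier A \<and> x = (\<Oplus>\<^bsub>M\<^esub>s \<in> S. c s \<odot>\<^bsub>M\<^esub> s)))"

definition module_maps ::
    "('k::field, 'x) module \<Rightarrow> ('x, 'y) module \<Rightarrow> ('x, 'y) module \<Rightarrow> ('y \<Rightarrow> 'y) set" where
  "module_maps A M N = {f \<in> carrier M \<rightarrow>\<^sub>E carrier N.
     (\<forall>x \<in> carrier M. \<forall>y \<in> carrier M. f (x \<oplus>\<^bsub>M\<^esub> y) = f x \<oplus>\<^bsub>N\<^esub> f y) \<and>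
     (\<forall>a \<in> carrier A. \<forall>x \<in> carrier M. f (a \<odot>\<^bsub>M\<^esub> x) = a \<odot>\<^bsub>N\<^esub> f x)}"

definition fg_module_category :: "('k::field, 'x) module \<Rightarrow>
    (('x, 'y) module, ('x, 'y) module \<times> ('x, 'y) module \<times> ('y \<Rightarrow> 'y), 'k) lin_cat" where
  "fg_module_category A =
     \<lparr>Obj = {M. fg_left_module A M},
      Arr = {(M, N, f). fg_left_module A M \<and> fg_left_module A N \<and> f \<in> module_maps A M N},
      Dom = (\<lambda>(M, N, f). M),
      Cod = (\<lambda>(M, N, f). N),
      Id = (\<lambda>M. (M, M, \<lambda>x \<in> carrier M. x)),
      Comp = (\<lambda>(N', P, g) (M, N, f). (M, P, compose (carrier M) g f)),
      Add = (\<lambda>(M, N, f) (M', N', g). (M, N, \<lambda>x \<in> carrier M. f x \<oplus>\<^bsub>N\<^esub> g x)),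
      Zero = (\<lambda>M N. (M, N, \<lambda>x \<in> carrier M. \<zero>\<^bsub>N\<^esub>)),
      Scale = (\<lambda>c (M, N, f). (M, N, \<lambda>x \<in> carrier M. (c \<odot>\<^bsub>A\<^esub> \<one>\<^bsub>A\<^esub>) \<odot>\<^bsub>N\<^esub> f x))\<rparr>"

definition cat_functor ::
    "('o, 'a, 'm) cat_scheme \<Rightarrow> ('p, 'b, 'n) cat_scheme \<Rightarrow> ('o \<Rightarrow> 'p) \<Rightarrow> ('a \<Rightarrow> 'b) \<Rightarrow> bool" where
  "cat_functor C D Fo Fa \<longleftrightarrow>
     (\<forall>X \<in> Obj C. Fo X \<in> Obj D \<and> Fa (Id C X) = Id D (Fo X)) \<and>
     (\<forall>X Y. \<forall>f \<in> mor C X Y. Fa f \<in> mor D (Fo X) (Fo Y)) \<and>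
     (\<forall>X Y Z. \<forall>f \<in> mor C X Y. \<forall>g \<in> mor C Y Z. Fa (g \<cdot>\<^bsub>C\<^esub> f) = Fa g \<cdot>\<^bsub>D\<^esub> Fa f)"

definition linear_equivalence ::
    "('o, 'a, 'k::field, 'm) lin_cat_scheme \<Rightarrow> ('p, 'b, 'k, 'n) lin_cat_scheme \<Rightarrow>
     ('o \<Rightarrow> 'p) \<Rightarrow> ('a \<Rightarrow> 'b) \<Rightarrow> bool" where
  "linear_equivalence C D Fo Fa \<longleftrightarrow> cat_functor C D Fo Fa \<and>
     (\<forall>X Y. \<forall>f \<in> mor C X Y. \<forall>g \<in> mor C X Y. \<forall>c d.
        Fa (c \<star>\<^bsub>C\<^esub> f \<boxplus>\<^bsub>C\<^esub> d \<star>\<^bsub>C\<^esub> g) = c \<star>\<^bsub>D\<^esub> Fa f \<boxplus>\<^bsub>D\<^esub> d \<star>\<^bsub>D\<^esub> Fa g) \<and>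
     (\<forall>X \<in> Obj C. \<forall>Y \<in> Obj C. bij_betw Fa (mor C X Y) (mor D (Fo X) (Fo Y))) \<and>
     (\<forall>M \<in> Obj D. \<exists>X \<in> Obj C. isos D (Fo X) M \<noteq> {})"

text \<open>
  The carrier type \<^typ>\<open>nat \<Rightarrow> 'k\<close> loses nothing: it contains a copy of every finite dimensional
  vector space over \<^typ>\<open>'k\<close>, hence of every finite dimensional algebra and of each of its finitely
  generated modules.
\<close>

definition finite_category :: "('o, 'a, 'k::field, 'm) lin_cat_scheme \<Rightarrow> bool" where
  "finite_category C \<longleftrightarrow>
     (\<exists>(A :: ('k, nat \<Rightarrow> 'k) module) (Fo :: 'o \<Rightarrow> (nat \<Rightarrow> 'k, nat \<Rightarrow> 'k) module) Fa.
        fd_algebra A \<and> linear_equivalence C (fg_module_category A) Fo Fa)"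


section \<open>Symmetric tensor categories and ind-completions\<close>

record ('o, 'a, 'k) sym_cat = "('o, 'a, 'k) lin_cat" +
  TensO :: "'o \<Rightarrow> 'o \<Rightarrow> 'o"  (infixl \<open>\<boxtimes>\<index>\<close> 75)
  TensA :: "'a \<Rightarrow> 'a \<Rightarrow> 'a"  (infixl \<open>\<boxdot>\<index>\<close> 75)
  Unit :: "'o"
  Assoc :: "'o \<Rightarrow> 'o \<Rightarrow> 'o \<Rightarrow> 'a"
  LUnit :: "'o \<Rightarrow> 'a"
  RUnit :: "'o \<Rightarrow> 'a"
  Braid :: "'o \<Rightarrow> 'o \<Rightarrow> 'a"

locale symmetric_monoidal_category = linear_category V
  for V :: "('o, 'a, 'k::field, 'm) sym_cat_scheme" (structure) +
  assumes tens_obj: "X \<in> Obj V \<Longrightarrow> Y \<in> Obj V \<Longrightarrow> X \<boxtimes> Y \<in> Obj V"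
    and tens_mor: "f \<in> mor V X Y \<Longrightarrow> g \<in> mor V X' Y' \<Longrightarrow> f \<boxdot> g \<in> mor V (X \<boxtimes> X') (Y \<boxtimes> Y')"
    and tens_id: "X \<in> Obj V \<Longrightarrow> Y \<in> Obj V \<Longrightarrow> Id V X \<boxdot> Id V Y = Id V (X \<boxtimes> Y)"
    and tens_comp: "f \<in> mor V X Y \<Longrightarrow> g \<in> mor V Y Z \<Longrightarrow> f' \<in> mor V X' Y' \<Longrightarrow> g' \<in> mor V Y' Z' \<Longrightarrow>
      (g \<cdot> f) \<boxdot> (g' \<cdot> f') = (g \<boxdot> g') \<cdot> (f \<boxdot> f')"
    and tens_add_left: "f \<in> mor V X Y \<Longrightarrow> g \<in> mor V X Y \<Longrightarrow> h \<in> mor V X' Y' \<Longrightarrow>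
      (f \<boxplus> g) \<boxdot> h = f \<boxdot> h \<boxplus> g \<boxdot> h"
    and tens_add_right: "f \<in> mor V X Y \<Longrightarrow> g \<in> mor V X Y \<Longrightarrow> h \<in> mor V X' Y' \<Longrightarrow>
      h \<boxdot> (f \<boxplus> g) = h \<boxdot> f \<boxplus> h \<boxdot> g"
    and tens_scale_left: "f \<in> mor V X Y \<Longrightarrow> g \<in> mor V X' Y' \<Longrightarrow> (c \<star> f) \<boxdot> g = c \<star> (f \<boxdot> g)"
    and tens_scale_right: "f \<in> mor V X Y \<Longrightarrow> g \<in> mor V X' Y' \<Longrightarrow> f \<boxdot> (c \<star> g) = c \<star> (f \<boxdot> g)"
    and unit_obj: "Unit V \<in> Obj V"
    and assoc_iso: "X \<in> Obj V \<Longrightarrow> Y \<in> Obj V \<Longrightarrow> Z \<in> Obj V \<Longrightarrow>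
      Assoc V X Y Z \<in> isos V (X \<boxtimes> Y \<boxtimes> Z) (X \<boxtimes> (Y \<boxtimes> Z))"
    and lunit_iso: "X \<in> Obj V \<Longrightarrow> LUnit V X \<in> isos V (Unit V \<boxtimes> X) X"
    and runit_iso: "X \<in> Obj V \<Longrightarrow> RUnit V X \<in> isos V (X \<boxtimes> Unit V) X"
    and braid_mor: "X \<in> Obj V \<Longrightarrow> Y \<in> Obj V \<Longrightarrow> Braid V X Y \<in> mor V (X \<boxtimes> Y) (Y \<boxtimes> X)"
    and assoc_natural: "f \<in> mor V X X' \<Longrightarrow> g \<in> mor V Y Y' \<Longrightarrow> h \<in> mor V Z Z' \<Longrightarrow>
      Assoc V X' Y' Z' \<cdot> (f \<boxdot> g \<boxdot> h) = (f \<boxdot> (g \<boxdot> h)) \<cdot> Assoc V X Y Z"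
    and lunit_natural: "f \<in> mor V X Y \<Longrightarrow> LUnit V Y \<cdot> (Id V (Unit V) \<boxdot> f) = f \<cdot> LUnit V X"
    and runit_natural: "f \<in> mor V X Y \<Longrightarrow> RUnit V Y \<cdot> (f \<boxdot> Id V (Unit V)) = f \<cdot> RUnit V X"
    and braid_natural: "f \<in> mor V X X' \<Longrightarrow> g \<in> mor V Y Y' \<Longrightarrow>
      Braid V X' Y' \<cdot> (f \<boxdot> g) = (g \<boxdot> f) \<cdot> Braid V X Y"
    and pentagon: "W \<in> Obj V \<Longrightarrow> X \<in> Obj V \<Longrightarrow> Y \<in> Obj V \<Longrightarrow> Z \<in> Obj V \<Longrightarrow>
      (Id V W \<boxdot> Assoc V X Y Z) \<cdot> Assoc V W (X \<boxtimes> Y) Z \<cdot> (Assoc V W X Y \<boxdot> Id V Z) =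
      Assoc V W X (Y \<boxtimes> Z) \<cdot> Assoc V (W \<boxtimes> X) Y Z"
    and triangle: "X \<in> Obj V \<Longrightarrow> Y \<in> Obj V \<Longrightarrow>
      (Id V X \<boxdot> LUnit V Y) \<cdot> Assoc V X (Unit V) Y = RUnit V X \<boxdot> Id V Y"
    and hexagon: "X \<in> Obj V \<Longrightarrow> Y \<in> Obj V \<Longrightarrow> Z \<in> Obj V \<Longrightarrow>
      Assoc V Y Z X \<cdot> Braid V X (Y \<boxtimes> Z) \<cdot> Assoc V X Y Z =
      (Id V Y \<boxdot> Braid V X Z) \<cdot> Assoc V Y X Z \<cdot> (Braid V X Y \<boxdot> Id V Z)"
    and braid_symmetric: "X \<in> Obj V \<Longrightarrow> Y \<in> Obj V \<Longrightarrow>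
      Braid V Y X \<cdot> Braid V X Y = Id V (X \<boxtimes> Y)"

context
  fixes V :: "('o, 'a, 'k::field, 'm) sym_cat_scheme" (structure)
begin

definition rigid :: "'o \<Rightarrow> bool" where
  "rigid X \<longleftrightarrow> (\<exists>X' ev coev. X' \<in> Obj V \<and>
     ev \<in> mor V (X' \<boxtimes> X) (Unit V) \<and> coev \<in> mor V (Unit V) (X \<boxtimes> X') \<and>
     RUnit V X \<cdot> (Id V X \<boxdot> ev) \<cdot> Assoc V X X' X \<cdot> (coev \<boxdot> Id V X)
       \<cdot> inverse_arr V (LUnit V X) = Id V X \<and>
     LUnit V X' \<cdot> (ev \<boxdot> Id V X') \<cdot> inverse_arr V (Assoc V X' X X') \<cdot> (Id V X' \<boxdot> coev)
       \<cdot> inverse_arr V (RUnit V X') = Id V X')"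

text \<open>The internal Hom from \<open>X\<close> to the unit object, with its evaluation map.\<close>

definition is_dual :: "'o \<Rightarrow> 'o \<Rightarrow> 'a \<Rightarrow> bool" where
  "is_dual X D ev \<longleftrightarrow> X \<in> Obj V \<and> D \<in> Obj V \<and> ev \<in> mor V (D \<boxtimes> X) (Unit V) \<and>
     (\<forall>Y \<in> Obj V. \<forall>h \<in> mor V (Y \<boxtimes> X) (Unit V).
        \<exists>!u. u \<in> mor V Y D \<and> ev \<cdot> (u \<boxdot> Id V X) = h)"

end

locale finite_symmetric_tensor_category =
  symmetric_monoidal_category C + abelian_category C
  for C :: "('o, 'a, 'k::alg_closed_field, 'm) sym_cat_scheme" (structure) +
  assumes finite: "finite_category C"
    and biexact_kernel: "is_kernel C f i \<Longrightarrow> X \<in> Obj C \<Longrightarrow>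
      is_kernel C (Id C X \<boxdot> f) (Id C X \<boxdot> i) \<and> is_kernel C (f \<boxdot> Id C X) (i \<boxdot> Id C X)"
    and biexact_cokernel: "is_cokernel C f q \<Longrightarrow> X \<in> Obj C \<Longrightarrow>
      is_cokernel C (Id C X \<boxdot> f) (Id C X \<boxdot> q) \<and> is_cokernel C (f \<boxdot> Id C X) (q \<boxdot> Id C X)"
    and simple_unit: "is_simple C (Unit C)"
    and all_rigid: "X \<in> Obj C \<Longrightarrow> rigid C X"

definition filtered_category :: "('i, 'j, 'm) cat_scheme \<Rightarrow> bool" where
  "filtered_category I \<longleftrightarrow> category I \<and> Obj I \<noteq> {} \<and>
     (\<forall>i \<in> Obj I. \<forall>j \<in> Obj I. \<exists>k \<in> Obj I. mor I i k \<noteq> {} \<and> mor I j k \<noteq> {}) \<and>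
     (\<forall>i j. \<forall>u \<in> mor I i j. \<forall>v \<in> mor I i j. \<exists>k. \<exists>w \<in> mor I j k. w \<cdot>\<^bsub>I\<^esub> u = w \<cdot>\<^bsub>I\<^esub> v)"

text \<open>
  \<^typ>\<open>'u\<close> plays the role of the set-theoretic universe: a set is small if its cardinality is less
  than that of \<^typ>\<open>'u\<close>.
\<close>

definition small_filtered_diagram ::
    "('o, 'a, 'm) cat_scheme \<Rightarrow> ('u, 'u) cat \<Rightarrow> ('u \<Rightarrow> 'o) \<Rightarrow> ('u \<Rightarrow> 'a) \<Rightarrow> bool" where
  "small_filtered_diagram C I Fo Fa \<longleftrightarrow>
     filtered_category I \<and> Arr I \<prec> (UNIV :: 'u set) \<and> cat_functor I C Fo Fa"

definition cocone :: "('o, 'a, 'm) cat_scheme \<Rightarrow> ('i, 'j, 'n) cat_scheme \<Rightarrow>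
    ('i \<Rightarrow> 'o) \<Rightarrow> ('j \<Rightarrow> 'a) \<Rightarrow> 'o \<Rightarrow> ('i \<Rightarrow> 'a) \<Rightarrow> bool" where
  "cocone C I Fo Fa L l \<longleftrightarrow> L \<in> Obj C \<and> (\<forall>i \<in> Obj I. l i \<in> mor C (Fo i) L) \<and>
     (\<forall>i j. \<forall>u \<in> mor I i j. l j \<cdot>\<^bsub>C\<^esub> Fa u = l i)"

definition is_colimit :: "('o, 'a, 'm) cat_scheme \<Rightarrow> ('i, 'j, 'n) cat_scheme \<Rightarrow>
    ('i \<Rightarrow> 'o) \<Rightarrow> ('j \<Rightarrow> 'a) \<Rightarrow> 'o \<Rightarrow> ('i \<Rightarrow> 'a) \<Rightarrow> bool" where
  "is_colimit C I Fo Fa L l \<longleftrightarrow> cocone C I Fo Fa L l \<and>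
     (\<forall>M m. cocone C I Fo Fa M m \<longrightarrow>
        (\<exists>!u. u \<in> mor C L M \<and> (\<forall>i \<in> Obj I. u \<cdot>\<^bsub>C\<^esub> l i = m i)))"

definition full_subcategory ::
    "('o, 'a, 'm) cat_scheme \<Rightarrow> 'o set \<Rightarrow> ('o, 'a, 'm) cat_scheme" where
  "full_subcategory V S = V\<lparr>Obj := S, Arr := {f \<in> Arr V. Dom V f \<in> S \<and> Cod V f \<in> S}\<rparr>"

text \<open>
  The ind-completion \<open>V\<close> of a symmetric tensor category \<open>C\<close>, up to the usual identification of \<open>C\<close> with
  a full symmetric monoidal subcategory of \<open>V\<close>: small filtered colimits exist in \<open>V\<close>, objects of \<open>C\<close>
  are compact, i.e. \<open>Hom(X, colim F i) = colim Hom(X, F i)\<close> (the latter colimit of sets is spelt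
  out), every object of \<open>V\<close> is a small filtered colimit of objects of \<open>C\<close>, and the tensor product of
  \<open>V\<close> extends that of \<open>C\<close> by commuting with these colimits in both variables.
\<close>

locale ind_completion =
  symmetric_monoidal_category V + abelian_category V
  for universe :: "'u itself"
    and C :: "('o, 'a, 'k::field) sym_cat"
    and V :: "('o, 'a, 'k::field) sym_cat" (structure) +
  assumes subcategory: "Obj C \<subseteq> Obj V" "C = full_subcategory V (Obj C)"
    and filtered_colimits: "small_filtered_diagram V (I :: ('u, 'u) cat) Fo Fa \<Longrightarrow>
      \<exists>L l. is_colimit V I Fo Fa L l"
    and compact_surj: "small_filtered_diagram V (I :: ('u, 'u) cat) Fo Fa \<Longrightarrow>
      is_colimit V I Fo Fa L l \<Longrightarrow> X \<in> Obj C \<Longrightarrow> f \<in> mor V X L \<Longrightarrow>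
      \<exists>i \<in> Obj I. \<exists>g \<in> mor V X (Fo i). l i \<cdot> g = f"
    and compact_inj: "small_filtered_diagram V (I :: ('u, 'u) cat) Fo Fa \<Longrightarrow>
      is_colimit V I Fo Fa L l \<Longrightarrow> X \<in> Obj C \<Longrightarrow> i \<in> Obj I \<Longrightarrow>
      g \<in> mor V X (Fo i) \<Longrightarrow> h \<in> mor V X (Fo i) \<Longrightarrow> l i \<cdot> g = l i \<cdot> h \<Longrightarrow>
      \<exists>j. \<exists>u \<in> mor I i j. Fa u \<cdot> g = Fa u \<cdot> h"
    and generated: "X \<in> Obj V \<Longrightarrow>
      \<exists>(I :: ('u, 'u) cat) Fo Fa l. small_filtered_diagram V I Fo Fa \<and>
        (\<forall>i \<in> Obj I. Fo i \<in> Obj C) \<and> is_colimit V I Fo Fa X l"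
    and tens_colimit_left: "small_filtered_diagram V (I :: ('u, 'u) cat) Fo Fa \<Longrightarrow>
      is_colimit V I Fo Fa L l \<Longrightarrow> X \<in> Obj V \<Longrightarrow>
      is_colimit V I (\<lambda>i. Fo i \<boxtimes> X) (\<lambda>u. Fa u \<boxdot> Id V X) (L \<boxtimes> X) (\<lambda>i. l i \<boxdot> Id V X)"
    and tens_colimit_right: "small_filtered_diagram V (I :: ('u, 'u) cat) Fo Fa \<Longrightarrow>
      is_colimit V I Fo Fa L l \<Longrightarrow> X \<in> Obj V \<Longrightarrow>
      is_colimit V I (\<lambda>i. X \<boxtimes> Fo i) (\<lambda>u. Id V X \<boxdot> Fa u) (X \<boxtimes> L) (\<lambda>i. Id V X \<boxdot> l i)"


section \<open>Commutative algebras and affine group schemes\<close>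

record ('o, 'a) alg =
  aobj :: "'o"
  amul :: "'a"
  aone :: "'a"

context
  fixes V :: "('o, 'a, 'k::field, 'm) sym_cat_scheme" (structure)
begin

definition comm_alg :: "('o, 'a) alg \<Rightarrow> bool" where
  "comm_alg A \<longleftrightarrow> aobj A \<in> Obj V \<and>
     amul A \<in> mor V (aobj A \<boxtimes> aobj A) (aobj A) \<and> aone A \<in> mor V (Unit V) (aobj A) \<and>
     amul A \<cdot> (amul A \<boxdot> Id V (aobj A)) =
       amul A \<cdot> (Id V (aobj A) \<boxdot> amul A) \<cdot> Assoc V (aobj A) (aobj A) (aobj A) \<and>
     amul A \<cdot> (aone A \<boxdot> Id V (aobj A)) = LUnit V (aobj A) \<and>
     amul A \<cdot> (Id V (aobj A) \<boxdot> aone A) = RUnit V (aobj A) \<and>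
     amul A \<cdot> Braid V (aobj A) (aobj A) = amul A"

definition alg_hom :: "('o, 'a) alg \<Rightarrow> ('o, 'a) alg \<Rightarrow> 'a set" where
  "alg_hom A B = {f \<in> mor V (aobj A) (aobj B).
     f \<cdot> amul A = amul B \<cdot> (f \<boxdot> f) \<and> f \<cdot> aone A = aone B}"

definition unit_alg :: "('o, 'a) alg" where
  "unit_alg = \<lparr>aobj = Unit V, amul = LUnit V (Unit V), aone = Id V (Unit V)\<rparr>"

text \<open>The middle interchange \<open>(A \<otimes> B) \<otimes> (A \<otimes> B) \<rightarrow> (A \<otimes> A) \<otimes> (B \<otimes> B)\<close> built from the braiding.\<close>

definition middle_swap :: "'o \<Rightarrow> 'o \<Rightarrow> 'a" where
  "middle_swap A B =
     inverse_arr V (Assoc V A A (B \<boxtimes> B)) \<cdot> (Id V A \<boxdot> Assoc V A B B)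
     \<cdot> (Id V A \<boxdot> (Braid V B A \<boxdot> Id V B))
     \<cdot> (Id V A \<boxdot> inverse_arr V (Assoc V B A B)) \<cdot> Assoc V A B (A \<boxtimes> B)"

definition tensor_alg :: "('o, 'a) alg \<Rightarrow> ('o, 'a) alg \<Rightarrow> ('o, 'a) alg" where
  "tensor_alg A B =
     \<lparr>aobj = aobj A \<boxtimes> aobj B,
      amul = (amul A \<boxdot> amul B) \<cdot> middle_swap (aobj A) (aobj B),
      aone = (aone A \<boxdot> aone B) \<cdot> inverse_arr V (LUnit V (Unit V))\<rparr>"

definition tensor_inl :: "('o, 'a) alg \<Rightarrow> ('o, 'a) alg \<Rightarrow> 'a" where
  "tensor_inl A B = (Id V (aobj A) \<boxdot> aone B) \<cdot> inverse_arr V (RUnit V (aobj A))"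

definition tensor_inr :: "('o, 'a) alg \<Rightarrow> ('o, 'a) alg \<Rightarrow> 'a" where
  "tensor_inr A B = (aone A \<boxdot> Id V (aobj B)) \<cdot> inverse_arr V (LUnit V (aobj B))"

end

text \<open>\<open>pts_map G A B f\<close> is the map \<open>G(A) \<rightarrow> G(B)\<close> induced by an algebra map \<open>f : A \<rightarrow> B\<close>.\<close>

record ('o, 'a, 'g) alg_functor =
  pts :: "('o, 'a) alg \<Rightarrow> 'g monoid"
  pts_map :: "('o, 'a) alg \<Rightarrow> ('o, 'a) alg \<Rightarrow> 'a \<Rightarrow> 'g \<Rightarrow> 'g"

context
  fixes V :: "('o, 'a, 'k::field, 'm) sym_cat_scheme" (structure)
    and G :: "('o, 'a, 'g) alg_functor"
begin

definition group_functor :: bool where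
  "group_functor \<longleftrightarrow>
     (\<forall>A. comm_alg V A \<longrightarrow> group (pts G A) \<and>
        (\<forall>x \<in> carrier (pts G A). pts_map G A A (Id V (aobj A)) x = x)) \<and>
     (\<forall>A B. comm_alg V A \<and> comm_alg V B \<longrightarrow>
        (\<forall>f \<in> alg_hom V A B. pts_map G A B f \<in> hom (pts G A) (pts G B))) \<and>
     (\<forall>A B D. comm_alg V A \<and> comm_alg V B \<and> comm_alg V D \<longrightarrow>
        (\<forall>f \<in> alg_hom V A B. \<forall>g \<in> alg_hom V B D. \<forall>x \<in> carrier (pts G A).
           pts_map G A D (g \<cdot> f) x = pts_map G B D g (pts_map G A B f x)))"

text \<open>\<open>\<Phi>\<close> is a natural bijection from algebra maps \<open>R \<rightarrow> A\<close> to \<open>G(A)\<close>.\<close>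

definition coordinate_ring ::
    "('o, 'a) alg \<Rightarrow> (('o, 'a) alg \<Rightarrow> 'a \<Rightarrow> 'g) \<Rightarrow> bool" where
  "coordinate_ring R \<Phi> \<longleftrightarrow> comm_alg V R \<and>
     (\<forall>A. comm_alg V A \<longrightarrow> bij_betw (\<Phi> A) (alg_hom V R A) (carrier (pts G A))) \<and>
     (\<forall>A B. comm_alg V A \<and> comm_alg V B \<longrightarrow>
        (\<forall>f \<in> alg_hom V R A. \<forall>g \<in> alg_hom V A B. \<Phi> B (g \<cdot> f) = pts_map G A B g (\<Phi> A f)))"

definition affine_group_scheme :: bool where
  "affine_group_scheme \<longleftrightarrow> group_functor \<and> (\<exists>R \<Phi>. coordinate_ring R \<Phi>)"

text \<open>
  The comultiplication corresponds to the product, in \<open>G(R \<otimes> R)\<close>, of the two points given by the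
  inclusions of \<open>R\<close> into \<open>R \<otimes> R\<close>; the counit corresponds to the identity of \<open>G(1)\<close>.
\<close>

definition comult :: "('o, 'a) alg \<Rightarrow> (('o, 'a) alg \<Rightarrow> 'a \<Rightarrow> 'g) \<Rightarrow> 'a" where
  "comult R \<Phi> = (let T = tensor_alg V R R in
     the_inv_into (alg_hom V R T) (\<Phi> T)
       (\<Phi> T (tensor_inl V R R) \<otimes>\<^bsub>pts G T\<^esub> \<Phi> T (tensor_inr V R R)))"

definition counit :: "('o, 'a) alg \<Rightarrow> (('o, 'a) alg \<Rightarrow> 'a \<Rightarrow> 'g) \<Rightarrow> 'a" where
  "counit R \<Phi> =
     the_inv_into (alg_hom V R (unit_alg V)) (\<Phi> (unit_alg V)) \<one>\<^bsub>pts G (unit_alg V)\<^esub>"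

end


section \<open>Tangent space, distributions, invariant derivations\<close>

context
  fixes V :: "('o, 'a, 'k::field, 'm) sym_cat_scheme" (structure)
    and R :: "('o, 'a) alg"
begin

text \<open>
  In the following \<open>\<eta>\<close> is the counit and \<open>\<mm>\<close> its kernel.
  \<open>aug_ideal_power \<eta> n i\<close>: the subobject \<open>i\<close> of \<open>R\<close> is \<open>\<mm>\<^sup>n\<^sup>+\<^sup>1\<close>, that is, \<open>\<mm>\<close> itself for \<open>n = 0\<close> and
  otherwise the image of \<open>\<mm>\<^sup>n \<otimes> \<mm>\<close> under the multiplication.
\<close>

primrec aug_ideal_power :: "'a \<Rightarrow> nat \<Rightarrow> 'a \<Rightarrow> bool" where
  "aug_ideal_power \<eta> 0 i \<longleftrightarrow> is_kernel V \<eta> i"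
| "aug_ideal_power \<eta> (Suc n) i \<longleftrightarrow>
     (\<exists>i' j. aug_ideal_power \<eta> n i' \<and> is_kernel V \<eta> j \<and> is_image V (amul R \<cdot> (i' \<boxdot> j)) i)"

text \<open>
  \<open>T\<close> with evaluation \<open>ev\<close> is the dual of \<open>\<mm>/\<mm>\<^sup>2\<close>, where \<open>j\<close> is the inclusion of \<open>\<mm>\<close> and \<open>q\<close> is the
  projection from \<open>\<mm>\<close> to \<open>\<mm>/\<mm>\<^sup>2\<close>.
\<close>

definition is_tangent_space :: "'a \<Rightarrow> 'a \<Rightarrow> 'a \<Rightarrow> 'o \<Rightarrow> 'a \<Rightarrow> bool" where
  "is_tangent_space \<eta> j q T ev \<longleftrightarrow> is_kernel V \<eta> j \<and>
     (\<exists>i t. aug_ideal_power \<eta> 1 i \<and> t \<in> mor V (Dom V i) (Dom V j) \<and> j \<cdot> t = i \<and>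
        is_cokernel V t q) \<and>
     is_dual V (Cod V q) T ev"

text \<open>
  \<open>E\<close> with evaluation \<open>ev\<close> is \<open>Dist\<^sub>n\<close>, where \<open>p\<close> is the projection from \<open>R\<close> to \<open>R/\<mm>\<^sup>n\<^sup>+\<^sup>1\<close>.
\<close>

definition is_dist :: "'a \<Rightarrow> nat \<Rightarrow> 'a \<Rightarrow> 'o \<Rightarrow> 'a \<Rightarrow> bool" where
  "is_dist \<eta> n p E ev \<longleftrightarrow>
     (\<exists>i. aug_ideal_power \<eta> n i \<and> is_cokernel V i p) \<and> is_dual V (Cod V p) E ev"

text \<open>
  \<open>e : D \<rightarrow> E\<close> is \<open>Dist\<^sub>n\<^sup>+\<close> inside \<open>E = Dist\<^sub>n\<close>: the kernel of the map from \<open>E\<close> to the unit object that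
  evaluates at the unit of \<open>R\<close>.
\<close>

definition is_dist_plus :: "'a \<Rightarrow> nat \<Rightarrow> 'a \<Rightarrow> 'o \<Rightarrow> 'a \<Rightarrow> 'o \<Rightarrow> 'a \<Rightarrow> bool" where
  "is_dist_plus \<eta> n p E ev D e \<longleftrightarrow> is_dist \<eta> n p E ev \<and> e \<in> mor V D E \<and>
     is_kernel V (ev \<cdot> (Id V E \<boxdot> (p \<cdot> aone R)) \<cdot> inverse_arr V (RUnit V E)) e"

definition derivation_action :: "'o \<Rightarrow> 'a \<Rightarrow> bool" where
  "derivation_action X \<beta> \<longleftrightarrow> X \<in> Obj V \<and> \<beta> \<in> mor V (X \<boxtimes> aobj R) (aobj R) \<and>
     \<beta> \<cdot> (Id V X \<boxdot> amul R) \<cdot> Assoc V X (aobj R) (aobj R) =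
     amul R \<cdot> (\<beta> \<boxdot> Id V (aobj R) \<boxplus>
       (Id V (aobj R) \<boxdot> \<beta>) \<cdot> Assoc V (aobj R) X (aobj R) \<cdot> (Braid V X (aobj R) \<boxdot> Id V (aobj R)))"

definition right_invariant :: "'a \<Rightarrow> 'o \<Rightarrow> 'a \<Rightarrow> bool" where
  "right_invariant \<Delta> X \<beta> \<longleftrightarrow>
     \<Delta> \<cdot> \<beta> =
     (\<beta> \<boxdot> Id V (aobj R)) \<cdot> inverse_arr V (Assoc V X (aobj R) (aobj R)) \<cdot> (Id V X \<boxdot> \<Delta>)"

text \<open>
  \<open>D\<close> with universal element \<open>\<beta>\<close> represents the functor sending \<open>X\<close> to the set of actions of \<open>X\<close>
  on \<open>R\<close> by right invariant derivations.
\<close>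

definition represents_derivations :: "'a \<Rightarrow> 'o \<Rightarrow> 'a \<Rightarrow> bool" where
  "represents_derivations \<Delta> D \<beta> \<longleftrightarrow>
     derivation_action D \<beta> \<and> right_invariant \<Delta> D \<beta> \<and>
     (\<forall>X \<beta>'. derivation_action X \<beta>' \<and> right_invariant \<Delta> X \<beta>' \<longrightarrow>
        (\<exists>!u. u \<in> mor V X D \<and> \<beta> \<cdot> (u \<boxdot> Id V (aobj R)) = \<beta>'))"

end

end

theory Submission
  imports Defs
begin

text \<open>
  All three objects represent the functor sending \<open>X\<close> to the set of point derivations
  \<open>h : X \<otimes> \<O>(G) \<rightarrow> 1\<close> at the identity, that is, the maps that vanish on the unit of \<open>\<O>(G)\<close> and on the
  image of \<open>\<mm> \<otimes> \<mm>\<close>; by Yoneda they are canonically isomorphic.  For \<open>(\<mm>/\<mm>\<^sup>2)\<^sup>*\<close> and \<open>Dist\<^sub>1\<^sup>+\<close> this follows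
  from the splitting \<open>\<O>(G) = 1 \<oplus> \<mm>\<close> and the right exactness of the tensor product, which holds because
  tensoring with a rigid object has an adjoint and every object is a filtered colimit of rigid ones.
  A right invariant derivation \<open>\<beta>\<close> corresponds to the point derivation \<open>\<eta> \<circ> \<beta>\<close>, and a point derivation \<open>h\<close>
  to the derivation \<open>(h \<otimes> 1) \<circ> (1 \<otimes> \<Delta>)\<close>; this uses that \<open>\<Delta>\<close> is a coassociative counital algebra map,
  which comes from the group laws by evaluating \<open>G\<close> at \<open>\<O>(G)\<close> and its tensor powers.
\<close>

section \<open>Linear categories\<close>

text \<open>The dual of an object that need not be rigid is known only through pairings: maps
  \<open>X -> D\<close> are maps \<open>X \<boxtimes> A -> \<I>\<close>. This is why everything is
  compared through a test object \<open>X\<close>, and why \<open>X \<boxtimes> -\<close> must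
  preserve the cokernels that define the quotients by \<mm>^2: a pairing with a quotient has to be
  the same as a pairing that vanishes on the ideal. Point derivations are needed in two forms. The
  vanishing form fits the quotients; the Leibniz form h(x, fg) = h(x, f) \<eta>(g) + \<eta>(f) h(x,
  g) is the one that can be translated by \<Delta>. They agree because f = (f - \<eta>(f) 1) +
  \<eta>(f) 1. The object of invariant derivations is not constructed separately: the tangent space,
  with its pairing translated, represents it. The main obstacle is that objects have no elements and
  the tensor product is not strict, so the short computations in Sweedler notation carry associators
  and braidings; most of the work on symmetric monoidal categories serves to normalise these
  away.\<close>

declare mor_def [simp]

context category
begin

lemma arr_objs [simp]:
  assumes "f \<in> Arr C"
  shows "Dom C f \<in> Obj C" "Cod C f \<in> Obj C"
  using assms dom_obj cod_obj by auto

lemma Id_arr [simp]: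
  assumes "X \<in> Obj C"
  shows "Id C X \<in> Arr C" "Dom C (Id C X) = X" "Cod C (Id C X) = X"
  using id_mor[OF assms] by auto

text \<open>A single side condition for the rewrite rules below: the inner arrow exists and its
  codomain fits. Its defining equation is a simp rule, so the condition is unfolded when it is
  discharged.\<close>

definition composable :: "'a \<Rightarrow> 'a \<Rightarrow> bool" where
  composable_iff [simp]: "composable g f \<longleftrightarrow> f \<in> Arr C \<and> Cod C f = Dom C g"

lemma comp_arr [simp]:
  assumes "g \<in> Arr C" "composable g f"
  shows "g \<cdot> f \<in> Arr C" "Dom C (g \<cdot> f) = Dom C f" "Cod C (g \<cdot> f) = Cod C g"
  using comp_mor[of f "Dom C f" "Cod C f" g "Cod C g"] assms by auto

lemma comp_Id [simp]:
  assumes "f \<in> Arr C"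
  shows "Dom C f = X \<Longrightarrow> f \<cdot> Id C X = f" "Cod C f = Y \<Longrightarrow> Id C Y \<cdot> f = f"
  using comp_id_left comp_id_right assms by auto

lemma comp_assoc_arr [simp]:
  assumes "h \<in> Arr C" "composable h g" "composable g f"
  shows "(h \<cdot> g) \<cdot> f = h \<cdot> (g \<cdot> f)"
  using comp_assoc[of f "Dom C f" "Cod C f" g "Cod C g" h "Cod C h"] assms by auto

text \<open>Composites are kept nested to the right, where the left side of
  \<open>g \<cdot> f = h\<close> is no longer a subterm once something precedes \<open>f\<close>.
  The form \<open>reassoc[OF ...]\<close> supplies the variant that applies there.\<close>

lemma reassoc:
  assumes "g \<cdot> f = h" "g \<in> Arr C" "composable g f" "composable f x"
  shows "g \<cdot> (f \<cdot> x) = h \<cdot> x"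
  using assms comp_assoc_arr[of x f g] by auto

lemma is_inverse_unique:
  assumes "is_inverse C f g" "is_inverse C f h"
  shows "g = h"
proof -
  have "h \<cdot> (f \<cdot> g) = (h \<cdot> f) \<cdot> g"
    using assms unfolding is_inverse_def by (intro comp_assoc_arr[symmetric]) auto
  then show ?thesis using assms unfolding is_inverse_def by auto
qed

lemma inverse_arr_eq: "is_inverse C f g \<Longrightarrow> inverse_arr C f = g"
  unfolding inverse_arr_def using is_inverse_unique by blast

lemma iso_inverse:
  assumes "f \<in> isos C X Y"
  shows "f \<in> Arr C" "Dom C f = X" "Cod C f = Y" "inverse_arr C f \<in> Arr C"
    "Dom C (inverse_arr C f) = Y" "Cod C (inverse_arr C f) = X"
    "inverse_arr C f \<cdot> f = Id C X" "f \<cdot> inverse_arr C f = Id C Y"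
proof -
  obtain g where g: "is_inverse C f g" using assms unfolding isos_def by auto
  then have "inverse_arr C f = g" by (rule inverse_arr_eq)
  with g assms show "f \<in> Arr C" "Dom C f = X" "Cod C f = Y" "inverse_arr C f \<in> Arr C"
    "Dom C (inverse_arr C f) = Y" "Cod C (inverse_arr C f) = X"
    "inverse_arr C f \<cdot> f = Id C X" "f \<cdot> inverse_arr C f = Id C Y"
    unfolding isos_def is_inverse_def by auto
qed

lemma iso_inverse_comp:
  assumes "f \<in> isos C X Y" "x \<in> Arr C"
  shows "Cod C x = X \<Longrightarrow> inverse_arr C f \<cdot> (f \<cdot> x) = x"
    "Cod C x = Y \<Longrightarrow> f \<cdot> (inverse_arr C f \<cdot> x) = x"
  using assms iso_inverse[OF assms(1)] reassoc[of "inverse_arr C f" f "Id C X" x]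
   reassoc[of f "inverse_arr C f" "Id C Y" x] by auto

lemma isosI:
  assumes "f \<in> mor C X Y" "g \<in> mor C Y X" "g \<cdot> f = Id C X" "f \<cdot> g = Id C Y"
  shows "f \<in> isos C X Y" "inverse_arr C f = g"
proof -
  have "is_inverse C f g" using assms unfolding is_inverse_def by auto
  then show "f \<in> isos C X Y" "inverse_arr C f = g"
    using assms inverse_arr_eq unfolding isos_def by auto
qed

lemma iso_cancel_left:
  assumes "f \<cdot> g = f \<cdot> h" "f \<in> isos C X Y" "g \<in> Arr C" "h \<in> Arr C" "Cod C g = X" "Cod C h = X"
  shows "g = h"
  using iso_inverse_comp(1)[OF assms(2,3,5)] iso_inverse_comp(1)[OF assms(2,4,6)] assms(1) by metis

lemma iso_cancel_right:
  assumes "g \<cdot> f = h \<cdot> f" "f \<in> isos C X Y" "g \<in> Arr C" "h \<in> Arr C" "Dom C g = Y" "Dom C h = Y"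
  shows "g = h"
proof -
  have "k = (k \<cdot> f) \<cdot> inverse_arr C f" if "k \<in> Arr C" "Dom C k = Y" for k
    using that iso_inverse[OF assms(2)] by simp
  then show ?thesis using assms by metis
qed

end

context linear_category
begin

lemma Zero_arr [simp]:
  assumes "X \<in> Obj C" "Y \<in> Obj C"
  shows "Zero C X Y \<in> Arr C" "Dom C (Zero C X Y) = X" "Cod C (Zero C X Y) = Y"
  using zero_mor[OF assms] by auto

lemma Add_arr [simp]:
  assumes "f \<in> Arr C" "g \<in> Arr C" "Dom C f = Dom C g" "Cod C f = Cod C g"
  shows "f \<boxplus> g \<in> Arr C" "Dom C (f \<boxplus> g) = Dom C g" "Cod C (f \<boxplus> g) = Cod C g"
  using add_mor[of f "Dom C g" "Cod C g" g] assms by auto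

lemma Add_left_cancel:
  assumes "f \<boxplus> g = f \<boxplus> h" "f \<in> mor C X Y" "g \<in> mor C X Y" "h \<in> mor C X Y"
  shows "g = h"
proof -
  obtain f' where f': "f' \<in> mor C X Y" "f \<boxplus> f' = Zero C X Y" using add_inverse[OF assms(2)] by blast
  have "k = f' \<boxplus> (f \<boxplus> k)" if k: "k \<in> mor C X Y" for k
  proof -
    have "f' \<boxplus> (f \<boxplus> k) = (f \<boxplus> f') \<boxplus> k"
      using add_assoc[OF f'(1) assms(2) k] add_commute[OF f'(1) assms(2)] by simp
    also have "\<dots> = k \<boxplus> Zero C X Y" using f' k add_commute[of k X Y "Zero C X Y"] add_mor[OF assms(2) f'(1)] by simp
    finally show ?thesis using add_zero[OF k] by simp
  qed
  then show ?thesis using assms by metis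
qed

lemma Add_eq_self:
  assumes "f \<boxplus> g = f" "f \<in> mor C X Y" "g \<in> mor C X Y"
  shows "g = Zero C X Y"
proof (rule Add_left_cancel[of f])
  have "X \<in> Obj C" "Y \<in> Obj C" using assms by auto
  then show "Zero C X Y \<in> mor C X Y" by (rule zero_mor)
  show "f \<boxplus> g = f \<boxplus> Zero C X Y" using assms add_zero[OF assms(2)] by simp
qed (fact assms)+

lemma Add_Zero [simp]:
  assumes "f \<in> Arr C" "Dom C f = X" "Cod C f = Y"
  shows "f \<boxplus> Zero C X Y = f" "Zero C X Y \<boxplus> f = f"
proof -
  show *: "f \<boxplus> Zero C X Y = f" using assms add_zero by auto
  have "X \<in> Obj C" "Y \<in> Obj C" using assms by auto
  then show "Zero C X Y \<boxplus> f = f" using * assms add_commute[of f X Y "Zero C X Y"] by simp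
qed

lemma comp_Add:
  assumes "f \<in> Arr C" "f' \<in> Arr C" "g \<in> Arr C" "Dom C f = Dom C f'" "Cod C f = Cod C f'"
    "Cod C f' = Dom C g"
  shows "g \<cdot> (f \<boxplus> f') = g \<cdot> f \<boxplus> g \<cdot> f'"
  using comp_add_right[of f _ _ f' g] assms by auto

lemma Add_comp:
  assumes "g \<in> Arr C" "g' \<in> Arr C" "f \<in> Arr C" "Dom C g = Dom C g'" "Cod C g = Cod C g'"
    "Cod C f = Dom C g'"
  shows "(g \<boxplus> g') \<cdot> f = g \<cdot> f \<boxplus> g' \<cdot> f"
  using comp_add_left[of f _ _ g _ g'] assms by auto

lemma comp_Zero [simp]:
  assumes "g \<in> Arr C" "Dom C g = Y" "X \<in> Obj C"
  shows "g \<cdot> Zero C X Y = Zero C X (Cod C g)"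
proof (rule Add_eq_self)
  have "Y \<in> Obj C" using assms by auto
  then show "g \<cdot> Zero C X Y \<boxplus> g \<cdot> Zero C X Y = g \<cdot> Zero C X Y"
    using assms comp_Add[of "Zero C X Y" "Zero C X Y" g] by simp
qed (use assms in auto)

lemma Zero_comp [simp]:
  assumes "f \<in> Arr C" "Cod C f = X" "Y \<in> Obj C"
  shows "Zero C X Y \<cdot> f = Zero C (Dom C f) Y"
proof (rule Add_eq_self)
  have "X \<in> Obj C" using assms by auto
  then show "Zero C X Y \<cdot> f \<boxplus> Zero C X Y \<cdot> f = Zero C X Y \<cdot> f"
    using assms Add_comp[of "Zero C X Y" "Zero C X Y" f] by simp
qed (use assms in auto)

lemma is_cokernelI:
  assumes "f \<in> Arr C" "q \<in> Arr C" "Dom C q = Cod C f" "q \<cdot> f = Zero C (Dom C f) (Cod C q)"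
    and "\<And>W h. h \<in> mor C (Cod C f) W \<Longrightarrow> h \<cdot> f = Zero C (Dom C f) W \<Longrightarrow> \<exists>u \<in> mor C (Cod C q) W. u \<cdot> q = h"
    and "\<And>W u v. u \<in> mor C (Cod C q) W \<Longrightarrow> v \<in> mor C (Cod C q) W \<Longrightarrow> u \<cdot> q = v \<cdot> q \<Longrightarrow> u = v"
  shows "is_cokernel C f q"
  unfolding is_cokernel_def using assms by (metis (no_types, lifting))

lemma is_cokernel_arr:
  assumes "is_cokernel C f q"
  shows "f \<in> Arr C" "q \<in> Arr C" "Dom C q = Cod C f" "q \<cdot> f = Zero C (Dom C f) (Cod C q)"
  using assms by (auto simp: is_cokernel_def)

lemma cokernel_factor:
  assumes "is_cokernel C f q" "h \<in> mor C (Cod C f) W" "h \<cdot> f = Zero C (Dom C f) W"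
  obtains u where "u \<in> mor C (Cod C q) W" "u \<cdot> q = h"
  using assms unfolding is_cokernel_def by blast

lemma cokernel_epi:
  assumes "is_cokernel C f q" "u \<in> mor C (Cod C q) W" "v \<in> mor C (Cod C q) W" "u \<cdot> q = v \<cdot> q"
  shows "u = v"
proof -
  note [simp] = is_cokernel_arr[OF assms(1)]
  have "u \<cdot> q \<in> mor C (Cod C f) W" using assms(2) by simp
  moreover have "(u \<cdot> q) \<cdot> f = Zero C (Dom C f) W" using assms(2) by auto
  ultimately have "\<exists>!w. w \<in> mor C (Cod C q) W \<and> w \<cdot> q = u \<cdot> q"
    using assms(1) unfolding is_cokernel_def by blast
  then show ?thesis using assms(2-4) by metis
qed

lemma kernel_arr:
  assumes "is_kernel C f i"
  shows "f \<in> Arr C" "i \<in> Arr C" "Cod C i = Dom C f" "f \<cdot> i = Zero C (Dom C i) (Cod C f)"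
  using assms by (auto simp: is_kernel_def)

lemma kernel_factor:
  assumes "is_kernel C f i" "h \<in> mor C W (Dom C f)" "f \<cdot> h = Zero C W (Cod C f)"
  obtains u where "u \<in> mor C W (Dom C i)" "i \<cdot> u = h"
  using assms unfolding is_kernel_def by blast

lemma kernel_mono:
  assumes "is_kernel C f i" "u \<in> mor C W (Dom C i)" "v \<in> mor C W (Dom C i)" "i \<cdot> u = i \<cdot> v"
  shows "u = v"
proof -
  note [simp] = kernel_arr[OF assms(1)]
  have "i \<cdot> u \<in> mor C W (Dom C f)" using assms(2) by simp
  moreover have "f \<cdot> i \<cdot> u = Zero C W (Cod C f)"
    using assms(2) reassoc[OF kernel_arr(4)[OF assms(1)], of u] by auto
  ultimately have "\<exists>!w. w \<in> mor C W (Dom C i) \<and> i \<cdot> w = i \<cdot> u"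
    using assms(1) unfolding is_kernel_def by blast
  then show ?thesis using assms(2-4) by metis
qed

text \<open>Since \<open>c\<close> kills \<open>f\<close>, the arrow \<open>f\<close> factors
  through \<open>i\<close>, so whatever kills \<open>i\<close> kills \<open>f\<close> and factors
  through \<open>c\<close>. Images are defined as kernels of cokernels; thus the cokernel of a map
  is also the cokernel of its image.\<close>

lemma cokernel_of_kernel:
  assumes "is_cokernel C f c" "is_kernel C c i"
  shows "is_cokernel C i c"
proof (rule is_cokernelI)
  note [simp] = is_cokernel_arr[OF assms(1)] kernel_arr[OF assms(2)]
  obtain w where w: "w \<in> mor C (Dom C f) (Dom C i)" "i \<cdot> w = f"
    by (rule kernel_factor[OF assms(2), of f "Dom C f"]) simp_all
  show "\<exists>u\<in>mor C (Cod C c) W. u \<cdot> c = h"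
    if h: "h \<in> mor C (Cod C i) W" "h \<cdot> i = Zero C (Dom C i) W" for W h
  proof -
    have "h \<cdot> f = (h \<cdot> i) \<cdot> w" using h(1) w by simp
    also have "\<dots> = Zero C (Dom C f) W" unfolding h(2) using h(1) w(1) by auto
    finally show ?thesis using cokernel_factor[OF assms(1), of h W] h(1) by auto
  qed
  show "\<And>W u v. u \<in> mor C (Cod C c) W \<Longrightarrow> v \<in> mor C (Cod C c) W \<Longrightarrow> u \<cdot> c = v \<cdot> c \<Longrightarrow> u = v"
    by (rule cokernel_epi[OF assms(1)])
qed (use is_cokernel_arr[OF assms(1)] kernel_arr[OF assms(2)] in simp_all)

text \<open>Two arrows that factor through each other are killed by the same arrows. This absorbs
  the freedom in the choice of kernels in \<open>aug_ideal_power\<close>.\<close>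

lemma cokernel_cong:
  assumes "is_cokernel C f c" "g \<in> Arr C" "Cod C g = Cod C f"
    and "u \<in> mor C (Dom C g) (Dom C f)" "g = f \<cdot> u" "v \<in> mor C (Dom C f) (Dom C g)" "f = g \<cdot> v"
  shows "is_cokernel C g c"
proof (rule is_cokernelI)
  note [simp] = is_cokernel_arr[OF assms(1)] assms(2,3)
  show "c \<cdot> g = Zero C (Dom C g) (Cod C c)"
    using assms(4) reassoc[OF is_cokernel_arr(4)[OF assms(1)], of u] by (subst assms(5)) auto
  show "\<exists>u\<in>mor C (Cod C c) W. u \<cdot> c = h"
    if h: "h \<in> mor C (Cod C g) W" "h \<cdot> g = Zero C (Dom C g) W" for W h
  proof -
    have "h \<cdot> f = (h \<cdot> g) \<cdot> v" using h(1) assms(6) by (subst assms(7)) simp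
    also have "\<dots> = Zero C (Dom C f) W" unfolding h(2) using h(1) assms(6) by auto
    finally show ?thesis using cokernel_factor[OF assms(1), of h W] h(1) by auto
  qed
  show "\<And>W u v. u \<in> mor C (Cod C c) W \<Longrightarrow> v \<in> mor C (Cod C c) W \<Longrightarrow> u \<cdot> c = v \<cdot> c \<Longrightarrow> u = v"
    by (rule cokernel_epi[OF assms(1)])
qed (use is_cokernel_arr[OF assms(1)] assms(2,3) in simp_all)

end

section \<open>Coherence in symmetric monoidal categories\<close>

context symmetric_monoidal_category
begin

abbreviation unit_object ("\<I>") where "\<I> \<equiv> Unit V"
abbreviation lwhisker (infixr "\<triangleright>" 76) where "X \<triangleright> f \<equiv> Id V X \<boxdot> f"
abbreviation rwhisker (infixl "\<triangleleft>" 77) where "f \<triangleleft> X \<equiv> f \<boxdot> Id V X"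
abbreviation as where "as \<equiv> Assoc V"
abbreviation as' where "as' X Y Z \<equiv> inverse_arr V (Assoc V X Y Z)"
abbreviation lu where "lu \<equiv> LUnit V"
abbreviation lu' where "lu' X \<equiv> inverse_arr V (LUnit V X)"
abbreviation ru where "ru \<equiv> RUnit V"
abbreviation ru' where "ru' X \<equiv> inverse_arr V (RUnit V X)"
abbreviation br where "br \<equiv> Braid V"

lemma unit_obj' [simp]: "\<I> \<in> Obj V" by (rule unit_obj)

lemma tens_obj' [simp]: "X \<in> Obj V \<Longrightarrow> Y \<in> Obj V \<Longrightarrow> X \<boxtimes> Y \<in> Obj V" by (rule tens_obj)

lemma tens_arr [simp]:
  assumes "f \<in> Arr V" "g \<in> Arr V"
  shows "f \<boxdot> g \<in> Arr V" "Dom V (f \<boxdot> g) = Dom V f \<boxtimes> Dom V g" "Cod V (f \<boxdot> g) = Cod V f \<boxtimes> Cod V g"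
  using tens_mor[of f "Dom V f" "Cod V f" g "Dom V g" "Cod V g"] assms by auto

lemma tens_Id [simp]: "X \<in> Obj V \<Longrightarrow> Y \<in> Obj V \<Longrightarrow> Id V X \<boxdot> Id V Y = Id V (X \<boxtimes> Y)"
  by (rule tens_id)

lemma assoc_arr [simp]:
  assumes "X \<in> Obj V" "Y \<in> Obj V" "Z \<in> Obj V"
  shows "as X Y Z \<in> Arr V" "Dom V (as X Y Z) = X \<boxtimes> Y \<boxtimes> Z" "Cod V (as X Y Z) = X \<boxtimes> (Y \<boxtimes> Z)"
    "as' X Y Z \<in> Arr V" "Cod V (as' X Y Z) = X \<boxtimes> Y \<boxtimes> Z" "Dom V (as' X Y Z) = X \<boxtimes> (Y \<boxtimes> Z)"
    "as X Y Z \<cdot> as' X Y Z = Id V (X \<boxtimes> (Y \<boxtimes> Z))" "as' X Y Z \<cdot> as X Y Z = Id V (X \<boxtimes> Y \<boxtimes> Z)"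
    "x \<in> Arr V \<Longrightarrow> Cod V x = X \<boxtimes> (Y \<boxtimes> Z) \<Longrightarrow> as X Y Z \<cdot> as' X Y Z \<cdot> x = x"
    "x \<in> Arr V \<Longrightarrow> Cod V x = X \<boxtimes> Y \<boxtimes> Z \<Longrightarrow> as' X Y Z \<cdot> as X Y Z \<cdot> x = x"
  using iso_inverse[OF assoc_iso[OF assms]] iso_inverse_comp[OF assoc_iso[OF assms]] by simp_all

lemma lunit_arr [simp]:
  assumes "X \<in> Obj V"
  shows "lu X \<in> Arr V" "Dom V (lu X) = \<I> \<boxtimes> X" "Cod V (lu X) = X"
    "lu' X \<in> Arr V" "Cod V (lu' X) = \<I> \<boxtimes> X" "Dom V (lu' X) = X"
    "lu X \<cdot> lu' X = Id V X" "lu' X \<cdot> lu X = Id V (\<I> \<boxtimes> X)"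
    "x \<in> Arr V \<Longrightarrow> Cod V x = X \<Longrightarrow> lu X \<cdot> lu' X \<cdot> x = x"
    "x \<in> Arr V \<Longrightarrow> Cod V x = \<I> \<boxtimes> X \<Longrightarrow> lu' X \<cdot> lu X \<cdot> x = x"
  using iso_inverse[OF lunit_iso[OF assms]] iso_inverse_comp[OF lunit_iso[OF assms]] by simp_all

lemma runit_arr [simp]:
  assumes "X \<in> Obj V"
  shows "ru X \<in> Arr V" "Dom V (ru X) = X \<boxtimes> \<I>" "Cod V (ru X) = X"
    "ru' X \<in> Arr V" "Cod V (ru' X) = X \<boxtimes> \<I>" "Dom V (ru' X) = X"
    "ru X \<cdot> ru' X = Id V X" "ru' X \<cdot> ru X = Id V (X \<boxtimes> \<I>)"
    "x \<in> Arr V \<Longrightarrow> Cod V x = X \<Longrightarrow> ru X \<cdot> ru' X \<cdot> x = x"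
    "x \<in> Arr V \<Longrightarrow> Cod V x = X \<boxtimes> \<I> \<Longrightarrow> ru' X \<cdot> ru X \<cdot> x = x"
  using iso_inverse[OF runit_iso[OF assms]] iso_inverse_comp[OF runit_iso[OF assms]] by simp_all

lemma braid_arr [simp]:
  assumes "X \<in> Obj V" "Y \<in> Obj V"
  shows "br X Y \<in> Arr V" "Dom V (br X Y) = X \<boxtimes> Y" "Cod V (br X Y) = Y \<boxtimes> X"
    "br Y X \<cdot> br X Y = Id V (X \<boxtimes> Y)"
    "x \<in> Arr V \<Longrightarrow> Cod V x = X \<boxtimes> Y \<Longrightarrow> br Y X \<cdot> br X Y \<cdot> x = x"
proof -
  show *: "br X Y \<in> Arr V" "Dom V (br X Y) = X \<boxtimes> Y" "Cod V (br X Y) = Y \<boxtimes> X"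
    "br Y X \<cdot> br X Y = Id V (X \<boxtimes> Y)" using braid_mor[OF assms] braid_symmetric[OF assms] by auto
  show "br Y X \<cdot> br X Y \<cdot> x = x" if "x \<in> Arr V" "Cod V x = X \<boxtimes> Y"
    using that reassoc[OF *(4), of x] * assms braid_mor[of Y X] by auto
qed

lemma tens_comp_arr:
  assumes "f \<in> Arr V" "g \<in> Arr V" "f' \<in> Arr V" "g' \<in> Arr V" "Cod V f = Dom V g" "Cod V f' = Dom V g'"
  shows "(g \<boxdot> g') \<cdot> (f \<boxdot> f') = (g \<cdot> f) \<boxdot> (g' \<cdot> f')"
  using tens_comp[of f _ _ g _ f' _ _ g'] assms by auto

lemma lwhisker_comp:
  assumes "f \<in> Arr V" "g \<in> Arr V" "Cod V f = Dom V g" "X \<in> Obj V"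
  shows "X \<triangleright> (g \<cdot> f) = X \<triangleright> g \<cdot> X \<triangleright> f"
  using assms by (simp add: tens_comp_arr)

lemma rwhisker_comp:
  assumes "f \<in> Arr V" "g \<in> Arr V" "Cod V f = Dom V g" "X \<in> Obj V"
  shows "(g \<cdot> f) \<triangleleft> X = g \<triangleleft> X \<cdot> f \<triangleleft> X"
  using assms by (simp add: tens_comp_arr)

lemma lwhisker_merge:
  assumes "f \<in> Arr V" "g \<in> Arr V" "Cod V f = Dom V g" "X \<in> Obj V"
  shows "X \<triangleright> g \<cdot> X \<triangleright> f = X \<triangleright> (g \<cdot> f)"
    "x \<in> Arr V \<Longrightarrow> Cod V x = X \<boxtimes> Dom V f \<Longrightarrow> X \<triangleright> g \<cdot> (X \<triangleright> f \<cdot> x) = X \<triangleright> (g \<cdot> f) \<cdot> x"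
proof -
  show *: "X \<triangleright> g \<cdot> X \<triangleright> f = X \<triangleright> (g \<cdot> f)" using assms by (simp add: tens_comp_arr)
  show "x \<in> Arr V \<Longrightarrow> Cod V x = X \<boxtimes> Dom V f \<Longrightarrow> X \<triangleright> g \<cdot> (X \<triangleright> f \<cdot> x) = X \<triangleright> (g \<cdot> f) \<cdot> x"
    using reassoc[OF *, of x] assms by simp
qed

text \<open>The interchange law, oriented so that the arrow on the left factor acts before the one
  on the right factor.\<close>

lemma rwhisker_natr:
  assumes "f \<in> Arr V" "g \<in> Arr V" "Dom V f = X" "Cod V g = Z"
  shows "f \<triangleleft> Z \<cdot> X \<triangleright> g = Cod V f \<triangleright> g \<cdot> f \<triangleleft> Dom V g"
  using assms by (auto simp add: tens_comp_arr)

lemma tens_split: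
  assumes "f \<in> Arr V" "g \<in> Arr V"
  shows "f \<boxdot> g = f \<triangleleft> Cod V g \<cdot> Dom V f \<triangleright> g"
  using assms by (simp add: tens_comp_arr)

lemma as_nat:
  assumes "f \<in> Arr V" "g \<in> Arr V" "h \<in> Arr V"
  shows "as (Cod V f) (Cod V g) (Cod V h) \<cdot> (f \<boxdot> g \<boxdot> h) = f \<boxdot> (g \<boxdot> h) \<cdot> as (Dom V f) (Dom V g) (Dom V h)"
  using assms by (simp add: assoc_natural)

text \<open>Naturality of the associator, solved for the product bracketed to the left. As a rewrite
  rule it moves brackets to the right at the cost of associators at both ends, which cancel between
  neighbours.\<close>

lemma tail_conj:
  assumes "f \<in> Arr V" "g \<in> Arr V" "h \<in> Arr V"
  shows "f \<boxdot> g \<boxdot> h = as' (Cod V f) (Cod V g) (Cod V h) \<cdot> f \<boxdot> (g \<boxdot> h) \<cdot> as (Dom V f) (Dom V g) (Dom V h)"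
  using assms by (simp flip: as_nat)

lemma tail_rules:
  assumes "f \<in> Arr V" "X \<in> Obj V" "Z \<in> Obj V"
  shows "(X \<triangleright> f) \<triangleleft> Z = as' X (Cod V f) Z \<cdot> X \<triangleright> (f \<triangleleft> Z) \<cdot> as X (Dom V f) Z"
    "f \<triangleleft> X \<triangleleft> Z = as' (Cod V f) X Z \<cdot> f \<triangleleft> (X \<boxtimes> Z) \<cdot> as (Dom V f) X Z"
    "(X \<boxtimes> Z) \<triangleright> f = as' X Z (Cod V f) \<cdot> X \<triangleright> (Z \<triangleright> f) \<cdot> as X Z (Dom V f)"
  using assms tail_conj[of "Id V X" f "Id V Z"] tail_conj[of f "Id V X" "Id V Z"]
    tail_conj[of "Id V X" "Id V Z" f] by auto

lemma as'_nat:
  assumes "f \<in> Arr V" "g \<in> Arr V" "h \<in> Arr V"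
  shows "as' (Cod V f) (Cod V g) (Cod V h) \<cdot> (f \<boxdot> (g \<boxdot> h)) = (f \<boxdot> g \<boxdot> h) \<cdot> as' (Dom V f) (Dom V g) (Dom V h)"
  using assms by (simp add: tail_conj)

text \<open>\<open>ru\<close> is a natural isomorphism from \<open>- \<boxtimes> \<I>\<close> to the
  identity functor, so an arrow can be recovered from its whiskering by \<I>.\<close>

lemma unit_faithful:
  assumes "f \<in> Arr V" "g \<in> Arr V" "Dom V f = Dom V g" "Cod V f = Cod V g" "f \<triangleleft> \<I> = g \<triangleleft> \<I>"
  shows "f = g"
proof -
  have "f \<cdot> ru (Dom V f) = g \<cdot> ru (Dom V f)"
    using runit_natural[of f "Dom V f" "Cod V f"] runit_natural[of g "Dom V f" "Cod V f"] assms by auto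
  then show ?thesis by (rule iso_cancel_right[OF _ runit_iso]) (use assms in simp_all)
qed

lemma unit_faithful_left:
  assumes "f \<in> Arr V" "g \<in> Arr V" "Dom V f = Dom V g" "Cod V f = Cod V g" "\<I> \<triangleright> f = \<I> \<triangleright> g"
  shows "f = g"
proof -
  have "f \<cdot> lu (Dom V f) = g \<cdot> lu (Dom V f)"
    using lunit_natural[of f "Dom V f" "Cod V f"] lunit_natural[of g "Dom V f" "Cod V f"] assms by auto
  then show ?thesis by (rule iso_cancel_right[OF _ lunit_iso]) (use assms in simp_all)
qed

text \<open>The pentagon, solved for the one associator that is whiskered on the right.\<close>

lemma as_tail:
  assumes "X \<in> Obj V" "Y \<in> Obj V" "W \<in> Obj V" "Z \<in> Obj V"
  shows "as X Y W \<triangleleft> Z = as' X (Y \<boxtimes> W) Z \<cdot> X \<triangleright> as' Y W Z \<cdot> as X Y (W \<boxtimes> Z) \<cdot> as (X \<boxtimes> Y) W Z"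
  using assms by (simp flip: pentagon) (simp add: lwhisker_merge)

lemma as'_tail:
  assumes "X \<in> Obj V" "Y \<in> Obj V" "W \<in> Obj V" "Z \<in> Obj V"
  shows "as' X Y W \<triangleleft> Z = as' (X \<boxtimes> Y) W Z \<cdot> as' X Y (W \<boxtimes> Z) \<cdot> X \<triangleright> as Y W Z \<cdot> as X (Y \<boxtimes> W) Z"
proof (rule iso_cancel_left)
  show "as X Y W \<triangleleft> Z \<in> isos V (X \<boxtimes> Y \<boxtimes> W \<boxtimes> Z) (X \<boxtimes> (Y \<boxtimes> W) \<boxtimes> Z)"
    using assms by (intro isosI(1)[of _ _ _ "as' X Y W \<triangleleft> Z"]) (simp_all flip: rwhisker_comp)
  have "as X Y W \<triangleleft> Z \<cdot> as' X Y W \<triangleleft> Z = Id V (X \<boxtimes> (Y \<boxtimes> W) \<boxtimes> Z)"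
    using assms by (simp flip: rwhisker_comp)
  moreover have "as X Y W \<triangleleft> Z \<cdot> as' (X \<boxtimes> Y) W Z \<cdot> as' X Y (W \<boxtimes> Z) \<cdot> X \<triangleright> as Y W Z \<cdot> as X (Y \<boxtimes> W) Z
    = Id V (X \<boxtimes> (Y \<boxtimes> W) \<boxtimes> Z)" using assms by (simp add: as_tail lwhisker_merge)
  ultimately show "as X Y W \<triangleleft> Z \<cdot> as' X Y W \<triangleleft> Z = as X Y W \<triangleleft> Z \<cdot> as' (X \<boxtimes> Y) W Z \<cdot> as' X Y (W \<boxtimes> Z) \<cdot> X \<triangleright> as Y W Z \<cdot> as X (Y \<boxtimes> W) Z"
    by simp
qed (use assms in simp_all)

lemma ru_tail:
  assumes "X \<in> Obj V" "Z \<in> Obj V"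
  shows "ru X \<triangleleft> Z = X \<triangleright> lu Z \<cdot> as X \<I> Z"
  using assms by (simp add: triangle)

text \<open>Kelly's observation that this unit triangle follows from the pentagon and the middle
  triangle. After whiskering with \<I> on the left, the pentagon for \<I>, \<I>, \<open>X\<close>,
  \<open>Y\<close> is combined with two instances of \<open>ru_tail\<close>; the auxiliary
  associators \<open>?b\<close> and \<open>?a\<close> are then cancelled.\<close>

lemma lu_tail:
  assumes "X \<in> Obj V" "Y \<in> Obj V"
  shows "lu X \<triangleleft> Y = lu (X \<boxtimes> Y) \<cdot> as \<I> X Y"
proof (rule unit_faithful_left)
  let ?a = "as \<I> (\<I> \<boxtimes> X) Y" and ?b = "as \<I> \<I> X \<triangleleft> Y"
  have b: "?b \<in> isos V ((\<I> \<boxtimes> \<I>) \<boxtimes> X \<boxtimes> Y) (\<I> \<boxtimes> (\<I> \<boxtimes> X) \<boxtimes> Y)"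
    using assms by (intro isosI(1)[of _ _ _ "as' \<I> \<I> X \<triangleleft> Y"]) (simp_all flip: rwhisker_comp)
  have "(\<I> \<triangleright> (lu (X \<boxtimes> Y) \<cdot> as \<I> X Y) \<cdot> ?a) \<cdot> ?b = \<I> \<triangleright> lu (X \<boxtimes> Y) \<cdot> (\<I> \<triangleright> as \<I> X Y \<cdot> ?a \<cdot> ?b)"
    using assms by (simp add: lwhisker_comp)
  also have "\<dots> = (ru \<I> \<triangleleft> (X \<boxtimes> Y)) \<cdot> as (\<I> \<boxtimes> \<I>) X Y" using assms by (simp add: pentagon ru_tail)
  also have "\<dots> = as \<I> X Y \<cdot> (ru \<I> \<triangleleft> X \<triangleleft> Y)" using assms by (simp add: tail_rules)
  also have "\<dots> = as \<I> X Y \<cdot> ((\<I> \<triangleright> lu X) \<triangleleft> Y) \<cdot> ?b" using assms by (simp add: ru_tail rwhisker_comp)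
  also have "\<dots> = (\<I> \<triangleright> (lu X \<triangleleft> Y) \<cdot> ?a) \<cdot> ?b" using assms by (simp add: tail_rules)
  finally have "\<I> \<triangleright> (lu (X \<boxtimes> Y) \<cdot> as \<I> X Y) \<cdot> ?a = \<I> \<triangleright> (lu X \<triangleleft> Y) \<cdot> ?a"
    by (rule iso_cancel_right[OF _ b]) (use assms in simp_all)
  from this[symmetric] show "\<I> \<triangleright> (lu X \<triangleleft> Y) = \<I> \<triangleright> (lu (X \<boxtimes> Y) \<cdot> as \<I> X Y)"
    by (rule iso_cancel_right[OF _ assoc_iso]) (use assms in simp_all)
qed (use assms in simp_all)

lemma lu_nat:
  assumes "f \<in> Arr V" "Cod V f = Y"
  shows "lu Y \<cdot> \<I> \<triangleright> f = f \<cdot> lu (Dom V f)"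
  using assms lunit_natural[of f "Dom V f" Y] by simp

lemma ru_nat:
  assumes "f \<in> Arr V" "Cod V f = Y"
  shows "ru Y \<cdot> f \<triangleleft> \<I> = f \<cdot> ru (Dom V f)"
  using assms runit_natural[of f "Dom V f" Y] by simp

lemma lu'_nat:
  assumes "f \<in> Arr V" "Cod V f = Y"
  shows "lu' Y \<cdot> f = \<I> \<triangleright> f \<cdot> lu' (Dom V f)"
proof -
  have "f = lu Y \<cdot> \<I> \<triangleright> f \<cdot> lu' (Dom V f)" using assms reassoc[OF lu_nat[OF assms]] by auto
  then have "lu' Y \<cdot> f = lu' Y \<cdot> lu Y \<cdot> \<I> \<triangleright> f \<cdot> lu' (Dom V f)" by simp
  then show ?thesis using assms by auto
qed

lemma ru'_nat:
  assumes "f \<in> Arr V" "Cod V f = Y"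
  shows "ru' Y \<cdot> f = f \<triangleleft> \<I> \<cdot> ru' (Dom V f)"
proof -
  have "f = ru Y \<cdot> f \<triangleleft> \<I> \<cdot> ru' (Dom V f)" using assms reassoc[OF ru_nat[OF assms]] by auto
  then have "ru' Y \<cdot> f = ru' Y \<cdot> ru Y \<cdot> f \<triangleleft> \<I> \<cdot> ru' (Dom V f)" by simp
  then show ?thesis using assms by auto
qed

lemma braid_nat:
  assumes "f \<in> Arr V" "g \<in> Arr V" "Cod V f = X'" "Cod V g = Y'"
  shows "br X' Y' \<cdot> f \<boxdot> g = g \<boxdot> f \<cdot> br (Dom V f) (Dom V g)"
  using assms braid_natural[of f _ X' g _ Y'] by simp

lemma lu'_tail:
  assumes "X \<in> Obj V" "Y \<in> Obj V"
  shows "lu' X \<triangleleft> Y = as' \<I> X Y \<cdot> lu' (X \<boxtimes> Y)"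
proof -
  have "lu X \<triangleleft> Y \<cdot> lu' X \<triangleleft> Y = lu X \<triangleleft> Y \<cdot> as' \<I> X Y \<cdot> lu' (X \<boxtimes> Y)"
    using assms by (simp flip: rwhisker_comp) (simp add: lu_tail)
  moreover have "lu X \<triangleleft> Y \<in> isos V (\<I> \<boxtimes> X \<boxtimes> Y) (X \<boxtimes> Y)"
    by (rule isosI(1)[of _ _ _ "lu' X \<triangleleft> Y"]) (use assms in \<open>simp_all flip: rwhisker_comp\<close>)
  ultimately show ?thesis by (rule iso_cancel_left) (use assms in simp_all)
qed

lemma ru'_tail:
  assumes "X \<in> Obj V" "Z \<in> Obj V"
  shows "ru' X \<triangleleft> Z = as' X \<I> Z \<cdot> X \<triangleright> lu' Z"
proof -
  have "ru X \<triangleleft> Z \<cdot> ru' X \<triangleleft> Z = ru X \<triangleleft> Z \<cdot> as' X \<I> Z \<cdot> X \<triangleright> lu' Z"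
    using assms by (simp flip: rwhisker_comp) (simp add: ru_tail lwhisker_merge)
  moreover have "ru X \<triangleleft> Z \<in> isos V (X \<boxtimes> \<I> \<boxtimes> Z) (X \<boxtimes> Z)"
    by (rule isosI(1)[of _ _ _ "ru' X \<triangleleft> Z"]) (use assms in \<open>simp_all flip: rwhisker_comp\<close>)
  ultimately show ?thesis by (rule iso_cancel_left) (use assms in simp_all)
qed

text \<open>Naturality of \<open>lu\<close> at \<open>lu \<I>\<close>, with \<open>lu \<I>\<close>
  cancelled, gives \<open>lu (\<I> \<boxtimes> \<I>) = \<I> \<triangleright> lu \<I>\<close>; then
  \<open>lu_tail\<close> and \<open>ru_tail\<close> have the same right side.\<close>

lemma lu_unit: "lu \<I> = ru \<I>"
proof (rule unit_faithful)
  have "lu (\<I> \<boxtimes> \<I>) = \<I> \<triangleright> lu \<I>"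
    by (rule iso_cancel_left[OF _ lunit_iso, of \<I>]) (simp_all add: lu_nat)
  then show "lu \<I> \<triangleleft> \<I> = ru \<I> \<triangleleft> \<I>" by (simp add: lu_tail ru_tail)
qed simp_all

text \<open>
  An equation between arrows is proved after tensoring it on the right with an object \<open>Z\<close>, the tail, and
  moving all bracketings to the form \<open>X \<otimes> (Y \<otimes> (\<dots> \<otimes> Z))\<close>: there, arrows acting on the first factors are
  families natural in \<open>Z\<close>, and no associators remain.  The case \<open>Z = 1\<close> gives back the equation.
  \<open>sw\<close>, \<open>bin\<close> and \<open>un\<close> are the families for a braiding, an arrow \<open>X \<otimes> Y \<rightarrow> W\<close> and an arrow \<open>1 \<rightarrow> W\<close>.
\<close>

definition sw :: "'o \<Rightarrow> 'o \<Rightarrow> 'o \<Rightarrow> 'a" where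
  "sw X Y Z = as Y X Z \<cdot> br X Y \<triangleleft> Z \<cdot> as' X Y Z"

lemma sw_arr [simp]:
  assumes "X \<in> Obj V" "Y \<in> Obj V" "Z \<in> Obj V"
  shows "sw X Y Z \<in> Arr V" "Dom V (sw X Y Z) = X \<boxtimes> (Y \<boxtimes> Z)" "Cod V (sw X Y Z) = Y \<boxtimes> (X \<boxtimes> Z)"
  using assms by (simp_all add: sw_def)

lemma sw_sw [simp]:
  assumes "X \<in> Obj V" "Y \<in> Obj V" "Z \<in> Obj V"
  shows "sw Y X Z \<cdot> sw X Y Z = Id V (X \<boxtimes> (Y \<boxtimes> Z))"
    "x \<in> Arr V \<Longrightarrow> Cod V x = X \<boxtimes> (Y \<boxtimes> Z) \<Longrightarrow> sw Y X Z \<cdot> sw X Y Z \<cdot> x = x"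
proof -
  have *: "br Y X \<triangleleft> Z \<cdot> br X Y \<triangleleft> Z = Id V (X \<boxtimes> Y \<boxtimes> Z)"
    using assms by (simp flip: rwhisker_comp)
  show **: "sw Y X Z \<cdot> sw X Y Z = Id V (X \<boxtimes> (Y \<boxtimes> Z))"
    using assms reassoc[OF *] by (simp add: sw_def)
  show "x \<in> Arr V \<Longrightarrow> Cod V x = X \<boxtimes> (Y \<boxtimes> Z) \<Longrightarrow> sw Y X Z \<cdot> sw X Y Z \<cdot> x = x"
    using assms reassoc[OF **] by simp
qed

lemma br_tail:
  assumes "X \<in> Obj V" "Y \<in> Obj V" "Z \<in> Obj V"
  shows "br X Y \<triangleleft> Z = as' Y X Z \<cdot> sw X Y Z \<cdot> as X Y Z"
  using assms by (simp add: sw_def)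

lemma sw_nat:
  assumes "f \<in> Arr V" "g \<in> Arr V" "h \<in> Arr V" "Cod V f = X'" "Cod V g = Y'" "Cod V h = Z'"
  shows "sw X' Y' Z' \<cdot> f \<boxdot> (g \<boxdot> h) = g \<boxdot> (f \<boxdot> h) \<cdot> sw (Dom V f) (Dom V g) (Dom V h)"
proof -
  have objs: "X' \<in> Obj V" "Y' \<in> Obj V" "Z' \<in> Obj V" using assms by auto
  have "sw X' Y' Z' \<cdot> f \<boxdot> (g \<boxdot> h) = as Y' X' Z' \<cdot> br X' Y' \<triangleleft> Z' \<cdot> f \<boxdot> g \<boxdot> h \<cdot> as' (Dom V f) (Dom V g) (Dom V h)"
    using as'_nat[of f g h] assms objs by (simp add: sw_def)
  also have "\<dots> = as Y' X' Z' \<cdot> (br X' Y' \<triangleleft> Z' \<cdot> f \<boxdot> g \<boxdot> h) \<cdot> as' (Dom V f) (Dom V g) (Dom V h)"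
    using assms objs by simp
  also have "br X' Y' \<triangleleft> Z' \<cdot> f \<boxdot> g \<boxdot> h = g \<boxdot> f \<boxdot> h \<cdot> br (Dom V f) (Dom V g) \<triangleleft> Dom V h"
    using assms objs by (simp add: tens_comp_arr braid_nat)
  also have "as Y' X' Z' \<cdot> (g \<boxdot> f \<boxdot> h \<cdot> br (Dom V f) (Dom V g) \<triangleleft> Dom V h) \<cdot> as' (Dom V f) (Dom V g) (Dom V h) =
    g \<boxdot> (f \<boxdot> h) \<cdot> sw (Dom V f) (Dom V g) (Dom V h)"
    using assms objs reassoc[OF as_nat, of g f h] by (simp add: sw_def)
  finally show ?thesis .
qed

text \<open>Composing the hexagon with \<open>?K\<close> and \<open>?K'\<close>, which carry the
  tail to the innermost bracket, leaves only the associators that open the bracket of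
  \<open>Y \<boxtimes> W\<close>.\<close>

lemma hexagon_tail:
  assumes "X \<in> Obj V" "Y \<in> Obj V" "W \<in> Obj V" "Z \<in> Obj V"
  shows "as Y W (X \<boxtimes> Z) \<cdot> sw X (Y \<boxtimes> W) Z \<cdot> X \<triangleright> as' Y W Z = Y \<triangleright> sw X W Z \<cdot> sw X Y (W \<boxtimes> Z)"
proof -
  let ?K = "Y \<triangleright> as W X Z \<cdot> as Y (W \<boxtimes> X) Z" and ?K' = "as' (X \<boxtimes> Y) W Z \<cdot> as' X Y (W \<boxtimes> Z)"
  have "?K \<cdot> ((as Y W X \<cdot> br X (Y \<boxtimes> W) \<cdot> as X Y W) \<triangleleft> Z \<cdot> ?K') =
    ?K \<cdot> ((Y \<triangleright> br X W \<cdot> as Y X W \<cdot> br X Y \<triangleleft> W) \<triangleleft> Z \<cdot> ?K')"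
    using hexagon[of X Y W] assms by simp
  then show ?thesis using assms
    by (simp add: rwhisker_comp as_tail br_tail[of X W Z] br_tail[of X "Y \<boxtimes> W" Z]
      br_tail[of X Y "W \<boxtimes> Z"] tail_rules lwhisker_merge)
qed

text \<open>Only one hexagon is an axiom. The other is its inverse, because \<open>sw\<close> is
  inverted by exchanging its first two arguments; it follows by cancelling
  \<open>?f'\<close>.\<close>

lemma hexagon_tail':
  assumes "X \<in> Obj V" "Y \<in> Obj V" "W \<in> Obj V" "Z \<in> Obj V"
  shows "W \<triangleright> as X Y Z \<cdot> sw (X \<boxtimes> Y) W Z \<cdot> as' X Y (W \<boxtimes> Z) = sw X W (Y \<boxtimes> Z) \<cdot> X \<triangleright> sw Y W Z"
proof -
  let ?f = "as X Y (W \<boxtimes> Z) \<cdot> sw W (X \<boxtimes> Y) Z \<cdot> W \<triangleright> as' X Y Z"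
  let ?f' = "X \<triangleright> sw W Y Z \<cdot> sw W X (Y \<boxtimes> Z)"
  have "?f \<cdot> W \<triangleright> as X Y Z \<cdot> sw (X \<boxtimes> Y) W Z \<cdot> as' X Y (W \<boxtimes> Z) = ?f' \<cdot> sw X W (Y \<boxtimes> Z) \<cdot> X \<triangleright> sw Y W Z"
    using assms by (simp add: lwhisker_merge)
  then have *: "?f' \<cdot> W \<triangleright> as X Y Z \<cdot> sw (X \<boxtimes> Y) W Z \<cdot> as' X Y (W \<boxtimes> Z) = ?f' \<cdot> sw X W (Y \<boxtimes> Z) \<cdot> X \<triangleright> sw Y W Z"
    unfolding hexagon_tail[OF assms(3,1,2,4)] .
  have "?f' \<in> isos V (W \<boxtimes> (X \<boxtimes> (Y \<boxtimes> Z))) (X \<boxtimes> (Y \<boxtimes> (W \<boxtimes> Z)))"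
    using assms by (intro isosI(1)[of _ _ _ "sw X W (Y \<boxtimes> Z) \<cdot> X \<triangleright> sw Y W Z"])
      (simp_all add: lwhisker_merge)
  from * this show ?thesis by (rule iso_cancel_left) (use assms in simp_all)
qed

text \<open>Once \<open>\<I> \<boxtimes> \<I>\<close> is collapsed, the hexagon for
  \<open>X\<close>, \<I>, \<I> has the factor \<open>br X \<I>\<close> on both sides; cancelling it
  leaves the claim.\<close>

lemma br_unit:
  assumes "X \<in> Obj V"
  shows "lu X \<cdot> br X \<I> = ru X"
proof (rule unit_faithful)
  have "br X \<I> \<cdot> ((lu X \<cdot> br X \<I>) \<triangleleft> \<I>) = lu (\<I> \<boxtimes> X) \<cdot> (\<I> \<triangleright> br X \<I> \<cdot> as \<I> X \<I> \<cdot> br X \<I> \<triangleleft> \<I>)"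
    using assms reassoc[OF lu_nat[of "br X \<I>" "\<I> \<boxtimes> X"]] by (simp add: rwhisker_comp lu_tail)
  also have "\<dots> = lu (\<I> \<boxtimes> X) \<cdot> (as \<I> \<I> X \<cdot> br X (\<I> \<boxtimes> \<I>) \<cdot> as X \<I> \<I>)"
    using assms by (simp add: hexagon)
  also have "\<dots> = lu \<I> \<triangleleft> X \<cdot> br X (\<I> \<boxtimes> \<I>) \<cdot> as X \<I> \<I>"
    using assms by (simp add: lu_tail)
  also have "\<dots> = (br X \<I> \<cdot> X \<triangleright> lu \<I>) \<cdot> as X \<I> \<I>"
    using assms by (simp add: braid_nat)
  also have "\<dots> = br X \<I> \<cdot> ru X \<triangleleft> \<I>" using assms by (simp add: ru_tail)
  finally show "(lu X \<cdot> br X \<I>) \<triangleleft> \<I> = ru X \<triangleleft> \<I>"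
    by (rule iso_cancel_left[OF _ isosI(1)[of _ "X \<boxtimes> \<I>" _ "br \<I> X"]]) (use assms in simp_all)
qed (use assms in simp_all)

lemma sw_unit:
  assumes "X \<in> Obj V" "Z \<in> Obj V"
  shows "lu (X \<boxtimes> Z) \<cdot> sw X \<I> Z = X \<triangleright> lu Z"
proof -
  have "(lu X \<cdot> br X \<I>) \<triangleleft> Z \<cdot> as' X \<I> Z = ru X \<triangleleft> Z \<cdot> as' X \<I> Z"
    using assms by (simp add: br_unit)
  then show ?thesis using assms by (simp add: rwhisker_comp lu_tail ru_tail br_tail)
qed

lemma sw_unit':
  assumes "X \<in> Obj V" "Z \<in> Obj V"
  shows "X \<triangleright> lu Z \<cdot> sw \<I> X Z = lu (X \<boxtimes> Z)"
proof -
  have "X \<triangleright> lu Z \<cdot> sw \<I> X Z = lu (X \<boxtimes> Z) \<cdot> (sw X \<I> Z \<cdot> sw \<I> X Z)"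
    using assms by (simp add: sw_unit del: sw_sw flip: comp_assoc_arr)
  then show ?thesis using assms by simp
qed

lemma sw_tail:
  assumes "X \<in> Obj V" "Y \<in> Obj V" "W \<in> Obj V" "Z \<in> Obj V"
  shows "sw X Y W \<triangleleft> Z =
    as' Y (X \<boxtimes> W) Z \<cdot> Y \<triangleright> as' X W Z \<cdot> sw X Y (W \<boxtimes> Z) \<cdot> X \<triangleright> as Y W Z \<cdot> as X (Y \<boxtimes> W) Z"
  using assms by (simp add: sw_def rwhisker_comp tail_rules as_tail as'_tail lwhisker_merge)

lemmas tails = rwhisker_comp tail_rules as_tail as'_tail sw_tail lu_tail lu'_tail ru_tail ru'_tail lwhisker_merge

definition bin :: "'a \<Rightarrow> 'o \<Rightarrow> 'o \<Rightarrow> 'o \<Rightarrow> 'a" where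
  "bin f X Y Z = f \<triangleleft> Z \<cdot> as' X Y Z"

definition un :: "'a \<Rightarrow> 'o \<Rightarrow> 'a" where
  "un u Z = u \<triangleleft> Z \<cdot> lu' Z"

lemma bin_arr [simp]:
  assumes "f \<in> Arr V" "Dom V f = X \<boxtimes> Y" "X \<in> Obj V" "Y \<in> Obj V" "Z \<in> Obj V"
  shows "bin f X Y Z \<in> Arr V" "Dom V (bin f X Y Z) = X \<boxtimes> (Y \<boxtimes> Z)" "Cod V (bin f X Y Z) = Cod V f \<boxtimes> Z"
  using assms by (simp_all add: bin_def)

lemma un_arr [simp]:
  assumes "u \<in> Arr V" "Dom V u = \<I>" "Z \<in> Obj V"
  shows "un u Z \<in> Arr V" "Dom V (un u Z) = Z" "Cod V (un u Z) = Cod V u \<boxtimes> Z"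
  using assms by (simp_all add: un_def)

lemma bin_natr:
  assumes "f \<in> Arr V" "Dom V f = X \<boxtimes> Y" "X \<in> Obj V" "Y \<in> Obj V" "g \<in> Arr V" "Cod V f = W" "Dom V g = Z'"
  shows "W \<triangleright> g \<cdot> bin f X Y Z' = bin f X Y (Cod V g) \<cdot> X \<triangleright> (Y \<triangleright> g)"
  using assms as'_nat[of "Id V X" "Id V Y" g] reassoc[OF rwhisker_natr[of f g "X \<boxtimes> Y" "Cod V g"]]
  by (auto simp add: bin_def)

lemma un_natr:
  assumes "u \<in> Arr V" "Dom V u = \<I>" "g \<in> Arr V" "Cod V u = W" "Dom V g = Z'"
  shows "W \<triangleright> g \<cdot> un u Z' = un u (Cod V g) \<cdot> g"
  using assms reassoc[OF rwhisker_natr[of u g \<I> "Cod V g"]] by (auto simp add: un_def lu'_nat)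

text \<open>By naturality, braiding the output of \<open>f\<close> past \<open>Y\<close> is braiding
  its whole input past \<open>Y\<close>; the hexagon splits this into the two input factors.\<close>

lemma bin_sw:
  assumes "f \<in> Arr V" "Dom V f = X1 \<boxtimes> X2" "X1 \<in> Obj V" "X2 \<in> Obj V" "Y \<in> Obj V" "Z \<in> Obj V" "Cod V f = W"
  shows "sw W Y Z \<cdot> bin f X1 X2 (Y \<boxtimes> Z) = Y \<triangleright> bin f X1 X2 Z \<cdot> sw X1 Y (X2 \<boxtimes> Z) \<cdot> X1 \<triangleright> sw X2 Y Z"
proof -
  have W: "W \<in> Obj V" using assms by auto
  have "sw W Y Z \<cdot> f \<triangleleft> (Y \<boxtimes> Z) = Y \<triangleright> (f \<triangleleft> Z) \<cdot> sw (X1 \<boxtimes> X2) Y Z"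
    using assms W sw_nat[of f "Id V Y" "Id V Z" W Y Z] by simp
  from reassoc[OF this] have "sw W Y Z \<cdot> bin f X1 X2 (Y \<boxtimes> Z) =
      Y \<triangleright> bin f X1 X2 Z \<cdot> Y \<triangleright> as X1 X2 Z \<cdot> sw (X1 \<boxtimes> X2) Y Z \<cdot> as' X1 X2 (Y \<boxtimes> Z)"
    using assms W by (simp add: bin_def lwhisker_merge)
  then show ?thesis using assms by (simp add: hexagon_tail')
qed

lemma sw_bin:
  assumes "f \<in> Arr V" "Dom V f = Y1 \<boxtimes> Y2" "Y1 \<in> Obj V" "Y2 \<in> Obj V" "X \<in> Obj V" "Z \<in> Obj V" "Cod V f = W"
  shows "sw X W Z \<cdot> X \<triangleright> bin f Y1 Y2 Z = bin f Y1 Y2 (X \<boxtimes> Z) \<cdot> Y1 \<triangleright> sw X Y2 Z \<cdot> sw X Y1 (Y2 \<boxtimes> Z)"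
proof -
  have W: "W \<in> Obj V" using assms by auto
  have "sw X W Z \<cdot> X \<triangleright> (f \<triangleleft> Z) = f \<triangleleft> (X \<boxtimes> Z) \<cdot> sw X (Y1 \<boxtimes> Y2) Z"
    using assms W sw_nat[of "Id V X" f "Id V Z" X W Z] by simp
  from reassoc[OF this, of "X \<triangleright> as' Y1 Y2 Z"] have "sw X W Z \<cdot> X \<triangleright> bin f Y1 Y2 Z =
      bin f Y1 Y2 (X \<boxtimes> Z) \<cdot> as Y1 Y2 (X \<boxtimes> Z) \<cdot> sw X (Y1 \<boxtimes> Y2) Z \<cdot> X \<triangleright> as' Y1 Y2 Z"
    using assms W by (simp add: bin_def lwhisker_merge)
  then show ?thesis using assms by (simp add: hexagon_tail)
qed

text \<open>Braiding with the unit object is trivial, so a braiding disappears when one of its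
  arguments has just been created by \<open>u\<close>.\<close>

lemma un_sw:
  assumes "u \<in> Arr V" "Dom V u = \<I>" "Y \<in> Obj V" "Z \<in> Obj V" "Cod V u = W"
  shows "sw W Y Z \<cdot> un u (Y \<boxtimes> Z) = Y \<triangleright> un u Z"
proof -
  have W: "W \<in> Obj V" using assms by auto
  have "sw W Y Z \<cdot> u \<triangleleft> (Y \<boxtimes> Z) = Y \<triangleright> (u \<triangleleft> Z) \<cdot> sw \<I> Y Z"
    using assms W sw_nat[of u "Id V Y" "Id V Z" W Y Z] by simp
  from reassoc[OF this] have "sw W Y Z \<cdot> un u (Y \<boxtimes> Z) = Y \<triangleright> (u \<triangleleft> Z) \<cdot> sw \<I> Y Z \<cdot> lu' (Y \<boxtimes> Z)"
    using assms W by (simp add: un_def)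
  also have "sw \<I> Y Z \<cdot> lu' (Y \<boxtimes> Z) = Y \<triangleright> lu' Z \<cdot> (Y \<triangleright> lu Z \<cdot> sw \<I> Y Z) \<cdot> lu' (Y \<boxtimes> Z)"
    using assms by (simp add: lwhisker_merge)
  also have "\<dots> = Y \<triangleright> lu' Z" using assms by (simp add: sw_unit')
  finally show ?thesis using assms W by (simp add: un_def lwhisker_merge)
qed

lemma sw_un:
  assumes "u \<in> Arr V" "Dom V u = \<I>" "X \<in> Obj V" "Z \<in> Obj V" "Cod V u = W"
  shows "sw X W Z \<cdot> X \<triangleright> un u Z = un u (X \<boxtimes> Z)"
proof -
  have W: "W \<in> Obj V" using assms by auto
  have "sw X W Z \<cdot> X \<triangleright> un u Z = sw X W Z \<cdot> sw W X Z \<cdot> un u (X \<boxtimes> Z)"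
    using assms W by (simp add: un_sw del: sw_sw)
  then show ?thesis using assms W by simp
qed

section \<open>Commutative algebras and their homomorphisms in tail form\<close>

abbreviation mul where "mul A Z \<equiv> bin (amul A) (aobj A) (aobj A) Z"
abbreviation unt where "unt A Z \<equiv> un (aone A) Z"

lemma comm_alg_arr [simp]:
  assumes "comm_alg V A"
  shows "aobj A \<in> Obj V" "amul A \<in> Arr V" "Dom V (amul A) = aobj A \<boxtimes> aobj A" "Cod V (amul A) = aobj A"
    "aone A \<in> Arr V" "Dom V (aone A) = \<I>" "Cod V (aone A) = aobj A"
  using assms by (simp_all add: comm_alg_def)

lemma mul_assoc:
  assumes "comm_alg V A" "Z \<in> Obj V"
  shows "mul A Z \<cdot> mul A (aobj A \<boxtimes> Z) = mul A Z \<cdot> aobj A \<triangleright> mul A Z"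
proof -
  let ?A = "aobj A"
  have "(amul A \<cdot> amul A \<triangleleft> ?A) \<triangleleft> Z \<cdot> as' (?A \<boxtimes> ?A) ?A Z \<cdot> as' ?A ?A (?A \<boxtimes> Z) =
    (amul A \<cdot> ?A \<triangleright> amul A \<cdot> as ?A ?A ?A) \<triangleleft> Z \<cdot> as' (?A \<boxtimes> ?A) ?A Z \<cdot> as' ?A ?A (?A \<boxtimes> Z)"
    using assms unfolding comm_alg_def by simp
  then show ?thesis using assms by (simp add: tails bin_def)
qed

lemma mul_unt:
  assumes "comm_alg V A" "Z \<in> Obj V"
  shows "mul A Z \<cdot> unt A (aobj A \<boxtimes> Z) = Id V (aobj A \<boxtimes> Z)"
    "mul A Z \<cdot> aobj A \<triangleright> unt A Z = Id V (aobj A \<boxtimes> Z)"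
proof -
  let ?A = "aobj A"
  have "(amul A \<cdot> aone A \<triangleleft> ?A) \<triangleleft> Z \<cdot> as' \<I> ?A Z \<cdot> lu' (?A \<boxtimes> Z) = lu ?A \<triangleleft> Z \<cdot> as' \<I> ?A Z \<cdot> lu' (?A \<boxtimes> Z)"
    using assms unfolding comm_alg_def by simp
  then show "mul A Z \<cdot> unt A (?A \<boxtimes> Z) = Id V (?A \<boxtimes> Z)" using assms by (simp add: tails bin_def un_def)
  have "(amul A \<cdot> ?A \<triangleright> aone A) \<triangleleft> Z \<cdot> as' ?A \<I> Z \<cdot> ?A \<triangleright> lu' Z = ru ?A \<triangleleft> Z \<cdot> as' ?A \<I> Z \<cdot> ?A \<triangleright> lu' Z"
    using assms unfolding comm_alg_def by simp
  then show "mul A Z \<cdot> ?A \<triangleright> unt A Z = Id V (?A \<boxtimes> Z)" using assms by (simp add: tails bin_def un_def)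
qed

lemma mul_comm:
  assumes "comm_alg V A" "Z \<in> Obj V"
  shows "mul A Z \<cdot> sw (aobj A) (aobj A) Z = mul A Z"
proof -
  let ?A = "aobj A"
  have "(amul A \<cdot> br ?A ?A) \<triangleleft> Z \<cdot> as' ?A ?A Z = amul A \<triangleleft> Z \<cdot> as' ?A ?A Z"
    using assms unfolding comm_alg_def by simp
  then show ?thesis using assms by (simp add: tails bin_def br_tail)
qed

text \<open>Checking the axioms with the tail \<I> suffices, since \<open>unit_faithful\<close>
  removes it again.\<close>

lemma comm_algI:
  assumes [simp]: "aobj A \<in> Obj V" "amul A \<in> Arr V" "Dom V (amul A) = aobj A \<boxtimes> aobj A" "Cod V (amul A) = aobj A"
    "aone A \<in> Arr V" "Dom V (aone A) = \<I>" "Cod V (aone A) = aobj A"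
    and assoc: "mul A \<I> \<cdot> mul A (aobj A \<boxtimes> \<I>) = mul A \<I> \<cdot> aobj A \<triangleright> mul A \<I>"
    and unit: "mul A \<I> \<cdot> unt A (aobj A \<boxtimes> \<I>) = Id V (aobj A \<boxtimes> \<I>)"
      "mul A \<I> \<cdot> aobj A \<triangleright> unt A \<I> = Id V (aobj A \<boxtimes> \<I>)"
    and comm: "mul A \<I> \<cdot> sw (aobj A) (aobj A) \<I> = mul A \<I>"
  shows "comm_alg V A"
proof -
  let ?A = "aobj A"
  have "amul A \<cdot> amul A \<triangleleft> ?A = amul A \<cdot> ?A \<triangleright> amul A \<cdot> as ?A ?A ?A"
  proof (rule unit_faithful)
    have "(mul A \<I> \<cdot> mul A (?A \<boxtimes> \<I>)) \<cdot> as ?A ?A (?A \<boxtimes> \<I>) \<cdot> as (?A \<boxtimes> ?A) ?A \<I> =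
      (mul A \<I> \<cdot> ?A \<triangleright> mul A \<I>) \<cdot> as ?A ?A (?A \<boxtimes> \<I>) \<cdot> as (?A \<boxtimes> ?A) ?A \<I>"
      unfolding assoc ..
    then show "(amul A \<cdot> amul A \<triangleleft> ?A) \<triangleleft> \<I> = (amul A \<cdot> ?A \<triangleright> amul A \<cdot> as ?A ?A ?A) \<triangleleft> \<I>"
      by (simp add: tails bin_def)
  qed simp_all
  moreover have "amul A \<cdot> aone A \<triangleleft> ?A = lu ?A"
  proof (rule unit_faithful)
    have "(mul A \<I> \<cdot> unt A (?A \<boxtimes> \<I>)) \<cdot> lu (?A \<boxtimes> \<I>) \<cdot> as \<I> ?A \<I> = lu (?A \<boxtimes> \<I>) \<cdot> as \<I> ?A \<I>"
      unfolding unit by simp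
    then show "(amul A \<cdot> aone A \<triangleleft> ?A) \<triangleleft> \<I> = lu ?A \<triangleleft> \<I>" by (simp add: tails bin_def un_def)
  qed simp_all
  moreover have "amul A \<cdot> ?A \<triangleright> aone A = ru ?A"
  proof (rule unit_faithful)
    have "(mul A \<I> \<cdot> ?A \<triangleright> unt A \<I>) \<cdot> ?A \<triangleright> lu \<I> \<cdot> as ?A \<I> \<I> = ?A \<triangleright> lu \<I> \<cdot> as ?A \<I> \<I>"
      unfolding unit by simp
    then show "(amul A \<cdot> ?A \<triangleright> aone A) \<triangleleft> \<I> = ru ?A \<triangleleft> \<I>" by (simp add: tails bin_def un_def)
  qed simp_all
  moreover have "amul A \<cdot> br ?A ?A = amul A"
  proof (rule unit_faithful)
    have "(mul A \<I> \<cdot> sw ?A ?A \<I>) \<cdot> as ?A ?A \<I> = mul A \<I> \<cdot> as ?A ?A \<I>"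
      unfolding comm ..
    then show "(amul A \<cdot> br ?A ?A) \<triangleleft> \<I> = amul A \<triangleleft> \<I>" by (simp add: tails bin_def br_tail)
  qed simp_all
  ultimately show ?thesis unfolding comm_alg_def by simp
qed

lemma alg_hom_arr:
  assumes "f \<in> alg_hom V A B"
  shows "f \<in> Arr V" "Dom V f = aobj A" "Cod V f = aobj B"
  using assms by (simp_all add: alg_hom_def)

lemma hom_mul:
  assumes "f \<in> alg_hom V A B" "comm_alg V A" "comm_alg V B" "Z \<in> Obj V"
  shows "f \<triangleleft> Z \<cdot> mul A Z = mul B Z \<cdot> f \<triangleleft> (aobj B \<boxtimes> Z) \<cdot> aobj A \<triangleright> (f \<triangleleft> Z)"
proof -
  note [simp] = alg_hom_arr[OF assms(1)]
  have "(f \<cdot> amul A) \<triangleleft> Z \<cdot> as' (aobj A) (aobj A) Z = (amul B \<cdot> f \<boxdot> f) \<triangleleft> Z \<cdot> as' (aobj A) (aobj A) Z"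
    using assms by (simp add: alg_hom_def)
  then show ?thesis using assms(2-) by (simp add: tails bin_def tens_split[of f f])
qed

lemma hom_unt:
  assumes "f \<in> alg_hom V A B" "comm_alg V A" "comm_alg V B" "Z \<in> Obj V"
  shows "f \<triangleleft> Z \<cdot> unt A Z = unt B Z"
proof -
  note [simp] = alg_hom_arr[OF assms(1)]
  have "(f \<cdot> aone A) \<triangleleft> Z \<cdot> lu' Z = aone B \<triangleleft> Z \<cdot> lu' Z"
    using assms by (simp add: alg_hom_def)
  then show ?thesis using assms(2-) by (simp add: tails un_def)
qed

lemma alg_homI:
  assumes [simp]: "comm_alg V A" "comm_alg V B" "f \<in> Arr V" "Dom V f = aobj A" "Cod V f = aobj B"
    and mul: "f \<triangleleft> \<I> \<cdot> mul A \<I> = mul B \<I> \<cdot> f \<triangleleft> (aobj B \<boxtimes> \<I>) \<cdot> aobj A \<triangleright> (f \<triangleleft> \<I>)"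
    and unit: "f \<triangleleft> \<I> \<cdot> unt A \<I> = unt B \<I>"
  shows "f \<in> alg_hom V A B"
proof -
  let ?A = "aobj A"
  have "f \<cdot> amul A = amul B \<cdot> f \<boxdot> f"
  proof (rule unit_faithful)
    have "(f \<triangleleft> \<I> \<cdot> mul A \<I>) \<cdot> as ?A ?A \<I> = (mul B \<I> \<cdot> f \<triangleleft> (aobj B \<boxtimes> \<I>) \<cdot> ?A \<triangleright> (f \<triangleleft> \<I>)) \<cdot> as ?A ?A \<I>"
      unfolding mul ..
    then show "(f \<cdot> amul A) \<triangleleft> \<I> = (amul B \<cdot> f \<boxdot> f) \<triangleleft> \<I>"
      by (simp add: tails bin_def tens_split[of f f])
  qed simp_all
  moreover have "f \<cdot> aone A = aone B"
  proof (rule unit_faithful)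
    have "(f \<triangleleft> \<I> \<cdot> unt A \<I>) \<cdot> lu \<I> = unt B \<I> \<cdot> lu \<I>" unfolding unit ..
    then show "(f \<cdot> aone A) \<triangleleft> \<I> = aone B \<triangleleft> \<I>" by (simp add: tails un_def)
  qed simp_all
  ultimately show ?thesis by (simp add: alg_hom_def)
qed

text \<open>The analogue of \<open>reassoc\<close> for whiskered composites:
  \<open>lwhisker_merge\<close> collects consecutive arrows under one whisker, where an equation
  about \<open>X \<triangleright> g\<close> alone no longer matches.\<close>

lemma whisker_cont:
  assumes "s \<cdot> X \<triangleright> g = h" "s \<in> Arr V" "g \<in> Arr V" "k \<in> Arr V" "X \<in> Obj V"
    "Dom V s = X \<boxtimes> Cod V g" "Cod V k = Dom V g"
  shows "s \<cdot> X \<triangleright> (g \<cdot> k) = h \<cdot> X \<triangleright> k"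
  using assms reassoc[OF assms(1), of "X \<triangleright> k"] by (simp add: lwhisker_comp)

lemma whisker_cont':
  assumes "s \<cdot> X \<triangleright> g = h" "s \<in> Arr V" "g \<in> Arr V" "k \<in> Arr V" "X \<in> Obj V"
    "Dom V s = X \<boxtimes> Cod V g" "Cod V k = Dom V g" "x \<in> Arr V" "Cod V x = X \<boxtimes> Dom V k"
  shows "s \<cdot> X \<triangleright> (g \<cdot> k) \<cdot> x = h \<cdot> X \<triangleright> k \<cdot> x"
proof -
  have "h \<in> Arr V" "Dom V h = X \<boxtimes> Dom V g" using assms by auto
  then show ?thesis using reassoc[OF whisker_cont[OF assms(1-7)], of x] assms by simp
qed

lemma sw_natr:
  assumes "f \<in> Arr V" "X \<in> Obj V" "Y \<in> Obj V" "Cod V f = Z"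
  shows "sw X Y Z \<cdot> X \<triangleright> (Y \<triangleright> f) = Y \<triangleright> (X \<triangleright> f) \<cdot> sw X Y (Dom V f)"
    "sw X Z Y \<cdot> X \<triangleright> (f \<triangleleft> Y) = f \<triangleleft> (X \<boxtimes> Y) \<cdot> sw X (Dom V f) Y"
    "sw Z X Y \<cdot> f \<triangleleft> (X \<boxtimes> Y) = X \<triangleright> (f \<triangleleft> Y) \<cdot> sw (Dom V f) X Y"
  using assms sw_nat[of "Id V X" "Id V Y" f X Y Z] sw_nat[of "Id V X" f "Id V Y" X Z Y]
    sw_nat[of f "Id V X" "Id V Y" Z X Y] by simp_all

text \<open>Oriented so that braidings move towards the source, past products and units. Together
  with \<open>natr_rules\<close>, which lets products and units on the front factor act last, and
  \<open>mul_rules\<close>, this brings expressions in commutative algebras to a common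
  shape.\<close>

lemmas sw_rules =
  bin_sw reassoc[OF bin_sw]
  sw_bin reassoc[OF sw_bin] whisker_cont[OF sw_bin] whisker_cont'[OF sw_bin]
  un_sw reassoc[OF un_sw] sw_un reassoc[OF sw_un] whisker_cont[OF sw_un] whisker_cont'[OF sw_un]
  sw_natr reassoc[OF sw_natr(1)] reassoc[OF sw_natr(2)] reassoc[OF sw_natr(3)]
  whisker_cont[OF sw_natr(1)] whisker_cont'[OF sw_natr(1)]
  whisker_cont[OF sw_natr(2)] whisker_cont'[OF sw_natr(2)]

lemmas mul_rules = mul_assoc reassoc[OF mul_assoc] mul_unt(1) reassoc[OF mul_unt(1)]
  mul_unt(2) reassoc[OF mul_unt(2)] whisker_cont[OF mul_unt(2)] whisker_cont'[OF mul_unt(2)]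
  mul_comm reassoc[OF mul_comm]

lemmas natr_rules = bin_natr reassoc[OF bin_natr] un_natr reassoc[OF un_natr]

text \<open>The multiplication of \<open>A \<otimes> B\<close> with tail \<open>Z\<close>, as a map on \<open>A \<otimes> (B \<otimes> (A \<otimes> (B \<otimes> Z)))\<close>.\<close>

definition tmul :: "('o, 'a) alg \<Rightarrow> ('o, 'a) alg \<Rightarrow> 'o \<Rightarrow> 'a" where
  "tmul A B Z = mul A (aobj B \<boxtimes> Z) \<cdot>
     aobj A \<triangleright> (aobj A \<triangleright> mul B Z \<cdot> sw (aobj B) (aobj A) (aobj B \<boxtimes> Z))"

lemma tmul_arr [simp]:
  assumes "comm_alg V A" "comm_alg V B" "Z \<in> Obj V"
  shows "tmul A B Z \<in> Arr V"
    "Dom V (tmul A B Z) = aobj A \<boxtimes> (aobj B \<boxtimes> (aobj A \<boxtimes> (aobj B \<boxtimes> Z)))"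
    "Cod V (tmul A B Z) = aobj A \<boxtimes> (aobj B \<boxtimes> Z)"
  using assms by (simp_all add: tmul_def)

lemma tmul_nat:
  assumes "comm_alg V A" "comm_alg V B" "f \<in> Arr V" "Dom V f = Z"
  shows "aobj A \<triangleright> (aobj B \<triangleright> f) \<cdot> tmul A B Z =
    tmul A B (Cod V f) \<cdot> aobj A \<triangleright> (aobj B \<triangleright> (aobj A \<triangleright> (aobj B \<triangleright> f)))"
  using assms by (auto simp add: tmul_def natr_rules lwhisker_merge sw_rules)

lemma tmul_assoc:
  assumes "comm_alg V A" "comm_alg V B" "Z \<in> Obj V"
  shows "tmul A B Z \<cdot> tmul A B (aobj A \<boxtimes> (aobj B \<boxtimes> Z)) = tmul A B Z \<cdot> aobj A \<triangleright> (aobj B \<triangleright> tmul A B Z)"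
  using assms by (simp add: tmul_def natr_rules lwhisker_merge sw_rules mul_rules)

lemma tmul_unt:
  assumes "comm_alg V A" "comm_alg V B" "Z \<in> Obj V"
  shows "tmul A B Z \<cdot> unt A (aobj B \<boxtimes> (aobj A \<boxtimes> (aobj B \<boxtimes> Z))) \<cdot> unt B (aobj A \<boxtimes> (aobj B \<boxtimes> Z)) =
      Id V (aobj A \<boxtimes> (aobj B \<boxtimes> Z))"
    "tmul A B Z \<cdot> aobj A \<triangleright> (aobj B \<triangleright> (unt A (aobj B \<boxtimes> Z) \<cdot> unt B Z)) = Id V (aobj A \<boxtimes> (aobj B \<boxtimes> Z))"
  using assms by (simp_all add: tmul_def lwhisker_merge sw_rules mul_rules natr_rules)

lemma tmul_comm:
  assumes "comm_alg V A" "comm_alg V B" "Z \<in> Obj V"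
  shows "tmul A B Z \<cdot>
      aobj A \<triangleright> (sw (aobj A) (aobj B) (aobj B \<boxtimes> Z) \<cdot> aobj A \<triangleright> sw (aobj B) (aobj B) Z) \<cdot>
      sw (aobj A) (aobj A) (aobj B \<boxtimes> (aobj B \<boxtimes> Z)) \<cdot> aobj A \<triangleright> sw (aobj B) (aobj A) (aobj B \<boxtimes> Z) =
    tmul A B Z"
proof -
  let ?A = "aobj A" and ?B = "aobj B"
  let ?k = "?A \<triangleright> sw ?B ?A (?B \<boxtimes> Z)"
  have "tmul A B Z \<cdot> ?A \<triangleright> (sw ?A ?B (?B \<boxtimes> Z) \<cdot> ?A \<triangleright> sw ?B ?B Z) \<cdot> sw ?A ?A (?B \<boxtimes> (?B \<boxtimes> Z)) \<cdot> ?k =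
    mul A (?B \<boxtimes> Z) \<cdot> (?A \<triangleright> (?A \<triangleright> mul B Z) \<cdot> sw ?A ?A (?B \<boxtimes> (?B \<boxtimes> Z))) \<cdot> ?k"
    using assms by (simp add: tmul_def lwhisker_merge mul_comm)
  \<comment> \<open>Naturality of \<open>sw\<close> used against its usual orientation: the swap of
    the two \<open>A\<close> factors has to reach \<open>mul A\<close>, which then absorbs it by
    commutativity.\<close>
  also have "?A \<triangleright> (?A \<triangleright> mul B Z) \<cdot> sw ?A ?A (?B \<boxtimes> (?B \<boxtimes> Z)) = sw ?A ?A (?B \<boxtimes> Z) \<cdot> ?A \<triangleright> (?A \<triangleright> mul B Z)"
    using assms by (simp add: sw_natr)
  finally show ?thesis using assms by (simp add: tmul_def mul_rules lwhisker_merge)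
qed

section \<open>The tensor product of commutative algebras\<close>

lemma tensor_alg_simps [simp]:
  "aobj (tensor_alg V A B) = aobj A \<boxtimes> aobj B"
  by (simp add: tensor_alg_def)

lemma tensor_alg_arr:
  assumes "comm_alg V A" "comm_alg V B"
  shows "amul (tensor_alg V A B) \<in> Arr V"
    "Dom V (amul (tensor_alg V A B)) = (aobj A \<boxtimes> aobj B) \<boxtimes> (aobj A \<boxtimes> aobj B)"
    "Cod V (amul (tensor_alg V A B)) = aobj A \<boxtimes> aobj B"
    "aone (tensor_alg V A B) \<in> Arr V" "Dom V (aone (tensor_alg V A B)) = \<I>"
    "Cod V (aone (tensor_alg V A B)) = aobj A \<boxtimes> aobj B"
  using assms by (simp_all add: tensor_alg_def middle_swap_def)

lemma middle_swap_sw: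
  assumes "X \<in> Obj V" "Y \<in> Obj V"
  shows "middle_swap V X Y = as' X X (Y \<boxtimes> Y) \<cdot> X \<triangleright> sw Y X Y \<cdot> as X Y (X \<boxtimes> Y)"
  using assms by (simp add: middle_swap_def lwhisker_merge sw_def)

text \<open>The product of the tensor algebra sees its arguments as two blocks. The associators on
  the right side open these blocks, and \<open>tmul\<close> is what remains in the normal
  form.\<close>

lemma tensor_mul:
  assumes "comm_alg V A" "comm_alg V B" "Z \<in> Obj V"
  shows "bin (amul (tensor_alg V A B)) (aobj A \<boxtimes> aobj B) (aobj A \<boxtimes> aobj B) Z =
    as' (aobj A) (aobj B) Z \<cdot> tmul A B Z \<cdot> aobj A \<triangleright> (aobj B \<triangleright> as (aobj A) (aobj B) Z)
      \<cdot> as (aobj A) (aobj B) (aobj A \<boxtimes> aobj B \<boxtimes> Z)"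
proof -
  let ?A = "aobj A" and ?B = "aobj B"
  have 1: "(amul A \<boxdot> amul B) \<triangleleft> Z = as' ?A ?B Z \<cdot> mul A (?B \<boxtimes> Z) \<cdot> ?A \<triangleright> (?A \<triangleright> (mul B Z \<cdot> as ?B ?B Z))
      \<cdot> as ?A ?A (?B \<boxtimes> ?B \<boxtimes> Z) \<cdot> as (?A \<boxtimes> ?A) (?B \<boxtimes> ?B) Z"
    using assms by (simp add: tens_split[of "amul A" "amul B"] tails bin_def)
  have 2: "middle_swap V ?A ?B \<triangleleft> Z \<cdot> as' (?A \<boxtimes> ?B) (?A \<boxtimes> ?B) Z = as' (?A \<boxtimes> ?A) (?B \<boxtimes> ?B) Z \<cdot>
     as' ?A ?A (?B \<boxtimes> ?B \<boxtimes> Z) \<cdot> ?A \<triangleright> (?A \<triangleright> as' ?B ?B Z \<cdot> sw ?B ?A (?B \<boxtimes> Z) \<cdot> ?B \<triangleright> as ?A ?B Z) \<cdot>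
     as ?A ?B (?A \<boxtimes> ?B \<boxtimes> Z)"
    using assms by (simp add: middle_swap_sw tails)
  have "bin (amul (tensor_alg V A B)) (?A \<boxtimes> ?B) (?A \<boxtimes> ?B) Z =
      (amul A \<boxdot> amul B) \<triangleleft> Z \<cdot> (middle_swap V ?A ?B \<triangleleft> Z \<cdot> as' (?A \<boxtimes> ?B) (?A \<boxtimes> ?B) Z)"
    using assms by (simp add: bin_def tensor_alg_def rwhisker_comp middle_swap_sw)
  then show ?thesis unfolding 1 2 using assms by (simp add: tmul_def lwhisker_merge)
qed

lemma tensor_unt:
  assumes "comm_alg V A" "comm_alg V B" "Z \<in> Obj V"
  shows "un (aone (tensor_alg V A B)) Z = as' (aobj A) (aobj B) Z \<cdot> unt A (aobj B \<boxtimes> Z) \<cdot> unt B Z"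
  using assms by (simp add: un_def tensor_alg_def tens_split[of "aone A" "aone B"] tails
    lu'_nat reassoc[OF lu'_nat])

lemma sw_tensor:
  assumes "X \<in> Obj V" "Y \<in> Obj V" "W \<in> Obj V" "Z \<in> Obj V"
  shows "sw X (Y \<boxtimes> W) Z = as' Y W (X \<boxtimes> Z) \<cdot> Y \<triangleright> sw X W Z \<cdot> sw X Y (W \<boxtimes> Z) \<cdot> X \<triangleright> as Y W Z"
    "sw (X \<boxtimes> Y) W Z = W \<triangleright> as' X Y Z \<cdot> sw X W (Y \<boxtimes> Z) \<cdot> X \<triangleright> sw Y W Z \<cdot> as X Y (W \<boxtimes> Z)"
proof -
  have "as' Y W (X \<boxtimes> Z) \<cdot> (as Y W (X \<boxtimes> Z) \<cdot> sw X (Y \<boxtimes> W) Z \<cdot> X \<triangleright> as' Y W Z) \<cdot> X \<triangleright> as Y W Z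
    = as' Y W (X \<boxtimes> Z) \<cdot> (Y \<triangleright> sw X W Z \<cdot> sw X Y (W \<boxtimes> Z)) \<cdot> X \<triangleright> as Y W Z"
    using hexagon_tail[OF assms] by simp
  then show "sw X (Y \<boxtimes> W) Z = as' Y W (X \<boxtimes> Z) \<cdot> Y \<triangleright> sw X W Z \<cdot> sw X Y (W \<boxtimes> Z) \<cdot> X \<triangleright> as Y W Z"
    using assms by (simp add: lwhisker_merge)
  have "W \<triangleright> as' X Y Z \<cdot> (W \<triangleright> as X Y Z \<cdot> sw (X \<boxtimes> Y) W Z \<cdot> as' X Y (W \<boxtimes> Z)) \<cdot> as X Y (W \<boxtimes> Z)
    = W \<triangleright> as' X Y Z \<cdot> (sw X W (Y \<boxtimes> Z) \<cdot> X \<triangleright> sw Y W Z) \<cdot> as X Y (W \<boxtimes> Z)"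
    using hexagon_tail'[OF assms] by simp
  then show "sw (X \<boxtimes> Y) W Z = W \<triangleright> as' X Y Z \<cdot> sw X W (Y \<boxtimes> Z) \<cdot> X \<triangleright> sw Y W Z \<cdot> as X Y (W \<boxtimes> Z)"
    using assms by (simp add: lwhisker_merge)
qed

lemma comm_alg_tensor [simp]:
  assumes "comm_alg V A" "comm_alg V B"
  shows "comm_alg V (tensor_alg V A B)"
proof (rule comm_algI)
  let ?T = "tensor_alg V A B" and ?A = "aobj A" and ?B = "aobj B"
  note [simp] = tensor_alg_arr[OF assms] assms
  show "mul ?T \<I> \<cdot> mul ?T (aobj ?T \<boxtimes> \<I>) = mul ?T \<I> \<cdot> aobj ?T \<triangleright> mul ?T \<I>"
    by (simp add: tensor_mul tail_rules(3) lwhisker_merge reassoc[OF tmul_nat] reassoc[OF tmul_assoc])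
  show "mul ?T \<I> \<cdot> unt ?T (aobj ?T \<boxtimes> \<I>) = Id V (aobj ?T \<boxtimes> \<I>)"
    using reassoc[OF tmul_unt(1)[OF assms, of \<I>], of "as ?A ?B \<I>"]
    by (simp add: tensor_mul tensor_unt tail_rules(3) lwhisker_merge natr_rules)
  show "mul ?T \<I> \<cdot> aobj ?T \<triangleright> unt ?T \<I> = Id V (aobj ?T \<boxtimes> \<I>)"
    by (simp add: tensor_mul tensor_unt tail_rules(3) lwhisker_merge reassoc[OF tmul_unt(2)])
  show "mul ?T \<I> \<cdot> sw (aobj ?T) (aobj ?T) \<I> = mul ?T \<I>"
    using reassoc[OF tmul_comm[OF assms, of \<I>], of "?A \<triangleright> (?B \<triangleright> as ?A ?B \<I>) \<cdot> as ?A ?B (?A \<boxtimes> ?B \<boxtimes> \<I>)"]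
    by (simp add: tensor_mul sw_tensor tail_rules(3) lwhisker_merge)
qed (use assms tensor_alg_arr in simp_all)

lemma unit_alg_simps [simp]:
  "aobj (unit_alg V) = \<I>" "amul (unit_alg V) = lu \<I>" "aone (unit_alg V) = Id V \<I>"
  by (simp_all add: unit_alg_def)

lemma comm_alg_unit [simp]: "comm_alg V (unit_alg V)"
proof -
  have "lu \<I> \<cdot> br \<I> \<I> = lu \<I>" using br_unit[of \<I>] lu_unit by simp
  moreover have "lu \<I> \<cdot> lu \<I> \<triangleleft> \<I> = lu \<I> \<cdot> \<I> \<triangleright> lu \<I> \<cdot> as \<I> \<I> \<I>"
    by (simp add: lu_tail reassoc[OF lu_nat])
  ultimately show ?thesis by (simp add: comm_alg_def lu_unit)
qed

lemma alg_hom_Id [simp]: "comm_alg V A \<Longrightarrow> Id V (aobj A) \<in> alg_hom V A A"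
  by (simp add: alg_hom_def)

lemma alg_hom_comp:
  assumes "comm_alg V A" "f \<in> alg_hom V A B" "g \<in> alg_hom V B D" "comm_alg V B" "comm_alg V D"
  shows "g \<cdot> f \<in> alg_hom V A D"
proof -
  note [simp] = alg_hom_arr[OF assms(2)] alg_hom_arr[OF assms(3)]
  have f: "f \<cdot> amul A = amul B \<cdot> f \<boxdot> f" "f \<cdot> aone A = aone B" using assms(2) by (simp_all add: alg_hom_def)
  have g: "g \<cdot> amul B = amul D \<cdot> g \<boxdot> g" "g \<cdot> aone B = aone D" using assms(3) by (simp_all add: alg_hom_def)
  have "(g \<cdot> f) \<cdot> amul A = amul D \<cdot> (g \<cdot> f) \<boxdot> (g \<cdot> f)"
    using assms(1,4,5) reassoc[OF g(1)] by (simp add: f tens_comp_arr)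
  then show ?thesis using assms(1,4,5) by (simp add: alg_hom_def f g)
qed

text \<open>Multiplicativity is 1 * 1 = 1. This is the map from the unit algebra along which the
  neutral element of G(\<I>) is carried to G(A).\<close>

lemma alg_hom_aone: "comm_alg V A \<Longrightarrow> aone A \<in> alg_hom V (unit_alg V) A"
proof -
  assume A [simp]: "comm_alg V A"
  have "amul A \<cdot> aone A \<boxdot> aone A = aone A \<cdot> lu \<I>"
  proof -
    have "amul A \<cdot> aone A \<boxdot> aone A = amul A \<cdot> aone A \<triangleleft> aobj A \<cdot> \<I> \<triangleright> aone A"
      by (simp add: tens_split[of "aone A" "aone A"])
    also have "\<dots> = (amul A \<cdot> aone A \<triangleleft> aobj A) \<cdot> \<I> \<triangleright> aone A" by simp
    also have "amul A \<cdot> aone A \<triangleleft> aobj A = lu (aobj A)" using A unfolding comm_alg_def by blast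
    finally show ?thesis by (simp add: lu_nat)
  qed
  then show ?thesis by (simp add: alg_hom_def)
qed

section \<open>The tensor product as a coproduct of commutative algebras\<close>

abbreviation inl where "inl \<equiv> tensor_inl V"
abbreviation inr where "inr \<equiv> tensor_inr V"

lemma inl_arr [simp]:
  assumes "comm_alg V A" "comm_alg V B"
  shows "inl A B \<in> Arr V" "Dom V (inl A B) = aobj A" "Cod V (inl A B) = aobj A \<boxtimes> aobj B"
    "inr A B \<in> Arr V" "Dom V (inr A B) = aobj B" "Cod V (inr A B) = aobj A \<boxtimes> aobj B"
  using assms by (simp_all add: tensor_inl_def tensor_inr_def)

lemma inl_tail:
  assumes "comm_alg V A" "comm_alg V B" "Z \<in> Obj V"
  shows "inl A B \<triangleleft> Z = as' (aobj A) (aobj B) Z \<cdot> aobj A \<triangleright> unt B Z"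
    "inr A B \<triangleleft> Z = as' (aobj A) (aobj B) Z \<cdot> unt A (aobj B \<boxtimes> Z)"
  using assms by (simp_all add: tensor_inl_def tensor_inr_def tails un_def)

lemma inl_hom:
  assumes [simp]: "comm_alg V A" "comm_alg V B"
  shows "inl A B \<in> alg_hom V A (tensor_alg V A B)" "inr A B \<in> alg_hom V B (tensor_alg V A B)"
proof (rule_tac [!] alg_homI)
  let ?T = "tensor_alg V A B" and ?A = "aobj A" and ?B = "aobj B"
  note [simp] = tensor_alg_arr[OF assms]
  show "inl A B \<triangleleft> \<I> \<cdot> mul A \<I> = mul ?T \<I> \<cdot> inl A B \<triangleleft> (aobj ?T \<boxtimes> \<I>) \<cdot> ?A \<triangleright> (inl A B \<triangleleft> \<I>)"
    by (simp add: tensor_mul inl_tail lwhisker_merge natr_rules tmul_def sw_rules mul_rules)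
  show "inl A B \<triangleleft> \<I> \<cdot> unt A \<I> = unt ?T \<I>"
    by (simp add: tensor_unt inl_tail natr_rules)
  show "inr A B \<triangleleft> \<I> \<cdot> mul B \<I> = mul ?T \<I> \<cdot> inr A B \<triangleleft> (aobj ?T \<boxtimes> \<I>) \<cdot> ?B \<triangleright> (inr A B \<triangleleft> \<I>)"
    by (simp add: tensor_mul inl_tail lwhisker_merge natr_rules tmul_def sw_rules mul_rules)
  show "inr A B \<triangleleft> \<I> \<cdot> unt B \<I> = unt ?T \<I>"
    by (simp add: tensor_unt inl_tail natr_rules)
qed (use tensor_alg_arr in simp_all)

text \<open>The map sending a \<otimes> b to f(a) g(b). For algebra maps into a commutative algebra
  it is the copairing, with \<open>inl\<close> and \<open>inr\<close> as the injections of the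
  coproduct.\<close>

definition pair :: "('o, 'a) alg \<Rightarrow> 'a \<Rightarrow> 'a \<Rightarrow> 'a" where
  "pair D f g = amul D \<cdot> f \<boxdot> g"

lemma pair_arr [simp]:
  assumes "comm_alg V D" "f \<in> Arr V" "g \<in> Arr V" "Cod V f = aobj D" "Cod V g = aobj D"
  shows "pair D f g \<in> Arr V" "Dom V (pair D f g) = Dom V f \<boxtimes> Dom V g" "Cod V (pair D f g) = aobj D"
  using assms by (simp_all add: pair_def)

lemma pair_tail:
  assumes "comm_alg V D" "f \<in> Arr V" "g \<in> Arr V" "Cod V f = aobj D" "Cod V g = aobj D" "Z \<in> Obj V"
  shows "pair D f g \<triangleleft> Z =
    mul D Z \<cdot> f \<triangleleft> (aobj D \<boxtimes> Z) \<cdot> Dom V f \<triangleright> (g \<triangleleft> Z) \<cdot> as (Dom V f) (Dom V g) Z"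
  using assms by (simp add: pair_def tens_split[of f g] tails bin_def)

lemma pair_inl:
  assumes "comm_alg V A" "comm_alg V B" "comm_alg V D" "f \<in> alg_hom V A D" "g \<in> alg_hom V B D"
  shows "pair D f g \<cdot> inl A B = f" "pair D f g \<cdot> inr A B = g"
proof -
  note [simp] = alg_hom_arr[OF assms(4)] alg_hom_arr[OF assms(5)] assms(1-3)
  have [simp]: "f \<cdot> aone A = aone D" "g \<cdot> aone B = aone D" using assms(4,5) by (simp_all add: alg_hom_def)
  have u: "amul D \<cdot> aobj D \<triangleright> aone D = ru (aobj D)" "amul D \<cdot> aone D \<triangleleft> aobj D = lu (aobj D)"
    using assms(3) unfolding comm_alg_def by blast+
  have "pair D f g \<cdot> inl A B = amul D \<cdot> (f \<boxdot> aone D) \<cdot> ru' (aobj A)"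
    by (simp add: pair_def tensor_inl_def reassoc[OF tens_comp_arr])
  also have "f \<boxdot> aone D = aobj D \<triangleright> aone D \<cdot> f \<triangleleft> \<I>" by (simp add: tens_comp_arr)
  finally show "pair D f g \<cdot> inl A B = f" by (simp add: reassoc[OF u(1)] reassoc[OF ru_nat])
  have "pair D f g \<cdot> inr A B = amul D \<cdot> (aone D \<boxdot> g) \<cdot> lu' (aobj B)"
    by (simp add: pair_def tensor_inr_def reassoc[OF tens_comp_arr])
  also have "aone D \<boxdot> g = aone D \<triangleleft> aobj D \<cdot> \<I> \<triangleright> g" by (simp add: tens_comp_arr)
  finally show "pair D f g \<cdot> inr A B = g" by (simp add: reassoc[OF u(2)] reassoc[OF lu_nat])
qed

text \<open>The uniqueness half of the coproduct property: with \<open>pair_hom_comp\<close>, an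
  algebra map out of the tensor product is the copairing of its two restrictions.\<close>

lemma pair_inl_inr:
  assumes [simp]: "comm_alg V A" "comm_alg V B"
  shows "pair (tensor_alg V A B) (inl A B) (inr A B) = Id V (aobj A \<boxtimes> aobj B)"
proof (rule unit_faithful)
  show "pair (tensor_alg V A B) (inl A B) (inr A B) \<triangleleft> \<I> = Id V (aobj A \<boxtimes> aobj B) \<triangleleft> \<I>"
    by (simp add: pair_tail tensor_mul inl_tail lwhisker_merge natr_rules tmul_def sw_rules mul_rules)
qed simp_all

lemma pair_hom_comp:
  assumes "comm_alg V D" "comm_alg V E" "h \<in> alg_hom V D E" "f \<in> Arr V" "g \<in> Arr V" "Cod V f = aobj D" "Cod V g = aobj D"
  shows "pair E (h \<cdot> f) (h \<cdot> g) = h \<cdot> pair D f g"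
proof -
  note [simp] = alg_hom_arr[OF assms(3)]
  have h: "h \<cdot> amul D = amul E \<cdot> h \<boxdot> h" using assms(3) by (simp add: alg_hom_def)
  show ?thesis using assms(1,2,4-) by (simp add: pair_def reassoc[OF h] flip: tens_comp_arr)
qed

text \<open>In a triple product x(yz) the first two factors are brought together by associativity,
  swapped, and separated again.\<close>

lemma mul_mul_sw:
  assumes "comm_alg V A" "Z \<in> Obj V"
  shows "mul A Z \<cdot> aobj A \<triangleright> mul A Z \<cdot> sw (aobj A) (aobj A) (aobj A \<boxtimes> Z) = mul A Z \<cdot> aobj A \<triangleright> mul A Z"
proof -
  have "mul A Z \<cdot> aobj A \<triangleright> mul A Z \<cdot> sw (aobj A) (aobj A) (aobj A \<boxtimes> Z) =
     mul A Z \<cdot> mul A (aobj A \<boxtimes> Z) \<cdot> sw (aobj A) (aobj A) (aobj A \<boxtimes> Z)"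
    using assms reassoc[OF mul_assoc, of A Z "sw (aobj A) (aobj A) (aobj A \<boxtimes> Z)"] by simp
  then show ?thesis using assms by (simp add: mul_comm mul_assoc)
qed

lemma pair_hom:
  assumes D: "comm_alg V D" and AB: "comm_alg V A" "comm_alg V B"
    and fg: "f \<in> alg_hom V A D" "g \<in> alg_hom V B D"
  shows "pair D f g \<in> alg_hom V (tensor_alg V A B) D"
proof (rule alg_homI)
  let ?T = "tensor_alg V A B" and ?A = "aobj A" and ?B = "aobj B" and ?D = "aobj D"
  note [simp] = tensor_alg_arr[OF AB] D AB alg_hom_arr[OF fg(1)] alg_hom_arr[OF fg(2)]
  note hom = hom_mul[OF fg(1)] hom_mul[OF fg(2)]
  note homs = hom reassoc[OF hom(1)] reassoc[OF hom(2)]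
  \<comment> \<open>With the common factor f(a) split off, multiplicativity of the copairing
    compares two maps on b, a', b': \<open>?L\<close> prepares f(a') (g(b) g(b')) and
    \<open>?R\<close> prepares g(b) (f(a') g(b')). They differ by one swap in \<open>D\<close>,
    which \<open>mul_mul_sw\<close> absorbs.\<close>
  let ?L = "?D \<triangleright> (mul D \<I> \<cdot> ?D \<triangleright> (g \<triangleleft> \<I>) \<cdot> g \<triangleleft> (?B \<boxtimes> \<I>)) \<cdot> f \<triangleleft> (?B \<boxtimes> (?B \<boxtimes> \<I>)) \<cdot> sw ?B ?A (?B \<boxtimes> \<I>)"
  let ?R = "?D \<triangleright> (?D \<triangleright> (g \<triangleleft> \<I>) \<cdot> f \<triangleleft> (?B \<boxtimes> \<I>)) \<cdot> g \<triangleleft> (?A \<boxtimes> (?B \<boxtimes> \<I>))"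
  have "?L = ?D \<triangleright> mul D \<I> \<cdot> sw ?D ?D (?D \<boxtimes> \<I>) \<cdot> ?R"
    by (simp add: sw_rules rwhisker_natr reassoc[OF rwhisker_natr] lwhisker_merge)
  then have "mul D \<I> \<cdot> ?L = mul D \<I> \<cdot> ?D \<triangleright> mul D \<I> \<cdot> ?R"
    using reassoc[OF mul_mul_sw[OF D], of \<I> ?R] by simp
  then have "(mul D \<I> \<cdot> ?L) \<cdot> ?B \<triangleright> as ?A ?B \<I> = (mul D \<I> \<cdot> ?D \<triangleright> mul D \<I> \<cdot> ?R) \<cdot> ?B \<triangleright> as ?A ?B \<I>"
    by simp
  then show "pair D f g \<triangleleft> \<I> \<cdot> mul ?T \<I> =
      mul D \<I> \<cdot> pair D f g \<triangleleft> (aobj D \<boxtimes> \<I>) \<cdot> aobj ?T \<triangleright> (pair D f g \<triangleleft> \<I>)"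
    by (simp add: pair_tail tensor_mul tail_rules(3) tmul_def natr_rules homs rwhisker_natr
      reassoc[OF rwhisker_natr] lwhisker_merge mul_assoc reassoc[OF mul_assoc])
  show "pair D f g \<triangleleft> \<I> \<cdot> unt ?T \<I> = unt D \<I>"
    by (simp add: pair_tail tensor_unt natr_rules mul_rules
      hom_unt[OF fg(1)] reassoc[OF hom_unt[OF fg(1)]] hom_unt[OF fg(2)])
qed (use assms tensor_alg_arr alg_hom_arr[OF fg(1)] alg_hom_arr[OF fg(2)] in simp_all)

lemma comm_alg_laws:
  assumes "comm_alg V A"
  shows "amul A \<cdot> amul A \<triangleleft> aobj A = amul A \<cdot> aobj A \<triangleright> amul A \<cdot> as (aobj A) (aobj A) (aobj A)"
    "amul A \<cdot> aone A \<triangleleft> aobj A = lu (aobj A)" "amul A \<cdot> aobj A \<triangleright> aone A = ru (aobj A)"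
  using assms unfolding comm_alg_def by blast+

section \<open>Additivity of the tensor product, rigid objects and duals\<close>

lemma tens_Add:
  assumes "f \<in> Arr V" "g \<in> Arr V" "h \<in> Arr V" "Dom V f = Dom V g" "Cod V f = Cod V g"
  shows "h \<boxdot> (f \<boxplus> g) = h \<boxdot> f \<boxplus> h \<boxdot> g" "(f \<boxplus> g) \<boxdot> h = f \<boxdot> h \<boxplus> g \<boxdot> h"
  using assms tens_add_left[of f _ _ g h] tens_add_right[of f _ _ g h] by auto

lemma tens_Zero [simp]:
  assumes "h \<in> Arr V" "X \<in> Obj V" "Y \<in> Obj V"
  shows "h \<boxdot> Zero V X Y = Zero V (Dom V h \<boxtimes> X) (Cod V h \<boxtimes> Y)"
    "Zero V X Y \<boxdot> h = Zero V (X \<boxtimes> Dom V h) (Y \<boxtimes> Cod V h)"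
proof (rule_tac [!] Add_eq_self)
  show "h \<boxdot> Zero V X Y \<boxplus> h \<boxdot> Zero V X Y = h \<boxdot> Zero V X Y"
    "Zero V X Y \<boxdot> h \<boxplus> Zero V X Y \<boxdot> h = Zero V X Y \<boxdot> h"
    using assms tens_Add[of "Zero V X Y" "Zero V X Y" h] by simp_all
qed (use assms in auto)

lemma ru_tens:
  assumes "X \<in> Obj V" "Y \<in> Obj V"
  shows "ru (X \<boxtimes> Y) = X \<triangleright> ru Y \<cdot> as X Y \<I>"
  by (rule unit_faithful) (use assms in \<open>simp_all add: tails\<close>)

text \<open>Interchange slides \<open>h\<close> past \<open>ev\<close>; what remains acts on
  \<open>X\<close> alone and is the zigzag identity. Hence transposition along the duality is
  injective.\<close>

lemma unmate_mate:
  assumes [simp]: "X \<in> Obj V" "X' \<in> Obj V" "B \<in> Obj V"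
    and [simp]: "ev \<in> Arr V" "Dom V ev = X' \<boxtimes> X" "Cod V ev = \<I>"
    and [simp]: "coev \<in> Arr V" "Dom V coev = \<I>" "Cod V coev = X \<boxtimes> X'"
    and zigzag: "ru X \<cdot> X \<triangleright> ev \<cdot> as X X' X \<cdot> coev \<triangleleft> X \<cdot> lu' X = Id V X"
    and [simp]: "h \<in> Arr V" "Dom V h = B \<boxtimes> X" "Cod V h = W"
  shows "ru W \<cdot> W \<triangleright> ev \<cdot> as W X' X \<cdot> (h \<triangleleft> X' \<cdot> as' B X X' \<cdot> B \<triangleright> coev \<cdot> ru' B) \<triangleleft> X = h"
proof -
  have [simp]: "W \<in> Obj V" using assms arr_objs by metis
  have "ru W \<cdot> W \<triangleright> ev \<cdot> as W X' X \<cdot> (h \<triangleleft> X' \<cdot> as' B X X' \<cdot> B \<triangleright> coev \<cdot> ru' B) \<triangleleft> X =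
    ru W \<cdot> (W \<triangleright> ev \<cdot> h \<triangleleft> (X' \<boxtimes> X)) \<cdot> as' B X (X' \<boxtimes> X) \<cdot> B \<triangleright> (as X X' X \<cdot> coev \<triangleleft> X \<cdot> lu' X)"
    by (simp add: tails)
  also have "W \<triangleright> ev \<cdot> h \<triangleleft> (X' \<boxtimes> X) = h \<triangleleft> \<I> \<cdot> (B \<boxtimes> X) \<triangleright> ev"
    by (simp add: rwhisker_natr)
  also have "ru W \<cdot> (h \<triangleleft> \<I> \<cdot> (B \<boxtimes> X) \<triangleright> ev) \<cdot> as' B X (X' \<boxtimes> X) \<cdot> B \<triangleright> (as X X' X \<cdot> coev \<triangleleft> X \<cdot> lu' X) =
    h \<cdot> B \<triangleright> (ru X \<cdot> X \<triangleright> ev \<cdot> as X X' X \<cdot> coev \<triangleleft> X \<cdot> lu' X)"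
    by (simp add: reassoc[OF ru_nat] ru_tens tail_rules(3) lwhisker_merge)
  finally show ?thesis unfolding zigzag by simp
qed

text \<open>
  The duality makes \<open>- \<otimes> X\<close> left adjoint to \<open>- \<otimes> X'\<close>; passing to mates, of which only \<open>unmate_mate\<close>
  is needed, transports the universal property of the cokernel.
\<close>

lemma rigid_cokernel:
  assumes X [simp]: "X \<in> Obj V" "X' \<in> Obj V"
    and [simp]: "ev \<in> Arr V" "Dom V ev = X' \<boxtimes> X" "Cod V ev = \<I>"
    and [simp]: "coev \<in> Arr V" "Dom V coev = \<I>" "Cod V coev = X \<boxtimes> X'"
    and zigzag: "ru X \<cdot> X \<triangleright> ev \<cdot> as X X' X \<cdot> coev \<triangleleft> X \<cdot> lu' X = Id V X"
    and coker: "is_cokernel V f q"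
  shows "is_cokernel V (X \<triangleright> f) (X \<triangleright> q)"
proof (rule is_cokernelI)
  note [simp] = is_cokernel_arr[OF coker]
  define mate where "mate B h = h \<triangleleft> X' \<cdot> as' B X X' \<cdot> B \<triangleright> coev \<cdot> ru' B" for B h
  define unmate where "unmate W k = ru W \<cdot> W \<triangleright> ev \<cdot> as W X' X \<cdot> k \<triangleleft> X" for W k
  have mate_arr: "mate B h \<in> Arr V" "Dom V (mate B h) = B" "Cod V (mate B h) = Cod V h \<boxtimes> X'"
    if "h \<in> Arr V" "Dom V h = B \<boxtimes> X" "B \<in> Obj V" for B h
    using that by (simp_all add: mate_def)
  have unmate: "unmate W (mate B h) = h"
    if "h \<in> Arr V" "Dom V h = B \<boxtimes> X" "Cod V h = W" "B \<in> Obj V" for B h W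
    unfolding mate_def unmate_def by (rule unmate_mate) (use zigzag that in simp_all)
  have mate_comp: "mate B (h \<cdot> g \<triangleleft> X) = mate B' h \<cdot> g"
    if "h \<in> Arr V" "Dom V h = B' \<boxtimes> X" "g \<in> Arr V" "Dom V g = B" "Cod V g = B'" "B \<in> Obj V" "B' \<in> Obj V" for B B' h g
    using that by (simp add: mate_def tails ru'_nat rwhisker_natr reassoc[OF rwhisker_natr])
  show "X \<triangleright> q \<cdot> X \<triangleright> f = Zero V (Dom V (X \<triangleright> f)) (Cod V (X \<triangleright> q))" by (simp add: lwhisker_merge)
  fix W
  {
    fix h
    assume h: "h \<in> mor V (Cod V (X \<triangleright> f)) W" and "h \<cdot> X \<triangleright> f = Zero V (Dom V (X \<triangleright> f)) W"
    then have hh [simp]: "h \<in> Arr V" "Dom V h = X \<boxtimes> Cod V f" "Cod V h = W"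
      and hf: "h \<cdot> X \<triangleright> f = Zero V (X \<boxtimes> Dom V f) W" by simp_all
    have [simp]: "W \<in> Obj V" using arr_objs(2)[OF hh(1)] hh(3) by simp
    \<comment> \<open>Transposition applies to tensoring with \<open>X\<close> on the right, so the
      braiding first moves \<open>X\<close> to that side.\<close>
    let ?h = "h \<cdot> br (Cod V f) X"
    have "?h \<cdot> f \<triangleleft> X = (h \<cdot> X \<triangleright> f) \<cdot> br (Dom V f) X" by (simp add: braid_nat)
    also have "\<dots> = Zero V (Dom V f \<boxtimes> X) W" unfolding hf by simp
    finally have "mate (Cod V f) ?h \<cdot> f = mate (Dom V f) (Zero V (Dom V f \<boxtimes> X) W)"
      by (subst mate_comp[symmetric]) simp_all
    also have "\<dots> = Zero V (Dom V f) (W \<boxtimes> X')" by (simp add: mate_def)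
    finally obtain u where u: "u \<in> mor V (Cod V q) (W \<boxtimes> X')" "u \<cdot> q = mate (Cod V f) ?h"
      using cokernel_factor[OF coker, of "mate (Cod V f) ?h" "W \<boxtimes> X'"] mate_arr[of ?h "Cod V f"] by auto
    let ?u = "unmate W u \<cdot> br X (Cod V q)"
    have "?u \<cdot> X \<triangleright> q = unmate W u \<cdot> q \<triangleleft> X \<cdot> br X (Cod V f)"
      using u(1) by (simp add: braid_nat unmate_def)
    also have "\<dots> = unmate W (u \<cdot> q) \<cdot> br X (Cod V f)"
      using u(1) by (simp add: unmate_def rwhisker_comp)
    also have "\<dots> = h" by (simp add: u(2) unmate)
    finally have "?u \<cdot> X \<triangleright> q = h" .
    then show "\<exists>u\<in>mor V (Cod V (X \<triangleright> q)) W. u \<cdot> X \<triangleright> q = h"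
      using u(1) by (intro bexI[of _ ?u]) (simp_all add: unmate_def)
  next
    fix u v
    assume "u \<in> mor V (Cod V (X \<triangleright> q)) W" "v \<in> mor V (Cod V (X \<triangleright> q)) W" and eq: "u \<cdot> X \<triangleright> q = v \<cdot> X \<triangleright> q"
    then have [simp]: "u \<in> Arr V" "Dom V u = X \<boxtimes> Cod V q" "Cod V u = W"
      "v \<in> Arr V" "Dom V v = X \<boxtimes> Cod V q" "Cod V v = W" by simp_all
    \<comment> \<open>Transposition turns precomposition with \<open>X \<triangleright> q\<close>
      into precomposition with \<open>q\<close>, which can be cancelled; injectivity of
      \<open>mate\<close> then gives uniqueness.\<close>
    have m: "mate (Cod V q) (w \<cdot> br (Cod V q) X) \<cdot> q = mate (Cod V f) ((w \<cdot> X \<triangleright> q) \<cdot> br (Cod V f) X)"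
      if "w \<in> Arr V" "Dom V w = X \<boxtimes> Cod V q" for w
      using that by (subst mate_comp[symmetric]) (simp_all add: braid_nat)
    have "mate (Cod V q) (u \<cdot> br (Cod V q) X) = mate (Cod V q) (v \<cdot> br (Cod V q) X)"
      by (rule cokernel_epi[OF coker, of _ "W \<boxtimes> X'"])
        (simp_all add: mate_arr m eq)
    then have "unmate W (mate (Cod V q) (u \<cdot> br (Cod V q) X)) = unmate W (mate (Cod V q) (v \<cdot> br (Cod V q) X))"
      by simp
    then have "u \<cdot> br (Cod V q) X = v \<cdot> br (Cod V q) X" by (simp add: unmate)
    then show "u = v"
      by (rule iso_cancel_right[OF _ isosI(1)[of _ _ _ "br X (Cod V q)"]]) simp_all
  }
qed (use is_cokernel_arr[OF coker] in simp_all)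

lemma dual_factor:
  assumes "is_dual V X D ev" "Y \<in> Obj V" "h \<in> mor V (Y \<boxtimes> X) \<I>"
  obtains u where "u \<in> mor V Y D" "ev \<cdot> u \<triangleleft> X = h"
  using assms unfolding is_dual_def by blast

lemma dual_unique:
  assumes dual: "is_dual V X D ev" and uv: "u \<in> mor V Y D" "v \<in> mor V Y D" "ev \<cdot> u \<triangleleft> X = ev \<cdot> v \<triangleleft> X"
  shows "u = v"
proof -
  have "Y \<in> Obj V" using uv(1) by auto
  moreover have "ev \<cdot> u \<triangleleft> X \<in> mor V (Y \<boxtimes> X) \<I>" using dual uv(1) by (simp add: is_dual_def)
  ultimately have "\<exists>!w. w \<in> mor V Y D \<and> ev \<cdot> w \<triangleleft> X = ev \<cdot> u \<triangleleft> X"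
    using dual unfolding is_dual_def by blast
  then show ?thesis using uv by metis
qed

end

section \<open>Right exactness of the tensor product in an ind-completion\<close>

lemma full_subcategory_sel:
  assumes "C = full_subcategory V S"
  shows "Arr C = {f \<in> Arr V. Dom V f \<in> S \<and> Cod V f \<in> S}" "Dom C = Dom V" "Cod C = Cod V"
    "Id C = Id V" "Comp C = Comp V"
  using assms by (simp_all add: full_subcategory_def)

locale ind_tensor_category = ind_completion universe C V
  for universe :: "'u itself" and C :: "('o, 'a, 'k::alg_closed_field) sym_cat"
    and V :: "('o, 'a, 'k) sym_cat" (structure) +
  assumes tensor_category: "finite_symmetric_tensor_category C"
begin

lemma C_sel: "TensO C = TensO V" "TensA C = TensA V" "Unit C = Unit V" "Assoc C = Assoc V"
    "LUnit C = LUnit V" "RUnit C = RUnit V"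
  by (subst subcategory(2), simp add: full_subcategory_def)+

lemma rigid_subcategory:
  assumes "X \<in> Obj C"
  obtains X' ev coev where "X' \<in> Obj V" "ev \<in> mor V (X' \<boxtimes> X) \<I>" "coev \<in> mor V \<I> (X \<boxtimes> X')"
    "ru X \<cdot> X \<triangleright> ev \<cdot> as X X' X \<cdot> coev \<triangleleft> X \<cdot> lu' X = Id V X"
proof -
  interpret C: finite_symmetric_tensor_category C by (fact tensor_category)
  note sel = full_subcategory_sel[OF subcategory(2)] C_sel
  have X: "X \<in> Obj V" using subcategory(1) assms by blast
  \<comment> \<open>\<open>inverse_arr\<close> is a description over the arrows of the category at
    hand. To read the zigzag identity of \<open>C\<close> in \<open>V\<close>, the inverse formed in
    \<open>V\<close> has to lie in \<open>C\<close>, hence so does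
    \<open>\<I> \<boxtimes> X\<close>.\<close>
  have "\<I> \<boxtimes> X \<in> Obj C" using C.tens_obj[OF C.unit_obj assms] by (simp add: sel)
  then have "is_inverse C (lu X) (lu' X)"
    using X assms by (simp add: is_inverse_def sel)
  then have inv: "inverse_arr C (lu X) = lu' X" by (rule C.inverse_arr_eq)
  obtain X' ev coev where X': "X' \<in> Obj C" "ev \<in> mor C (X' \<boxtimes> X) \<I>" "coev \<in> mor C \<I> (X \<boxtimes> X')"
    "ru X \<cdot> X \<triangleright> ev \<cdot> as X X' X \<cdot> coev \<triangleleft> X \<cdot> lu' X = Id V X"
    using C.all_rigid[OF assms] unfolding rigid_def by (auto simp: sel inv)
  show ?thesis by (rule that[of X' ev coev]) (use X' subcategory(1) in \<open>auto simp: sel\<close>)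
qed

text \<open>Both arrows mediate the cocone obtained by composing the legs of the colimit with
  \<open>u\<close>, so they agree.\<close>

lemma colimit_jointly_epi:
  assumes "is_colimit V I Fo Fa L l" "u \<in> mor V L M" "v \<in> mor V L M"
    and "\<And>i j w. w \<in> mor I i j \<Longrightarrow> i \<in> Obj I \<and> j \<in> Obj I \<and> Fa w \<in> mor V (Fo i) (Fo j)"
    and "\<And>i. i \<in> Obj I \<Longrightarrow> u \<cdot> l i = v \<cdot> l i"
  shows "u = v"
proof -
  have l: "\<And>i. i \<in> Obj I \<Longrightarrow> l i \<in> mor V (Fo i) L" "\<And>i j w. w \<in> mor I i j \<Longrightarrow> l j \<cdot> Fa w = l i"
    using assms(1) unfolding is_colimit_def cocone_def by blast+
  have "cocone V I Fo Fa M (\<lambda>i. u \<cdot> l i)"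
    unfolding cocone_def
  proof (intro conjI ballI allI)
    show "M \<in> Obj V" using assms(2) by auto
    show "u \<cdot> l i \<in> mor V (Fo i) M" if "i \<in> Obj I" for i using l(1)[OF that] assms(2) by simp
    fix i j w assume w: "w \<in> mor I i j"
    have "(u \<cdot> l j) \<cdot> Fa w = u \<cdot> (l j \<cdot> Fa w)"
      using assms(2) assms(4)[OF w] l(1)[of j] by simp
    then show "(u \<cdot> l j) \<cdot> Fa w = u \<cdot> l i" using l(2)[OF w] by simp
  qed
  then have "\<exists>!w. w \<in> mor V L M \<and> (\<forall>i\<in>Obj I. w \<cdot> l i = u \<cdot> l i)"
    using assms(1) unfolding is_colimit_def by blast
  then show ?thesis using assms(2,3,5) by metis
qed

text \<open>At each stage \<open>Fo i\<close> of a diagram in \<open>C\<close> with colimit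
  \<open>X\<close>, rigidity makes \<open>Fo i \<triangleright> q\<close> a cokernel. Tensoring with
  a fixed object preserves the colimit, so the factorisations found at the stages glue to one on
  \<open>X\<close>.\<close>

lemma right_exact:
  assumes coker: "is_cokernel V f q" and X [simp]: "X \<in> Obj V"
  shows "is_cokernel V (X \<triangleright> f) (X \<triangleright> q)"
proof -
  note [simp] = is_cokernel_arr[OF coker]
  obtain I :: "('u, 'u) cat" and Fo Fa l where diag: "small_filtered_diagram V I Fo Fa"
    and FoC: "\<And>i. i \<in> Obj I \<Longrightarrow> Fo i \<in> Obj C" and colim: "is_colimit V I Fo Fa X l"
    using generated[OF X] by blast
  have FoV: "Fo i \<in> Obj V" if "i \<in> Obj I" for i using FoC[OF that] subcategory(1) by blast
  have Fa: "i \<in> Obj I \<and> j \<in> Obj I \<and> Fa w \<in> mor V (Fo i) (Fo j)" if "w \<in> mor I i j" for i j w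
  proof -
    have "category I" "cat_functor I V Fo Fa"
      using diag by (simp_all add: small_filtered_diagram_def filtered_category_def)
    then show ?thesis using that category.dom_obj[of I w] category.cod_obj[of I w]
      unfolding cat_functor_def by auto
  qed
  have l: "\<And>i. i \<in> Obj I \<Longrightarrow> l i \<in> mor V (Fo i) X" "\<And>i j w. w \<in> mor I i j \<Longrightarrow> l j \<cdot> Fa w = l i"
    using colim unfolding is_colimit_def cocone_def by blast+
  have colim_tens: "is_colimit V I (\<lambda>i. Fo i \<boxtimes> B) (\<lambda>u. Fa u \<triangleleft> B) (X \<boxtimes> B) (\<lambda>i. l i \<triangleleft> B)" if "B \<in> Obj V" for B
    by (rule tens_colimit_left[OF diag colim that])
  have joint: "u = v" if "u \<in> mor V (X \<boxtimes> B) W" "v \<in> mor V (X \<boxtimes> B) W" "B \<in> Obj V"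
    "\<And>i. i \<in> Obj I \<Longrightarrow> u \<cdot> l i \<triangleleft> B = v \<cdot> l i \<triangleleft> B" for u v B W
    by (rule colimit_jointly_epi[OF colim_tens[OF that(3)] that(1,2) _ that(4)])
      (use Fa that(3) FoV in \<open>fastforce\<close>)+
  have coker_Fo: "is_cokernel V (Fo i \<triangleright> f) (Fo i \<triangleright> q)" if i: "i \<in> Obj I" for i
  proof -
    obtain X' ev coev where "X' \<in> Obj V" "ev \<in> mor V (X' \<boxtimes> Fo i) \<I>" "coev \<in> mor V \<I> (Fo i \<boxtimes> X')"
      "ru (Fo i) \<cdot> Fo i \<triangleright> ev \<cdot> as (Fo i) X' (Fo i) \<cdot> coev \<triangleleft> Fo i \<cdot> lu' (Fo i) = Id V (Fo i)"
      using rigid_subcategory[OF FoC[OF i]] .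
    then show ?thesis by (intro rigid_cokernel[of "Fo i" X' ev coev f q]) (use FoV[OF i] coker in simp_all)
  qed
  have l_q: "l i \<triangleleft> Cod V q \<cdot> Fo i \<triangleright> q = X \<triangleright> q \<cdot> l i \<triangleleft> Cod V f" if "i \<in> Obj I" for i
    using l(1)[OF that] FoV[OF that] by (simp add: rwhisker_natr)
  show ?thesis
  proof (rule is_cokernelI)
    show "X \<triangleright> q \<cdot> X \<triangleright> f = Zero V (Dom V (X \<triangleright> f)) (Cod V (X \<triangleright> q))" by (simp add: lwhisker_merge)
    fix W
    {
      fix h
      assume "h \<in> mor V (Cod V (X \<triangleright> f)) W" "h \<cdot> X \<triangleright> f = Zero V (Dom V (X \<triangleright> f)) W"
      then have h [simp]: "h \<in> Arr V" "Dom V h = X \<boxtimes> Cod V f" "Cod V h = W"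
        and hf: "h \<cdot> X \<triangleright> f = Zero V (X \<boxtimes> Dom V f) W" by simp_all
      have W [simp]: "W \<in> Obj V" using arr_objs(2)[OF h(1)] h(3) by simp
      have "\<exists>u. u \<in> mor V (Fo i \<boxtimes> Cod V q) W \<and> u \<cdot> Fo i \<triangleright> q = h \<cdot> l i \<triangleleft> Cod V f" if i: "i \<in> Obj I" for i
      proof -
        note [simp] = FoV[OF i] l(1)[OF i, unfolded mor_def, simplified]
        have "(h \<cdot> l i \<triangleleft> Cod V f) \<cdot> Fo i \<triangleright> f = (h \<cdot> X \<triangleright> f) \<cdot> l i \<triangleleft> Dom V f"
          by (simp add: rwhisker_natr)
        then have "(h \<cdot> l i \<triangleleft> Cod V f) \<cdot> Fo i \<triangleright> f = Zero V (Dom V (Fo i \<triangleright> f)) W"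
          unfolding hf by simp
        then show ?thesis
          using cokernel_factor[OF coker_Fo[OF i], of "h \<cdot> l i \<triangleleft> Cod V f" W] by auto
      qed
      then obtain u where u: "\<And>i. i \<in> Obj I \<Longrightarrow> u i \<in> mor V (Fo i \<boxtimes> Cod V q) W"
        "\<And>i. i \<in> Obj I \<Longrightarrow> u i \<cdot> Fo i \<triangleright> q = h \<cdot> l i \<triangleleft> Cod V f" by metis
      have "cocone V I (\<lambda>i. Fo i \<boxtimes> Cod V q) (\<lambda>u. Fa u \<triangleleft> Cod V q) W u"
        unfolding cocone_def
      proof (intro conjI ballI allI)
        show "W \<in> Obj V" by simp
        show "u i \<in> mor V (Fo i \<boxtimes> Cod V q) W" if "i \<in> Obj I" for i using u(1)[OF that] .
        fix i j w assume w: "w \<in> mor I i j"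
        have ij: "i \<in> Obj I" "j \<in> Obj I" using Fa[OF w] by auto
        note [simp] = FoV[OF ij(1)] FoV[OF ij(2)] u(1)[OF ij(1), simplified] u(1)[OF ij(2), simplified]
          l(1)[OF ij(1), simplified] l(1)[OF ij(2), simplified]
        have [simp]: "Fa w \<in> Arr V" "Dom V (Fa w) = Fo i" "Cod V (Fa w) = Fo j" using Fa[OF w] by auto
        \<comment> \<open>Compatibility of the factorisations is tested after the epimorphism
          \<open>Fo i \<triangleright> q\<close>, where both sides become the restriction of
          \<open>h\<close> to stage \<open>i\<close>.\<close>
        show "u j \<cdot> Fa w \<triangleleft> Cod V q = u i"
        proof (rule cokernel_epi[OF coker_Fo[OF ij(1)], of _ W])
          have "(u j \<cdot> Fa w \<triangleleft> Cod V q) \<cdot> Fo i \<triangleright> q = (u j \<cdot> Fo j \<triangleright> q) \<cdot> Fa w \<triangleleft> Cod V f"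
            by (simp add: rwhisker_natr)
          also have "\<dots> = h \<cdot> (l j \<cdot> Fa w) \<triangleleft> Cod V f" unfolding u(2)[OF ij(2)] by (simp add: rwhisker_comp)
          finally show "(u j \<cdot> Fa w \<triangleleft> Cod V q) \<cdot> Fo i \<triangleright> q = u i \<cdot> Fo i \<triangleright> q"
            unfolding l(2)[OF w] u(2)[OF ij(1)] .
        qed simp_all
      qed
      then obtain v where v: "v \<in> mor V (X \<boxtimes> Cod V q) W" "\<And>i. i \<in> Obj I \<Longrightarrow> v \<cdot> l i \<triangleleft> Cod V q = u i"
        using colim_tens[of "Cod V q"] unfolding is_colimit_def
        by (metis (no_types, lifting) arr_objs(2) is_cokernel_arr(2) coker)
      have "v \<cdot> X \<triangleright> q = h"
      proof (rule joint[of _ "Cod V f" W])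
        fix i assume i: "i \<in> Obj I"
        note [simp] = FoV[OF i] l(1)[OF i, simplified]
        have "(v \<cdot> X \<triangleright> q) \<cdot> l i \<triangleleft> Cod V f = (v \<cdot> l i \<triangleleft> Cod V q) \<cdot> Fo i \<triangleright> q"
          using v(1) by (simp add: l_q[OF i])
        then show "(v \<cdot> X \<triangleright> q) \<cdot> l i \<triangleleft> Cod V f = h \<cdot> l i \<triangleleft> Cod V f"
          unfolding v(2)[OF i] u(2)[OF i] .
      qed (use v(1) in simp_all)
      then show "\<exists>u\<in>mor V (Cod V (X \<triangleright> q)) W. u \<cdot> X \<triangleright> q = h"
        using v(1) by (intro bexI[of _ v]) simp_all
    next
      fix u v
      assume "u \<in> mor V (Cod V (X \<triangleright> q)) W" "v \<in> mor V (Cod V (X \<triangleright> q)) W" and eq: "u \<cdot> X \<triangleright> q = v \<cdot> X \<triangleright> q"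
      then have uv [simp]: "u \<in> Arr V" "Dom V u = X \<boxtimes> Cod V q" "Cod V u = W"
        "v \<in> Arr V" "Dom V v = X \<boxtimes> Cod V q" "Cod V v = W" by simp_all
      show "u = v"
      proof (rule joint[of _ "Cod V q" W])
        fix i assume i: "i \<in> Obj I"
        note [simp] = FoV[OF i] l(1)[OF i, simplified]
        show "u \<cdot> l i \<triangleleft> Cod V q = v \<cdot> l i \<triangleleft> Cod V q"
        proof (rule cokernel_epi[OF coker_Fo[OF i], of _ W])
          have "(w \<cdot> l i \<triangleleft> Cod V q) \<cdot> Fo i \<triangleright> q = (w \<cdot> X \<triangleright> q) \<cdot> l i \<triangleleft> Cod V f"
            if "w \<in> Arr V" "Dom V w = X \<boxtimes> Cod V q" for w using that by (simp add: l_q[OF i])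
          then show "(u \<cdot> l i \<triangleleft> Cod V q) \<cdot> Fo i \<triangleright> q = (v \<cdot> l i \<triangleleft> Cod V q) \<cdot> Fo i \<triangleright> q"
            using eq uv by metis
        qed simp_all
      qed simp_all
    }
  qed simp_all
qed

end

section \<open>The Hopf algebra of a group scheme\<close>

locale group_scheme = symmetric_monoidal_category V
  for V :: "('o, 'a, 'k::field, 'm) sym_cat_scheme" (structure) +
  fixes G :: "('o, 'a, 'g) alg_functor" and R :: "('o, 'a) alg"
    and \<Phi> :: "('o, 'a) alg \<Rightarrow> 'a \<Rightarrow> 'g"
  assumes grp: "group_functor V G" and coord: "coordinate_ring V G R \<Phi>"
begin

abbreviation "\<Delta> \<equiv> comult V G R \<Phi>"
abbreviation "\<eta> \<equiv> counit V G R \<Phi>"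
abbreviation "H \<equiv> aobj R"
abbreviation "RR \<equiv> tensor_alg V R R"

lemma comm_alg_R [simp]: "comm_alg V R"
  using coord by (simp add: coordinate_ring_def)

lemma pts_group: "comm_alg V A \<Longrightarrow> group (pts G A)"
  using grp by (simp add: group_functor_def)

lemma pts_map_hom:
  "comm_alg V A \<Longrightarrow> comm_alg V B \<Longrightarrow> f \<in> alg_hom V A B \<Longrightarrow> pts_map G A B f \<in> hom (pts G A) (pts G B)"
  using grp by (simp add: group_functor_def)

lemma \<Phi>_bij: "comm_alg V A \<Longrightarrow> bij_betw (\<Phi> A) (alg_hom V R A) (carrier (pts G A))"
  using coord by (simp add: coordinate_ring_def)

lemma \<Phi>_carrier: "comm_alg V A \<Longrightarrow> f \<in> alg_hom V R A \<Longrightarrow> \<Phi> A f \<in> carrier (pts G A)"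
  using \<Phi>_bij bij_betwE by blast

lemma \<Phi>_inj: "comm_alg V A \<Longrightarrow> f \<in> alg_hom V R A \<Longrightarrow> g \<in> alg_hom V R A \<Longrightarrow> \<Phi> A f = \<Phi> A g \<Longrightarrow> f = g"
  using \<Phi>_bij by (meson bij_betw_imp_inj_on inj_onD)

lemma \<Phi>_comp:
  "comm_alg V A \<Longrightarrow> comm_alg V B \<Longrightarrow> f \<in> alg_hom V R A \<Longrightarrow> g \<in> alg_hom V A B \<Longrightarrow>
    \<Phi> B (g \<cdot> f) = pts_map G A B g (\<Phi> A f)"
  using coord by (simp add: coordinate_ring_def)

lemma comult: "\<Delta> \<in> alg_hom V R RR" "\<Phi> RR \<Delta> = \<Phi> RR (inl R R) \<otimes>\<^bsub>pts G RR\<^esub> \<Phi> RR (inr R R)"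
proof -
  interpret group "pts G RR" by (simp add: pts_group)
  have *: "\<Phi> RR (inl R R) \<otimes>\<^bsub>pts G RR\<^esub> \<Phi> RR (inr R R) \<in> carrier (pts G RR)"
    by (simp add: \<Phi>_carrier inl_hom)
  have **: "bij_betw (\<Phi> RR) (alg_hom V R RR) (carrier (pts G RR))" by (simp add: \<Phi>_bij)
  show "\<Phi> RR \<Delta> = \<Phi> RR (inl R R) \<otimes>\<^bsub>pts G RR\<^esub> \<Phi> RR (inr R R)"
    unfolding comult_def Let_def by (rule f_the_inv_into_f_bij_betw[OF ** *])
  show "\<Delta> \<in> alg_hom V R RR"
    unfolding comult_def Let_def using bij_betw_the_inv_into[OF **] * by (meson bij_betwE)
qed

lemma counit: "\<eta> \<in> alg_hom V R (unit_alg V)" "\<Phi> (unit_alg V) \<eta> = \<one>\<^bsub>pts G (unit_alg V)\<^esub>"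
proof -
  interpret group "pts G (unit_alg V)" by (simp add: pts_group)
  have **: "bij_betw (\<Phi> (unit_alg V)) (alg_hom V R (unit_alg V)) (carrier (pts G (unit_alg V)))"
    by (simp add: \<Phi>_bij)
  show "\<Phi> (unit_alg V) \<eta> = \<one>\<^bsub>pts G (unit_alg V)\<^esub>"
    unfolding counit_def by (rule f_the_inv_into_f_bij_betw[OF ** one_closed])
  show "\<eta> \<in> alg_hom V R (unit_alg V)"
    unfolding counit_def using bij_betw_the_inv_into[OF **] one_closed by (meson bij_betwE)
qed

lemma hopf_arr [simp]:
  "\<Delta> \<in> Arr V" "Dom V \<Delta> = H" "Cod V \<Delta> = H \<boxtimes> H"
  "\<eta> \<in> Arr V" "Dom V \<eta> = H" "Cod V \<eta> = \<I>"
  using alg_hom_arr[OF comult(1)] alg_hom_arr[OF counit(1)] by simp_all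

text \<open>By definition \<Delta> is the product of the two tautological points of G(R \<otimes>
  R). The algebra map \<open>pair A f g\<close> induces a group homomorphism that sends these points
  to those of \<open>f\<close> and \<open>g\<close>, hence their product to the product.\<close>

lemma pair_comult:
  assumes "comm_alg V A" "f \<in> alg_hom V R A" "g \<in> alg_hom V R A"
  shows "pair A f g \<cdot> \<Delta> \<in> alg_hom V R A" "\<Phi> A (pair A f g \<cdot> \<Delta>) = \<Phi> A f \<otimes>\<^bsub>pts G A\<^esub> \<Phi> A g"
proof -
  have p: "pair A f g \<in> alg_hom V RR A" using assms by (simp add: pair_hom)
  show "pair A f g \<cdot> \<Delta> \<in> alg_hom V R A"
    using assms by (intro alg_hom_comp[OF _ comult(1) p]) simp_all
  have "\<Phi> A (pair A f g \<cdot> \<Delta>) = pts_map G RR A (pair A f g) (\<Phi> RR (inl R R) \<otimes>\<^bsub>pts G RR\<^esub> \<Phi> RR (inr R R))"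
    using assms by (simp add: \<Phi>_comp[OF _ _ comult(1) p] comult(2))
  also have "\<dots> = pts_map G RR A (pair A f g) (\<Phi> RR (inl R R)) \<otimes>\<^bsub>pts G A\<^esub> pts_map G RR A (pair A f g) (\<Phi> RR (inr R R))"
    using assms by (intro hom_mult[OF pts_map_hom]) (simp_all add: p \<Phi>_carrier inl_hom)
  also have "\<dots> = \<Phi> A (pair A f g \<cdot> inl R R) \<otimes>\<^bsub>pts G A\<^esub> \<Phi> A (pair A f g \<cdot> inr R R)"
    using assms by (simp add: \<Phi>_comp[OF _ _ _ p] inl_hom)
  finally show "\<Phi> A (pair A f g \<cdot> \<Delta>) = \<Phi> A f \<otimes>\<^bsub>pts G A\<^esub> \<Phi> A g"
    using pair_inl[of R R A f g] assms by simp
qed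

text \<open>\<open>aone A\<close> is an algebra map from the unit algebra, so it induces a group
  homomorphism, which preserves neutral elements.\<close>

lemma \<Phi>_unit:
  assumes "comm_alg V A"
  shows "aone A \<cdot> \<eta> \<in> alg_hom V R A" "\<Phi> A (aone A \<cdot> \<eta>) = \<one>\<^bsub>pts G A\<^esub>"
proof -
  have a: "aone A \<in> alg_hom V (unit_alg V) A" using assms by (rule alg_hom_aone)
  show "aone A \<cdot> \<eta> \<in> alg_hom V R A"
    using assms by (intro alg_hom_comp[OF _ counit(1) a]) simp_all
  have "\<Phi> A (aone A \<cdot> \<eta>) = pts_map G (unit_alg V) A (aone A) \<one>\<^bsub>pts G (unit_alg V)\<^esub>"
    using assms by (simp add: \<Phi>_comp[OF _ _ counit(1) a] counit(2))
  also have "\<dots> = \<one>\<^bsub>pts G A\<^esub>"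
    using assms by (intro hom_one[OF pts_map_hom]) (simp_all add: a pts_group)
  finally show "\<Phi> A (aone A \<cdot> \<eta>) = \<one>\<^bsub>pts G A\<^esub>" .
qed

text \<open>This is the law e x = x in G(R) for the point x given by \<open>Id V H\<close>; since
  \<Phi> is injective, an equation between points is an equation between maps.\<close>

lemma counit_left: "lu H \<cdot> \<eta> \<triangleleft> H \<cdot> \<Delta> = Id V H"
proof -
  interpret group "pts G R" by (simp add: pts_group)
  have u: "aone R \<cdot> \<eta> \<in> alg_hom V R R" by (simp add: \<Phi>_unit)
  have "pair R (aone R \<cdot> \<eta>) (Id V H) \<cdot> \<Delta> = Id V H"
    by (rule \<Phi>_inj[of R]) (simp_all add: pair_comult u, simp add: \<Phi>_unit \<Phi>_carrier)
  moreover have "amul R \<cdot> aone R \<triangleleft> H = lu H" by (simp add: comm_alg_laws)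
  ultimately show ?thesis
    by (simp add: pair_def rwhisker_comp reassoc[of "amul R" "aone R \<triangleleft> H"])
qed

lemma counit_right: "ru H \<cdot> H \<triangleright> \<eta> \<cdot> \<Delta> = Id V H"
proof -
  interpret group "pts G R" by (simp add: pts_group)
  have u: "aone R \<cdot> \<eta> \<in> alg_hom V R R" by (simp add: \<Phi>_unit)
  have "pair R (Id V H) (aone R \<cdot> \<eta>) \<cdot> \<Delta> = Id V H"
    by (rule \<Phi>_inj[of R]) (simp_all add: pair_comult u, simp add: \<Phi>_unit \<Phi>_carrier)
  moreover have "amul R \<cdot> H \<triangleright> aone R = ru H" by (simp add: comm_alg_laws)
  ultimately show ?thesis
    by (simp add: pair_def lwhisker_comp reassoc[of "amul R" "H \<triangleright> aone R"])
qed

text \<open>Associativity in \<open>G(R \<otimes> R \<otimes> R)\<close> for the points given by the three inclusions of \<open>R\<close>.\<close>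

lemma coassoc: "\<Delta> \<triangleleft> H \<cdot> \<Delta> = as' H H H \<cdot> H \<triangleright> \<Delta> \<cdot> \<Delta>"
proof -
  let ?U = "tensor_alg V RR R"
  interpret group "pts G ?U" by (simp add: pts_group)
  have [simp]: "inl RR R \<in> alg_hom V RR ?U" "inr RR R \<in> alg_hom V R ?U"
    "inl R R \<in> alg_hom V R RR" "inr R R \<in> alg_hom V R RR"
    by (simp_all add: inl_hom)
  define a b c where "a = inl RR R \<cdot> inl R R" and "b = inl RR R \<cdot> inr R R" and "c = inr RR R"
  have abc [simp]: "a \<in> alg_hom V R ?U" "b \<in> alg_hom V R ?U" "c \<in> alg_hom V R ?U"
    unfolding a_def b_def c_def by (auto intro!: alg_hom_comp[where B = RR])
  note [simp] = alg_hom_arr[OF abc(1)] alg_hom_arr[OF abc(2)] alg_hom_arr[OF abc(3)]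
  have ab: "pair ?U a b = inl RR R"
    by (simp add: a_def b_def pair_hom_comp[of RR] pair_inl_inr)
  have "pair ?U (pair ?U a b \<cdot> \<Delta>) c \<cdot> \<Delta> = pair ?U a (pair ?U b c \<cdot> \<Delta>) \<cdot> \<Delta>"
    by (rule \<Phi>_inj[of ?U]) (simp_all add: pair_comult, simp add: \<Phi>_carrier m_assoc)
  moreover have "pair ?U (pair ?U a b \<cdot> \<Delta>) c = \<Delta> \<triangleleft> H"
  proof -
    have "pair ?U (pair ?U a b \<cdot> \<Delta>) c = pair ?U (inl RR R) (inr RR R) \<cdot> \<Delta> \<triangleleft> H"
      unfolding ab by (simp add: pair_def c_def tens_comp_arr tensor_alg_arr)
    then show ?thesis by (simp add: pair_inl_inr)
  qed
  \<comment> \<open>Bracketed to the left, the copairing of the three inclusions is the identity;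
    bracketed to the right it is therefore the inverse associator.\<close>
  moreover have "pair ?U a (pair ?U b c \<cdot> \<Delta>) = as' H H H \<cdot> H \<triangleright> \<Delta>"
  proof -
    have assoc: "amul ?U \<cdot> amul ?U \<triangleleft> aobj ?U = amul ?U \<cdot> aobj ?U \<triangleright> amul ?U \<cdot> as (aobj ?U) (aobj ?U) (aobj ?U)"
      by (rule comm_alg_laws) simp
    have "pair ?U a (pair ?U b c) \<cdot> as H H H = pair ?U (pair ?U a b) c"
    proof -
      have "pair ?U (pair ?U a b) c = amul ?U \<cdot> amul ?U \<triangleleft> aobj ?U \<cdot> a \<boxdot> b \<boxdot> c"
        by (simp add: pair_def tens_comp_arr tensor_alg_arr)
      also have "\<dots> = amul ?U \<cdot> aobj ?U \<triangleright> amul ?U \<cdot> as (aobj ?U) (aobj ?U) (aobj ?U) \<cdot> a \<boxdot> b \<boxdot> c"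
        using reassoc[OF assoc, of "a \<boxdot> b \<boxdot> c"] by (simp add: tensor_alg_arr)
      also have "as (aobj ?U) (aobj ?U) (aobj ?U) \<cdot> a \<boxdot> b \<boxdot> c = a \<boxdot> (b \<boxdot> c) \<cdot> as H H H"
        using as_nat[of a b c] by simp
      also have "amul ?U \<cdot> aobj ?U \<triangleright> amul ?U \<cdot> a \<boxdot> (b \<boxdot> c) \<cdot> as H H H = pair ?U a (pair ?U b c) \<cdot> as H H H"
        by (simp add: pair_def tensor_alg_arr reassoc[OF tens_comp_arr])
      finally show ?thesis by simp
    qed
    also have "pair ?U (pair ?U a b) c = Id V (H \<boxtimes> H \<boxtimes> H)" by (simp add: ab c_def pair_inl_inr)
    finally have "(pair ?U a (pair ?U b c) \<cdot> as H H H) \<cdot> as' H H H = Id V (H \<boxtimes> H \<boxtimes> H) \<cdot> as' H H H" by simp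
    then have "pair ?U a (pair ?U b c) = as' H H H" by simp
    moreover have "pair ?U a (pair ?U b c \<cdot> \<Delta>) = pair ?U a (pair ?U b c) \<cdot> H \<triangleright> \<Delta>"
      by (simp add: pair_def tensor_alg_arr tens_comp_arr)
    ultimately show ?thesis by simp
  qed
  ultimately show ?thesis by simp
qed

section \<open>Point derivations and right invariant derivations\<close>

text \<open>The rule h(x, fg) = h(x, f) \<eta>(g) + \<eta>(f) h(x, g). Since \<eta> takes values in
  \<I>, it is applied to one factor before \<open>h\<close>, which avoids a braiding of
  \<open>X\<close> past \<open>H\<close>.\<close>

definition leibniz :: "'o \<Rightarrow> 'a \<Rightarrow> bool" where
  "leibniz X h \<longleftrightarrow> X \<in> Obj V \<and> h \<in> mor V (X \<boxtimes> H) \<I> \<and>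
     h \<cdot> X \<triangleright> amul R = h \<cdot> X \<triangleright> (ru H \<cdot> H \<triangleright> \<eta>) \<boxplus> h \<cdot> X \<triangleright> (lu H \<cdot> \<eta> \<triangleleft> H)"

text \<open>In Sweedler notation, \<open>x \<otimes> f\<close> is sent to \<open>\<Sum> h (x \<otimes> f\<^sub>1) f\<^sub>2\<close>.\<close>

definition infinitesimal :: "'o \<Rightarrow> 'a \<Rightarrow> 'a" where
  "infinitesimal X h = lu H \<cdot> h \<triangleleft> H \<cdot> as' X H H \<cdot> X \<triangleright> \<Delta>"

lemma eta_amul: "\<eta> \<cdot> amul R = \<eta> \<cdot> lu H \<cdot> \<eta> \<triangleleft> H" "\<eta> \<cdot> amul R = \<eta> \<cdot> ru H \<cdot> H \<triangleright> \<eta>"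
proof -
  have *: "\<eta> \<cdot> amul R = lu \<I> \<cdot> \<eta> \<boxdot> \<eta>" using counit(1) by (simp add: alg_hom_def)
  have "\<eta> \<boxdot> \<eta> = \<I> \<triangleright> \<eta> \<cdot> \<eta> \<triangleleft> H" by (simp add: tens_comp_arr)
  then show "\<eta> \<cdot> amul R = \<eta> \<cdot> lu H \<cdot> \<eta> \<triangleleft> H" unfolding * by (simp add: reassoc[OF lu_nat])
  have "\<eta> \<boxdot> \<eta> = \<eta> \<triangleleft> \<I> \<cdot> H \<triangleright> \<eta>" by (simp add: tens_comp_arr)
  then show "\<eta> \<cdot> amul R = \<eta> \<cdot> ru H \<cdot> H \<triangleright> \<eta>" unfolding * lu_unit by (simp add: reassoc[OF ru_nat])
qed

text \<open>Cancelling the associator on the right brings the Leibniz rule to tail form, where the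
  braiding becomes \<open>sw\<close>.\<close>

lemma derivation_iff:
  assumes "X \<in> Obj V" "\<beta> \<in> mor V (X \<boxtimes> H) H"
  shows "derivation_action V R X \<beta> \<longleftrightarrow>
    \<beta> \<cdot> X \<triangleright> amul R = amul R \<cdot> (bin \<beta> X H H \<boxplus> H \<triangleright> \<beta> \<cdot> sw X H H)"
proof -
  let ?L = "\<beta> \<cdot> X \<triangleright> amul R" and ?R = "amul R \<cdot> (bin \<beta> X H H \<boxplus> H \<triangleright> \<beta> \<cdot> sw X H H)"
  have "?L = ?R \<longleftrightarrow> ?L \<cdot> as X H H = ?R \<cdot> as X H H"
  proof
    show "?L \<cdot> as X H H = ?R \<cdot> as X H H" if "?L = ?R" unfolding that ..
    show "?L = ?R" if "?L \<cdot> as X H H = ?R \<cdot> as X H H"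
      using that by (rule iso_cancel_right[OF _ assoc_iso]) (use assms in simp_all)
  qed
  also have "\<dots> \<longleftrightarrow> derivation_action V R X \<beta>"
    using assms by (simp add: derivation_action_def Add_comp bin_def sw_def)
  finally show ?thesis by simp
qed

text \<open>The multiplicative map \<eta> is applied to the Leibniz rule. In the second term the
  braiding of \<open>X\<close> past the first factor becomes a braiding with \<I> and disappears by
  \<open>sw_unit\<close>.\<close>

lemma leibniz_of_derivation:
  assumes "derivation_action V R X \<beta>"
  shows "leibniz X (\<eta> \<cdot> \<beta>)"
proof -
  have [simp]: "X \<in> Obj V" "\<beta> \<in> Arr V" "Dom V \<beta> = X \<boxtimes> H" "Cod V \<beta> = H"
    using assms by (auto simp: derivation_action_def)
  have "\<eta> \<cdot> amul R \<cdot> bin \<beta> X H H = \<eta> \<cdot> ru H \<cdot> (H \<triangleright> \<eta> \<cdot> bin \<beta> X H H)"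
    using reassoc[OF eta_amul(2), of "bin \<beta> X H H"] by simp
  also have "H \<triangleright> \<eta> \<cdot> bin \<beta> X H H = bin \<beta> X H \<I> \<cdot> X \<triangleright> (H \<triangleright> \<eta>)" by (simp add: bin_natr)
  also have "\<eta> \<cdot> ru H \<cdot> bin \<beta> X H \<I> \<cdot> X \<triangleright> (H \<triangleright> \<eta>) = \<eta> \<cdot> \<beta> \<cdot> X \<triangleright> (ru H \<cdot> H \<triangleright> \<eta>)"
    by (simp add: bin_def reassoc[OF ru_nat] ru_tens lwhisker_merge)
  finally have 1: "\<eta> \<cdot> amul R \<cdot> bin \<beta> X H H = (\<eta> \<cdot> \<beta>) \<cdot> X \<triangleright> (ru H \<cdot> H \<triangleright> \<eta>)" by simp
  have "\<eta> \<cdot> amul R \<cdot> H \<triangleright> \<beta> \<cdot> sw X H H = \<eta> \<cdot> lu H \<cdot> (\<eta> \<triangleleft> H \<cdot> H \<triangleright> \<beta>) \<cdot> sw X H H"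
    using reassoc[OF eta_amul(1), of "H \<triangleright> \<beta> \<cdot> sw X H H"] by simp
  also have "\<eta> \<triangleleft> H \<cdot> H \<triangleright> \<beta> = \<I> \<triangleright> \<beta> \<cdot> \<eta> \<triangleleft> (X \<boxtimes> H)" by (simp add: rwhisker_natr)
  also have "\<eta> \<cdot> lu H \<cdot> (\<I> \<triangleright> \<beta> \<cdot> \<eta> \<triangleleft> (X \<boxtimes> H)) \<cdot> sw X H H = \<eta> \<cdot> \<beta> \<cdot> lu (X \<boxtimes> H) \<cdot> (\<eta> \<triangleleft> (X \<boxtimes> H) \<cdot> sw X H H)"
    by (simp add: reassoc[OF lu_nat])
  also have "\<eta> \<triangleleft> (X \<boxtimes> H) \<cdot> sw X H H = sw X \<I> H \<cdot> X \<triangleright> (\<eta> \<triangleleft> H)" by (simp add: sw_natr)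
  finally have 2: "\<eta> \<cdot> amul R \<cdot> H \<triangleright> \<beta> \<cdot> sw X H H = (\<eta> \<cdot> \<beta>) \<cdot> X \<triangleright> (lu H \<cdot> \<eta> \<triangleleft> H)"
    by (simp add: reassoc[OF sw_unit] lwhisker_merge)
  have "(\<eta> \<cdot> \<beta>) \<cdot> X \<triangleright> amul R = \<eta> \<cdot> amul R \<cdot> (bin \<beta> X H H \<boxplus> H \<triangleright> \<beta> \<cdot> sw X H H)"
    using assms derivation_iff[of X \<beta>] by simp
  also have "\<dots> = \<eta> \<cdot> amul R \<cdot> bin \<beta> X H H \<boxplus> \<eta> \<cdot> amul R \<cdot> H \<triangleright> \<beta> \<cdot> sw X H H"
    by (simp add: comp_Add)
  finally show ?thesis by (simp add: leibniz_def 1 2 del: comp_assoc_arr)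
qed

text \<open>Right invariance rewrites (\<beta> \<otimes> 1)(1 \<otimes> \<Delta>) as \<Delta>
  \<beta>, and the left counit law removes \<Delta>. So an invariant derivation is recovered from
  its value at the identity.\<close>

lemma infinitesimal_counit:
  assumes "right_invariant V R \<Delta> X \<beta>" "X \<in> Obj V" "\<beta> \<in> mor V (X \<boxtimes> H) H"
  shows "infinitesimal X (\<eta> \<cdot> \<beta>) = \<beta>"
proof -
  have "infinitesimal X (\<eta> \<cdot> \<beta>) = lu H \<cdot> \<eta> \<triangleleft> H \<cdot> (\<beta> \<triangleleft> H \<cdot> as' X H H \<cdot> X \<triangleright> \<Delta>)"
    using assms by (simp add: infinitesimal_def rwhisker_comp)
  also have "\<dots> = (lu H \<cdot> \<eta> \<triangleleft> H \<cdot> \<Delta>) \<cdot> \<beta>" using assms by (simp add: right_invariant_def)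
  finally show ?thesis using assms by (simp add: counit_left)
qed

text \<open>The families with tail \<open>Z\<close> for \<open>h : X \<otimes> H \<rightarrow> 1\<close>, the counit and the comultiplication.\<close>

definition hop where "hop h X Z = lu Z \<cdot> bin h X H Z"
definition eop where "eop Z = lu Z \<cdot> \<eta> \<triangleleft> Z"
definition dop where "dop Z = as H H Z \<cdot> \<Delta> \<triangleleft> Z"

lemma op_arr [simp]:
  assumes "Z \<in> Obj V"
  shows "eop Z \<in> Arr V" "Dom V (eop Z) = H \<boxtimes> Z" "Cod V (eop Z) = Z"
    "dop Z \<in> Arr V" "Dom V (dop Z) = H \<boxtimes> Z" "Cod V (dop Z) = H \<boxtimes> (H \<boxtimes> Z)"
  using assms by (simp_all add: eop_def dop_def)

lemma op_nat:
  assumes "f \<in> Arr V" "Dom V f = Z"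
  shows "f \<cdot> eop Z = eop (Cod V f) \<cdot> H \<triangleright> f"
    "H \<triangleright> (H \<triangleright> f) \<cdot> dop Z = dop (Cod V f) \<cdot> H \<triangleright> f"
proof -
  show "f \<cdot> eop Z = eop (Cod V f) \<cdot> H \<triangleright> f"
    using assms by (auto simp add: eop_def rwhisker_natr reassoc[OF lu_nat])
  have "as H H (Cod V f) \<cdot> (H \<boxtimes> H) \<triangleright> f = H \<triangleright> (H \<triangleright> f) \<cdot> as H H (Dom V f)"
    using assms as_nat[of "Id V H" "Id V H" f] by simp
  from reassoc[OF this, of "\<Delta> \<triangleleft> Dom V f"] show "H \<triangleright> (H \<triangleright> f) \<cdot> dop Z = dop (Cod V f) \<cdot> H \<triangleright> f"
    using assms by (auto simp add: dop_def rwhisker_natr)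
qed

lemma eop_dop: "Z \<in> Obj V \<Longrightarrow> eop (H \<boxtimes> Z) \<cdot> dop Z = Id V (H \<boxtimes> Z)"
proof -
  assume [simp]: "Z \<in> Obj V"
  have "(lu H \<cdot> \<eta> \<triangleleft> H \<cdot> \<Delta>) \<triangleleft> Z = Id V (H \<boxtimes> Z)" unfolding counit_left by simp
  then show ?thesis by (simp add: eop_def dop_def tails)
qed

lemma eop_sw: "Y \<in> Obj V \<Longrightarrow> Z \<in> Obj V \<Longrightarrow> eop (Y \<boxtimes> Z) \<cdot> sw Y H Z = Y \<triangleright> eop Z"
  using sw_natr(2)[of \<eta> Y Z \<I>, symmetric] by (simp add: eop_def reassoc[OF sw_unit] lwhisker_merge)

text \<open>Multiplicativity of \<Delta>. The factors reach \<open>tmul\<close> in the order f_1,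
  f_2, g_1, g_2, with f_2 and g_1 still to be exchanged.\<close>

lemma dop_mul:
  assumes [simp]: "Z \<in> Obj V"
  shows "dop Z \<cdot> mul R Z = tmul R R Z \<cdot> dop (H \<boxtimes> (H \<boxtimes> Z)) \<cdot> H \<triangleright> dop Z"
proof -
  have "dop Z \<cdot> mul R Z = as H H Z \<cdot> (\<Delta> \<triangleleft> Z \<cdot> mul R Z)" by (simp add: dop_def)
  also have "\<dots> = tmul R R Z \<cdot> (H \<triangleright> (H \<triangleright> as H H Z) \<cdot> dop (H \<boxtimes> H \<boxtimes> Z)) \<cdot> H \<triangleright> (\<Delta> \<triangleleft> Z)"
    using hom_mul[OF comult(1)] by (simp add: tensor_mul dop_def)
  also have "H \<triangleright> (H \<triangleright> as H H Z) \<cdot> dop (H \<boxtimes> H \<boxtimes> Z) = dop (H \<boxtimes> (H \<boxtimes> Z)) \<cdot> H \<triangleright> as H H Z"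
    by (simp add: op_nat)
  finally show ?thesis by (simp add: lwhisker_merge dop_def)
qed

context
  fixes X h
  assumes X [simp]: "X \<in> Obj V" and h [simp]: "h \<in> Arr V" "Dom V h = X \<boxtimes> H" "Cod V h = \<I>"
begin

lemma hop_arr [simp]:
  assumes "Z \<in> Obj V"
  shows "hop h X Z \<in> Arr V" "Dom V (hop h X Z) = X \<boxtimes> (H \<boxtimes> Z)" "Cod V (hop h X Z) = Z"
  using assms by (simp_all add: hop_def)

lemma hop_nat:
  assumes "f \<in> Arr V" "Dom V f = Z"
  shows "f \<cdot> hop h X Z = hop h X (Cod V f) \<cdot> X \<triangleright> (H \<triangleright> f)"
proof -
  have "f \<cdot> hop h X Z = lu (Cod V f) \<cdot> (\<I> \<triangleright> f \<cdot> bin h X H Z)"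
    using assms by (auto simp add: hop_def reassoc[OF lu_nat])
  also have "\<I> \<triangleright> f \<cdot> bin h X H Z = bin h X H (Cod V f) \<cdot> X \<triangleright> (H \<triangleright> f)"
    using assms by (simp add: bin_natr)
  finally show ?thesis using assms by (auto simp: hop_def)
qed

text \<open>\<open>h\<close> takes values in \<I>, so moving \<open>Y\<close> past its output costs
  nothing; by \<open>bin_sw\<close> this is the same as moving \<open>Y\<close> past both of its
  inputs.\<close>

lemma hop_sw:
  assumes [simp]: "Y \<in> Obj V" "Z \<in> Obj V"
  shows "hop h X (Y \<boxtimes> Z) \<cdot> X \<triangleright> sw Y H Z = Y \<triangleright> hop h X Z \<cdot> sw X Y (H \<boxtimes> Z)"
proof -
  have "hop h X (Y \<boxtimes> Z) = Y \<triangleright> lu Z \<cdot> (sw \<I> Y Z \<cdot> bin h X H (Y \<boxtimes> Z))"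
    using reassoc[OF sw_unit', of Y Z "bin h X H (Y \<boxtimes> Z)"] by (simp add: hop_def)
  also have "\<dots> = Y \<triangleright> hop h X Z \<cdot> sw X Y (H \<boxtimes> Z) \<cdot> X \<triangleright> sw H Y Z"
    by (simp add: bin_sw hop_def lwhisker_merge)
  finally show ?thesis by (simp add: lwhisker_merge)
qed

lemma infinitesimal_arr [simp]:
  "infinitesimal X h \<in> Arr V" "Dom V (infinitesimal X h) = X \<boxtimes> H" "Cod V (infinitesimal X h) = H"
  by (simp_all add: infinitesimal_def)

lemma bin_infinitesimal:
  assumes "Z \<in> Obj V"
  shows "bin (infinitesimal X h) X H Z = hop h X (H \<boxtimes> Z) \<cdot> X \<triangleright> dop Z"
  using assms by (simp add: infinitesimal_def bin_def hop_def dop_def tails)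

lemma infinitesimal_hop: "infinitesimal X h = hop h X H \<cdot> X \<triangleright> \<Delta>"
  by (simp add: infinitesimal_def hop_def bin_def)

text \<open>The counit acts behind \<open>h\<close> and commutes with it; then h(x, f_1) \<eta>(f_2)
  = h(x, f) by the right counit law.\<close>

lemma counit_infinitesimal: "\<eta> \<cdot> infinitesimal X h = h"
proof -
  have "H \<triangleright> \<eta> \<cdot> \<Delta> = ru' H \<cdot> ru H \<cdot> H \<triangleright> \<eta> \<cdot> \<Delta>" by simp
  also have "\<dots> = ru' H" unfolding counit_right by simp
  finally have *: "H \<triangleright> \<eta> \<cdot> \<Delta> = ru' H" .
  have "\<eta> \<cdot> infinitesimal X h = (\<eta> \<cdot> hop h X H) \<cdot> X \<triangleright> \<Delta>" by (simp add: infinitesimal_hop)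
  also have "\<dots> = hop h X \<I> \<cdot> X \<triangleright> (H \<triangleright> \<eta> \<cdot> \<Delta>)" by (simp add: hop_nat lwhisker_merge)
  also have "\<dots> = (ru \<I> \<cdot> h \<triangleleft> \<I>) \<cdot> as' X H \<I> \<cdot> X \<triangleright> ru' H"
    by (simp add: * hop_def bin_def lu_unit)
  also have "\<dots> = h" by (simp add: ru_nat ru_tens lwhisker_merge)
  finally show ?thesis .
qed

text \<open>By coassociativity both sides are h(x, f_1) f_2 \<otimes> f_3.\<close>

lemma infinitesimal_right_invariant: "right_invariant V R \<Delta> X (infinitesimal X h)"
proof -
  have "\<Delta> \<cdot> infinitesimal X h = (\<Delta> \<cdot> hop h X H) \<cdot> X \<triangleright> \<Delta>" by (simp add: infinitesimal_hop)
  also have "\<dots> = hop h X (H \<boxtimes> H) \<cdot> X \<triangleright> (H \<triangleright> \<Delta> \<cdot> \<Delta>)" by (simp add: hop_nat lwhisker_merge)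
  also have "H \<triangleright> \<Delta> \<cdot> \<Delta> = dop H \<cdot> \<Delta>" by (simp add: dop_def coassoc)
  also have "hop h X (H \<boxtimes> H) \<cdot> X \<triangleright> (dop H \<cdot> \<Delta>) = bin (infinitesimal X h) X H H \<cdot> X \<triangleright> \<Delta>"
    by (simp add: bin_infinitesimal lwhisker_merge)
  finally show ?thesis by (simp add: right_invariant_def bin_def)
qed

lemma leibniz_op:
  assumes "leibniz X h" and [simp]: "Z \<in> Obj V"
  shows "hop h X Z \<cdot> X \<triangleright> mul R Z = hop h X Z \<cdot> X \<triangleright> (H \<triangleright> eop Z) \<boxplus> hop h X Z \<cdot> X \<triangleright> eop (H \<boxtimes> Z)"
proof -
  have "lu Z \<cdot> (h \<cdot> X \<triangleright> amul R) \<triangleleft> Z \<cdot> as' X (H \<boxtimes> H) Z \<cdot> X \<triangleright> as' H H Z =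
     lu Z \<cdot> (h \<cdot> X \<triangleright> (ru H \<cdot> H \<triangleright> \<eta>) \<boxplus> h \<cdot> X \<triangleright> (lu H \<cdot> \<eta> \<triangleleft> H)) \<triangleleft> Z \<cdot> as' X (H \<boxtimes> H) Z \<cdot> X \<triangleright> as' H H Z"
    using assms by (simp add: leibniz_def)
  then show ?thesis
    by (simp add: tens_Add Add_comp comp_Add tails hop_def bin_def eop_def)
qed

text \<open>Multiplicativity of \<Delta> turns \<beta>(x, fg) into h(x, f_1 g_1) f_2 g_2, and the
  rule for \<open>h\<close> splits this into h(x, f_1) \<eta>(g_1) f_2 g_2 and \<eta>(f_1) h(x, g_1)
  f_2 g_2. The counit law contracts these to \<beta>(x, f) g and f \<beta>(x, g).\<close>

lemma infinitesimal_derivation: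
  assumes "leibniz X h"
  shows "derivation_action V R X (infinitesimal X h)"
proof -
  let ?\<beta> = "infinitesimal X h"
  \<comment> \<open>The part of \<open>tmul\<close> behind the first factor: it takes f_2, g_1, g_2
    to g_1, f_2 g_2.\<close>
  let ?S = "\<lambda>Z. H \<triangleright> mul R Z \<cdot> sw H H (H \<boxtimes> Z)"
  have op: "bin ?\<beta> X H Z \<cdot> X \<triangleright> mul R Z = mul R Z \<cdot> bin ?\<beta> X H (H \<boxtimes> Z) \<boxplus> mul R Z \<cdot> H \<triangleright> bin ?\<beta> X H Z \<cdot> sw X H (H \<boxtimes> Z)"
    if [simp]: "Z \<in> Obj V" for Z
  proof -
    let ?D = "dop (H \<boxtimes> (H \<boxtimes> Z)) \<cdot> H \<triangleright> dop Z"
    have "bin ?\<beta> X H Z \<cdot> X \<triangleright> mul R Z = hop h X (H \<boxtimes> Z) \<cdot> X \<triangleright> (dop Z \<cdot> mul R Z)"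
      by (simp add: bin_infinitesimal lwhisker_merge)
    also have "\<dots> = (hop h X (H \<boxtimes> Z) \<cdot> X \<triangleright> mul R (H \<boxtimes> Z)) \<cdot> X \<triangleright> (H \<triangleright> ?S Z \<cdot> ?D)"
      by (simp add: dop_mul tmul_def lwhisker_merge)
    also have "\<dots> = hop h X (H \<boxtimes> Z) \<cdot> X \<triangleright> (H \<triangleright> (eop (H \<boxtimes> Z) \<cdot> ?S Z) \<cdot> ?D) \<boxplus>
        hop h X (H \<boxtimes> Z) \<cdot> X \<triangleright> (eop (H \<boxtimes> (H \<boxtimes> Z)) \<cdot> H \<triangleright> ?S Z \<cdot> ?D)"
      by (simp add: leibniz_op[OF assms] Add_comp lwhisker_merge)
    \<comment> \<open>First summand: the counit falls on g_1, and \<eta>(g_1) g_2 = g.\<close>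
    also have "eop (H \<boxtimes> Z) \<cdot> ?S Z = mul R Z \<cdot> H \<triangleright> eop (H \<boxtimes> Z)"
    proof -
      have "eop (H \<boxtimes> Z) \<cdot> ?S Z = (eop (H \<boxtimes> Z) \<cdot> H \<triangleright> mul R Z) \<cdot> sw H H (H \<boxtimes> Z)" by simp
      also have "eop (H \<boxtimes> Z) \<cdot> H \<triangleright> mul R Z = mul R Z \<cdot> eop (H \<boxtimes> (H \<boxtimes> Z))" by (simp add: op_nat)
      finally show ?thesis by (simp add: eop_sw)
    qed
    also have "H \<triangleright> (mul R Z \<cdot> H \<triangleright> eop (H \<boxtimes> Z)) \<cdot> ?D = H \<triangleright> mul R Z \<cdot> dop (H \<boxtimes> Z)"
    proof -
      have "H \<triangleright> (mul R Z \<cdot> H \<triangleright> eop (H \<boxtimes> Z)) \<cdot> ?D =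
        H \<triangleright> mul R Z \<cdot> (H \<triangleright> (H \<triangleright> eop (H \<boxtimes> Z)) \<cdot> dop (H \<boxtimes> (H \<boxtimes> Z))) \<cdot> H \<triangleright> dop Z"
        by (simp add: lwhisker_comp)
      also have "H \<triangleright> (H \<triangleright> eop (H \<boxtimes> Z)) \<cdot> dop (H \<boxtimes> (H \<boxtimes> Z)) = dop (H \<boxtimes> Z) \<cdot> H \<triangleright> eop (H \<boxtimes> Z)"
        by (simp add: op_nat)
      finally show ?thesis by (simp add: lwhisker_merge eop_dop)
    qed
    also have "hop h X (H \<boxtimes> Z) \<cdot> X \<triangleright> (H \<triangleright> mul R Z \<cdot> dop (H \<boxtimes> Z)) = mul R Z \<cdot> bin ?\<beta> X H (H \<boxtimes> Z)"
    proof -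
      have "hop h X (H \<boxtimes> Z) \<cdot> X \<triangleright> (H \<triangleright> mul R Z \<cdot> dop (H \<boxtimes> Z)) =
        (hop h X (H \<boxtimes> Z) \<cdot> X \<triangleright> (H \<triangleright> mul R Z)) \<cdot> X \<triangleright> dop (H \<boxtimes> Z)" by (simp add: lwhisker_comp)
      also have "hop h X (H \<boxtimes> Z) \<cdot> X \<triangleright> (H \<triangleright> mul R Z) = mul R Z \<cdot> hop h X (H \<boxtimes> (H \<boxtimes> Z))"
        by (simp add: hop_nat)
      finally show ?thesis by (simp add: bin_infinitesimal)
    qed
    \<comment> \<open>Second summand: the counit falls on f_1, and \<eta>(f_1) f_2 = f.\<close>
    also have "eop (H \<boxtimes> (H \<boxtimes> Z)) \<cdot> H \<triangleright> ?S Z \<cdot> ?D = ?S Z \<cdot> H \<triangleright> dop Z"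
    proof -
      have "eop (H \<boxtimes> (H \<boxtimes> Z)) \<cdot> H \<triangleright> ?S Z \<cdot> ?D = (eop (H \<boxtimes> (H \<boxtimes> Z)) \<cdot> H \<triangleright> ?S Z) \<cdot> ?D" by simp
      also have "eop (H \<boxtimes> (H \<boxtimes> Z)) \<cdot> H \<triangleright> ?S Z = ?S Z \<cdot> eop (H \<boxtimes> (H \<boxtimes> (H \<boxtimes> Z)))"
        by (simp add: op_nat)
      also have "(?S Z \<cdot> eop (H \<boxtimes> (H \<boxtimes> (H \<boxtimes> Z)))) \<cdot> ?D = ?S Z \<cdot> (eop (H \<boxtimes> (H \<boxtimes> (H \<boxtimes> Z))) \<cdot> dop (H \<boxtimes> (H \<boxtimes> Z))) \<cdot> H \<triangleright> dop Z"
        by simp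
      finally show ?thesis by (simp add: eop_dop)
    qed
    \<comment> \<open>What remains is h(x, g_1) f g_2 with f standing between x and g_1;
      \<open>hop_sw\<close> moves x past f, which produces the braiding of the Leibniz rule.\<close>
    also have "hop h X (H \<boxtimes> Z) \<cdot> X \<triangleright> (?S Z \<cdot> H \<triangleright> dop Z) = mul R Z \<cdot> H \<triangleright> bin ?\<beta> X H Z \<cdot> sw X H (H \<boxtimes> Z)"
    proof -
      have "hop h X (H \<boxtimes> Z) \<cdot> X \<triangleright> (?S Z \<cdot> H \<triangleright> dop Z) =
        (hop h X (H \<boxtimes> Z) \<cdot> X \<triangleright> (H \<triangleright> mul R Z)) \<cdot> X \<triangleright> sw H H (H \<boxtimes> Z) \<cdot> X \<triangleright> (H \<triangleright> dop Z)"
        by (simp add: lwhisker_comp)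
      also have "hop h X (H \<boxtimes> Z) \<cdot> X \<triangleright> (H \<triangleright> mul R Z) = mul R Z \<cdot> hop h X (H \<boxtimes> (H \<boxtimes> Z))"
        by (simp add: hop_nat)
      also have "(mul R Z \<cdot> hop h X (H \<boxtimes> (H \<boxtimes> Z))) \<cdot> X \<triangleright> sw H H (H \<boxtimes> Z) \<cdot> X \<triangleright> (H \<triangleright> dop Z) =
        mul R Z \<cdot> (hop h X (H \<boxtimes> (H \<boxtimes> Z)) \<cdot> X \<triangleright> sw H H (H \<boxtimes> Z)) \<cdot> X \<triangleright> (H \<triangleright> dop Z)" by simp
      also have "\<dots> = mul R Z \<cdot> H \<triangleright> hop h X (H \<boxtimes> Z) \<cdot> (sw X H (H \<boxtimes> (H \<boxtimes> Z)) \<cdot> X \<triangleright> (H \<triangleright> dop Z))"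
        by (simp add: hop_sw)
      finally show ?thesis by (simp add: sw_natr bin_infinitesimal lwhisker_merge)
    qed
    finally show ?thesis .
  qed
  have "?\<beta> \<cdot> X \<triangleright> amul R = amul R \<cdot> (bin ?\<beta> X H H \<boxplus> H \<triangleright> ?\<beta> \<cdot> sw X H H)"
  proof (rule unit_faithful)
    have "(bin ?\<beta> X H \<I> \<cdot> X \<triangleright> mul R \<I>) \<cdot> X \<triangleright> as H H \<I> \<cdot> as X (H \<boxtimes> H) \<I> =
      (mul R \<I> \<cdot> bin ?\<beta> X H (H \<boxtimes> \<I>) \<boxplus> mul R \<I> \<cdot> H \<triangleright> bin ?\<beta> X H \<I> \<cdot> sw X H (H \<boxtimes> \<I>)) \<cdot> X \<triangleright> as H H \<I> \<cdot> as X (H \<boxtimes> H) \<I>"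
      by (simp add: op)
    then show "(?\<beta> \<cdot> X \<triangleright> amul R) \<triangleleft> \<I> = (amul R \<cdot> (bin ?\<beta> X H H \<boxplus> H \<triangleright> ?\<beta> \<cdot> sw X H H)) \<triangleleft> \<I>"
      by (simp add: bin_def tails tens_Add comp_Add Add_comp)
  qed simp_all
  then show ?thesis using derivation_iff[of X ?\<beta>] by simp
qed

end

lemma eta_aone: "\<eta> \<cdot> aone R = Id V \<I>"
  using counit(1) by (simp add: alg_hom_def)

lemma aone_aone: "amul R \<cdot> aone R \<boxdot> aone R = aone R \<cdot> lu \<I>"
  using alg_hom_aone[OF comm_alg_R] by (simp add: alg_hom_def)

lemma amul_aone_eta:
  "amul R \<cdot> (aone R \<cdot> \<eta>) \<triangleleft> H = lu H \<cdot> \<eta> \<triangleleft> H" "amul R \<cdot> H \<triangleright> (aone R \<cdot> \<eta>) = ru H \<cdot> H \<triangleright> \<eta>"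
  by (simp_all add: rwhisker_comp lwhisker_comp reassoc[OF comm_alg_laws(2)] reassoc[OF comm_alg_laws(3)])

end

section \<open>Representing point derivations\<close>

locale augmentation = group_scheme V G R \<Phi>
  for V :: "('o, 'a, 'k::field, 'm) sym_cat_scheme" (structure)
    and G :: "('o, 'a, 'g) alg_functor" and R \<Phi> +
  fixes j :: 'a
  assumes ker: "is_kernel V \<eta> j"
begin

abbreviation "M \<equiv> Dom V j"

lemma j_arr [simp]: "j \<in> Arr V" "Cod V j = H" "\<eta> \<cdot> j = Zero V M \<I>"
  using kernel_arr[OF ker] by simp_all

lemma j_mono: "u \<in> mor V W M \<Longrightarrow> v \<in> mor V W M \<Longrightarrow> j \<cdot> u = j \<cdot> v \<Longrightarrow> u = v"
  by (rule kernel_mono[OF ker])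

text \<open>\<open>g\<close> is the negative of \<open>aone R \<cdot> \<eta>\<close>, so
  \<open>Id V H \<boxplus> g\<close> sends f to f - \<eta>(f) 1. This is killed by \<eta> and
  therefore factors through the kernel \<open>j\<close>.\<close>

lemma ex_retraction: "\<exists>\<pi>. \<pi> \<in> mor V H M \<and> j \<cdot> \<pi> \<boxplus> aone R \<cdot> \<eta> = Id V H"
proof -
  have c: "aone R \<cdot> \<eta> \<in> mor V H H" by simp
  obtain g where g: "g \<in> mor V H H" "aone R \<cdot> \<eta> \<boxplus> g = Zero V H H" using add_inverse[OF c] by blast
  then have [simp]: "g \<in> Arr V" "Dom V g = H" "Cod V g = H" by simp_all
  have "\<eta> \<cdot> (Id V H \<boxplus> g) = \<eta> \<cdot> (aone R \<cdot> \<eta> \<boxplus> g)"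
    by (simp add: comp_Add reassoc[OF eta_aone])
  then have "\<eta> \<cdot> (Id V H \<boxplus> g) = Zero V H \<I>" unfolding g(2) by simp
  then obtain \<pi> where \<pi>: "\<pi> \<in> mor V H M" "j \<cdot> \<pi> = Id V H \<boxplus> g"
    using kernel_factor[OF ker, of "Id V H \<boxplus> g" H] by auto
  have "(Id V H \<boxplus> g) \<boxplus> aone R \<cdot> \<eta> = Id V H \<boxplus> (g \<boxplus> aone R \<cdot> \<eta>)"
    by (rule add_assoc) simp_all
  also have "g \<boxplus> aone R \<cdot> \<eta> = Zero V H H" using add_commute[OF g(1) c] g(2) by simp
  finally show ?thesis using \<pi> by (intro exI[of _ \<pi>]) simp
qed

text \<open>Since \<open>j\<close> is mono there is only one such arrow, so the choice is
  immaterial.\<close>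

definition \<pi> where "\<pi> = (SOME \<pi>. \<pi> \<in> mor V H M \<and> j \<cdot> \<pi> \<boxplus> aone R \<cdot> \<eta> = Id V H)"

lemma pi [simp]: "\<pi> \<in> Arr V" "Dom V \<pi> = H" "Cod V \<pi> = M"
  and splitting: "j \<cdot> \<pi> \<boxplus> aone R \<cdot> \<eta> = Id V H"
  using someI_ex[OF ex_retraction] by (simp_all add: \<pi>_def)

lemma pi_j [simp]: "\<pi> \<cdot> j = Id V M"
proof (rule j_mono)
  have "(j \<cdot> \<pi> \<boxplus> aone R \<cdot> \<eta>) \<cdot> j = j" unfolding splitting by simp
  then show "j \<cdot> \<pi> \<cdot> j = j \<cdot> Id V M" by (simp add: Add_comp)
qed simp_all

lemma pi_aone [simp]: "\<pi> \<cdot> aone R = Zero V \<I> M"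
proof (rule j_mono)
  have "(j \<cdot> \<pi> \<boxplus> aone R \<cdot> \<eta>) \<cdot> aone R = aone R" unfolding splitting by simp
  then have "aone R \<boxplus> j \<cdot> \<pi> \<cdot> aone R = aone R"
    by (subst add_commute[of _ \<I> H]) (simp_all add: Add_comp eta_aone)
  then have "j \<cdot> \<pi> \<cdot> aone R = Zero V \<I> H" by (rule Add_eq_self) simp_all
  then show "j \<cdot> \<pi> \<cdot> aone R = j \<cdot> Zero V \<I> M" by simp
qed simp_all

text \<open>Vanishing is required on the product map of \<mm> \<otimes> \<mm> rather than on its
  image \<mm>^2; \<open>vanish_square\<close> passes between the two by right exactness.\<close>

definition point_derivation :: "'o \<Rightarrow> 'a \<Rightarrow> bool" where
  "point_derivation X h \<longleftrightarrow> X \<in> Obj V \<and> h \<in> mor V (X \<boxtimes> H) \<I> \<and>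
     h \<cdot> X \<triangleright> aone R = Zero V (X \<boxtimes> \<I>) \<I> \<and> h \<cdot> X \<triangleright> (amul R \<cdot> j \<boxdot> j) = Zero V (X \<boxtimes> (M \<boxtimes> M)) \<I>"

text \<open>From 1 = 1 * 1 the rule gives h(x, 1) = h(x, 1) + h(x, 1), hence h(x, 1) = 0 in every
  characteristic; on a product of two elements of \<mm> both counits vanish.\<close>

lemma point_derivation_leibniz:
  assumes "leibniz X h"
  shows "point_derivation X h"
proof -
  have [simp]: "X \<in> Obj V" "h \<in> Arr V" "Dom V h = X \<boxtimes> H" "Cod V h = \<I>"
    and leib: "h \<cdot> X \<triangleright> amul R = h \<cdot> X \<triangleright> (ru H \<cdot> H \<triangleright> \<eta>) \<boxplus> h \<cdot> X \<triangleright> (lu H \<cdot> \<eta> \<triangleleft> H)"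
    using assms by (simp_all add: leibniz_def)
  have leib': "h \<cdot> X \<triangleright> (amul R \<cdot> k) = h \<cdot> X \<triangleright> (ru H \<cdot> H \<triangleright> \<eta> \<cdot> k) \<boxplus> h \<cdot> X \<triangleright> (lu H \<cdot> \<eta> \<triangleleft> H \<cdot> k)"
    if "k \<in> Arr V" "Cod V k = H \<boxtimes> H" for k
    using whisker_cont[OF leib, of k] that by (simp add: Add_comp lwhisker_merge)
  have "h \<cdot> X \<triangleright> (aone R \<cdot> lu \<I>) = h \<cdot> X \<triangleright> (aone R \<cdot> lu \<I>) \<boxplus> h \<cdot> X \<triangleright> (aone R \<cdot> lu \<I>)"
    using leib'[of "aone R \<boxdot> aone R"]
    by (simp add: aone_aone tens_comp_arr eta_aone ru_nat lu_nat lu_unit)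
  then have "h \<cdot> X \<triangleright> (aone R \<cdot> lu \<I>) = Zero V (X \<boxtimes> (\<I> \<boxtimes> \<I>)) \<I>"
    by (intro Add_eq_self[of "h \<cdot> X \<triangleright> (aone R \<cdot> lu \<I>)"]) simp_all
  then have "(h \<cdot> X \<triangleright> (aone R \<cdot> lu \<I>)) \<cdot> X \<triangleright> lu' \<I> = Zero V (X \<boxtimes> \<I>) \<I>" by simp
  then have "h \<cdot> X \<triangleright> aone R = Zero V (X \<boxtimes> \<I>) \<I>" by (simp add: lwhisker_merge)
  moreover have "h \<cdot> X \<triangleright> (amul R \<cdot> j \<boxdot> j) = Zero V (X \<boxtimes> (M \<boxtimes> M)) \<I>"
    using leib'[of "j \<boxdot> j"] by (simp add: tens_comp_arr)
  ultimately show ?thesis by (simp add: point_derivation_def)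
qed

text \<open>Both factors of a product are decomposed along H = \<mm> \<oplus> \<I> by the
  projections \<open>?e\<close> and \<open>?c\<close>; after multiplication, \<open>h\<close> kills
  the \<open>?e\<close>, \<open>?e\<close> part and the \<open>?c\<close>, \<open>?c\<close>
  part.\<close>

lemma leibniz_point_derivation:
  assumes "point_derivation X h"
  shows "leibniz X h"
proof -
  have [simp]: "X \<in> Obj V" "h \<in> Arr V" "Dom V h = X \<boxtimes> H" "Cod V h = \<I>"
    and h: "h \<cdot> X \<triangleright> aone R = Zero V (X \<boxtimes> \<I>) \<I>" "h \<cdot> X \<triangleright> (amul R \<cdot> j \<boxdot> j) = Zero V (X \<boxtimes> (M \<boxtimes> M)) \<I>"
    using assms by (simp_all add: point_derivation_def)
  let ?e = "j \<cdot> \<pi>" and ?c = "aone R \<cdot> \<eta>"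
  let ?h = "\<lambda>k. h \<cdot> X \<triangleright> (amul R \<cdot> k)"
  have add: "?h (k \<boxplus> k') = ?h k \<boxplus> ?h k'" if "k \<in> mor V (H \<boxtimes> H) (H \<boxtimes> H)" "k' \<in> mor V (H \<boxtimes> H) (H \<boxtimes> H)" for k k'
    using that by (simp add: comp_Add tens_Add)
  have "?h (?e \<boxdot> ?e) = h \<cdot> X \<triangleright> ((amul R \<cdot> j \<boxdot> j) \<cdot> \<pi> \<boxdot> \<pi>)"
    by (simp add: tens_comp_arr)
  then have ee: "?h (?e \<boxdot> ?e) = Zero V (X \<boxtimes> (H \<boxtimes> H)) \<I>"
    using whisker_cont[OF h(2), of "\<pi> \<boxdot> \<pi>"] by simp
  have "amul R \<cdot> ?c \<boxdot> ?c = aone R \<cdot> lu \<I> \<cdot> \<eta> \<boxdot> \<eta>"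
    using reassoc[OF aone_aone, of "\<eta> \<boxdot> \<eta>"] by (simp add: tens_comp_arr)
  then have cc: "?h (?c \<boxdot> ?c) = Zero V (X \<boxtimes> (H \<boxtimes> H)) \<I>"
    using whisker_cont[OF h(1), of "lu \<I> \<cdot> \<eta> \<boxdot> \<eta>"] by simp
  \<comment> \<open>The identity is e \<otimes> e + e \<otimes> c + c \<otimes> 1. As c \<otimes> c
    contributes nothing, e \<otimes> c may be replaced by 1 \<otimes> c, which leaves the two terms
    of the Leibniz rule.\<close>
  have "?e \<triangleleft> H \<boxplus> ?c \<triangleleft> H = Id V (H \<boxtimes> H)" "?e \<boxdot> ?e \<boxplus> ?e \<boxdot> ?c = ?e \<triangleleft> H" "?e \<boxdot> ?c \<boxplus> ?c \<boxdot> ?c = H \<triangleright> ?c"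
    using tens_Add(2)[of ?e ?c "Id V H"] tens_Add(1)[of ?e ?c ?e] tens_Add(2)[of ?e ?c ?c] by (simp_all add: splitting)
  then have "?h (Id V (H \<boxtimes> H)) = ?h (?e \<triangleleft> H) \<boxplus> ?h (?c \<triangleleft> H)" "?h (?e \<triangleleft> H) = ?h (?e \<boxdot> ?e) \<boxplus> ?h (?e \<boxdot> ?c)"
    "?h (H \<triangleright> ?c) = ?h (?e \<boxdot> ?c) \<boxplus> ?h (?c \<boxdot> ?c)"
    using add[of "?e \<triangleleft> H" "?c \<triangleleft> H"] add[of "?e \<boxdot> ?e" "?e \<boxdot> ?c"] add[of "?e \<boxdot> ?c" "?c \<boxdot> ?c"] by simp_all
  then have "h \<cdot> X \<triangleright> amul R = ?h (H \<triangleright> ?c) \<boxplus> ?h (?c \<triangleleft> H)" unfolding ee cc by simp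
  then show ?thesis unfolding amul_aone_eta by (simp add: leibniz_def)
qed

lemma leibniz_iff: "leibniz X h \<longleftrightarrow> point_derivation X h"
  using leibniz_point_derivation point_derivation_leibniz by blast

lemma point_derivation_comp:
  assumes "point_derivation X h" "u \<in> mor V Y X"
  shows "point_derivation Y (h \<cdot> u \<triangleleft> H)"
proof -
  have [simp]: "Y \<in> Obj V" using assms(2) by auto
  have [simp]: "u \<in> Arr V" "Dom V u = Y" "Cod V u = X" "X \<in> Obj V" "h \<in> Arr V" "Dom V h = X \<boxtimes> H" "Cod V h = \<I>"
    and h: "h \<cdot> X \<triangleright> aone R = Zero V (X \<boxtimes> \<I>) \<I>" "h \<cdot> X \<triangleright> (amul R \<cdot> j \<boxdot> j) = Zero V (X \<boxtimes> (M \<boxtimes> M)) \<I>"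
    using assms by (simp_all add: point_derivation_def)
  show ?thesis
    using reassoc[OF h(1), of "u \<triangleleft> \<I>"] reassoc[OF h(2), of "u \<triangleleft> (M \<boxtimes> M)"]
    by (simp add: point_derivation_def rwhisker_natr)
qed

definition represents_pd :: "'o \<Rightarrow> 'a \<Rightarrow> bool" where
  "represents_pd D d \<longleftrightarrow> point_derivation D d \<and>
     (\<forall>X h. point_derivation X h \<longrightarrow> (\<exists>!u. u \<in> mor V X D \<and> d \<cdot> u \<triangleleft> H = h))"

lemma represents_pd_factor:
  assumes "represents_pd D d" "point_derivation X h"
  obtains u where "u \<in> mor V X D" "d \<cdot> u \<triangleleft> H = h"
  using assms unfolding represents_pd_def by blast

lemma represents_pd_unique:
  assumes "represents_pd D d" "u \<in> mor V X D" "v \<in> mor V X D" "d \<cdot> u \<triangleleft> H = d \<cdot> v \<triangleleft> H"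
  shows "u = v"
proof -
  have "point_derivation X (d \<cdot> u \<triangleleft> H)"
    using assms(1,2) point_derivation_comp unfolding represents_pd_def by blast
  then have "\<exists>!w. w \<in> mor V X D \<and> d \<cdot> w \<triangleleft> H = d \<cdot> u \<triangleleft> H"
    using assms(1) unfolding represents_pd_def by blast
  then show ?thesis using assms(2-4) by metis
qed

lemma represents_pd_iso:
  assumes A: "represents_pd A a" and B: "represents_pd B b"
  obtains \<phi> where "\<phi> \<in> isos V A B" "b \<cdot> \<phi> \<triangleleft> H = a"
proof -
  have a: "point_derivation A a" and b: "point_derivation B b" using A B by (simp_all add: represents_pd_def)
  then have [simp]: "A \<in> Obj V" "B \<in> Obj V" "a \<in> Arr V" "Dom V a = A \<boxtimes> H" "b \<in> Arr V" "Dom V b = B \<boxtimes> H"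
    by (simp_all add: point_derivation_def)
  obtain u where u: "u \<in> mor V A B" "b \<cdot> u \<triangleleft> H = a" using represents_pd_factor[OF B a] .
  obtain v where v: "v \<in> mor V B A" "a \<cdot> v \<triangleleft> H = b" using represents_pd_factor[OF A b] .
  have "v \<cdot> u = Id V A"
    by (rule represents_pd_unique[OF A, of _ A]) (use u v reassoc[OF v(2), of "u \<triangleleft> H"] in \<open>simp_all add: rwhisker_comp\<close>)
  moreover have "u \<cdot> v = Id V B"
    by (rule represents_pd_unique[OF B, of _ B]) (use u v reassoc[OF u(2), of "v \<triangleleft> H"] in \<open>simp_all add: rwhisker_comp\<close>)
  ultimately show ?thesis using that[of u] u v isosI(1)[of u A B v] by blast
qed

lemma infinitesimal_comp:
  assumes "X \<in> Obj V" "h \<in> mor V (X \<boxtimes> H) \<I>" "u \<in> mor V Y X"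
  shows "infinitesimal X h \<cdot> u \<triangleleft> H = infinitesimal Y (h \<cdot> u \<triangleleft> H)"
proof -
  have [simp]: "Y \<in> Obj V" using assms(3) by auto
  have "u \<triangleleft> (H \<boxtimes> H) \<cdot> Y \<triangleright> \<Delta> = X \<triangleright> \<Delta> \<cdot> u \<triangleleft> H" using assms by (simp add: rwhisker_natr)
  then show ?thesis using assms by (simp add: infinitesimal_def tails)
qed

text \<open>Composition with \<eta> and \<open>infinitesimal\<close> are mutually inverse and
  natural in the test object, so universal elements correspond.\<close>

lemma represents_pd_counit:
  assumes "\<beta> \<in> mor V (L \<boxtimes> H) H" "L \<in> Obj V" and rep: "represents_derivations V R \<Delta> L \<beta>"
  shows "represents_pd L (\<eta> \<cdot> \<beta>)"
proof -
  have \<beta>: "derivation_action V R L \<beta>" "right_invariant V R \<Delta> L \<beta>"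
    using rep by (simp_all add: represents_derivations_def)
  show ?thesis
    unfolding represents_pd_def
  proof (intro conjI allI impI)
    show "point_derivation L (\<eta> \<cdot> \<beta>)" using leibniz_of_derivation[OF \<beta>(1)] by (simp add: leibniz_iff)
    fix X h assume pd: "point_derivation X h"
    then have h [simp]: "X \<in> Obj V" "h \<in> Arr V" "Dom V h = X \<boxtimes> H" "Cod V h = \<I>"
      by (simp_all add: point_derivation_def)
    have "derivation_action V R X (infinitesimal X h)" "right_invariant V R \<Delta> X (infinitesimal X h)"
      using pd infinitesimal_derivation[OF h] infinitesimal_right_invariant[OF h] by (simp_all add: leibniz_iff)
    then have *: "\<exists>!u. u \<in> mor V X L \<and> \<beta> \<cdot> u \<triangleleft> H = infinitesimal X h"
      using rep unfolding represents_derivations_def by blast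
    have "(\<eta> \<cdot> \<beta>) \<cdot> u \<triangleleft> H = h \<longleftrightarrow> \<beta> \<cdot> u \<triangleleft> H = infinitesimal X h" if u: "u \<in> mor V X L" for u
    proof
      assume eq: "\<beta> \<cdot> u \<triangleleft> H = infinitesimal X h"
      show "(\<eta> \<cdot> \<beta>) \<cdot> u \<triangleleft> H = h"
        using assms u counit_infinitesimal[OF h] by (simp add: eq)
    next
      assume eq: "(\<eta> \<cdot> \<beta>) \<cdot> u \<triangleleft> H = h"
      have "\<beta> \<cdot> u \<triangleleft> H = infinitesimal L (\<eta> \<cdot> \<beta>) \<cdot> u \<triangleleft> H"
        using infinitesimal_counit[OF \<beta>(2) assms(2,1)] by simp
      also have "\<dots> = infinitesimal X h" using infinitesimal_comp[of L "\<eta> \<cdot> \<beta>" u X] assms u eq by simp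
      finally show "\<beta> \<cdot> u \<triangleleft> H = infinitesimal X h" .
    qed
    then show "\<exists>!u. u \<in> mor V X L \<and> (\<eta> \<cdot> \<beta>) \<cdot> u \<triangleleft> H = h" using * by blast
  qed
qed

text \<open>Applied to the tangent space, this supplies the representing object for right invariant
  derivations whose existence is claimed.\<close>

lemma represents_derivations_infinitesimal:
  assumes rep: "represents_pd L h"
  shows "represents_derivations V R \<Delta> L (infinitesimal L h)"
proof -
  have pd: "point_derivation L h" using rep by (simp add: represents_pd_def)
  then have h [simp]: "L \<in> Obj V" "h \<in> Arr V" "Dom V h = L \<boxtimes> H" "Cod V h = \<I>"
    by (simp_all add: point_derivation_def)
  have inf: "derivation_action V R L (infinitesimal L h)" "right_invariant V R \<Delta> L (infinitesimal L h)"
    using pd infinitesimal_derivation[OF h] infinitesimal_right_invariant[OF h] by (simp_all add: leibniz_iff)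
  have "\<exists>!u. u \<in> mor V X L \<and> infinitesimal L h \<cdot> u \<triangleleft> H = \<beta>'"
    if \<beta>': "derivation_action V R X \<beta>'" "right_invariant V R \<Delta> X \<beta>'" for X \<beta>'
  proof -
    have [simp]: "X \<in> Obj V" "\<beta>' \<in> Arr V" "Dom V \<beta>' = X \<boxtimes> H" "Cod V \<beta>' = H"
      using \<beta>'(1) by (simp_all add: derivation_action_def)
    have *: "\<exists>!u. u \<in> mor V X L \<and> h \<cdot> u \<triangleleft> H = \<eta> \<cdot> \<beta>'"
      using leibniz_of_derivation[OF \<beta>'(1)] rep by (simp add: leibniz_iff represents_pd_def)
    have "infinitesimal L h \<cdot> u \<triangleleft> H = \<beta>' \<longleftrightarrow> h \<cdot> u \<triangleleft> H = \<eta> \<cdot> \<beta>'" if u: "u \<in> mor V X L" for u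
    proof
      assume "h \<cdot> u \<triangleleft> H = \<eta> \<cdot> \<beta>'"
      then show "infinitesimal L h \<cdot> u \<triangleleft> H = \<beta>'"
        using infinitesimal_comp[of L h u X] u infinitesimal_counit[OF \<beta>'(2)] by simp
    next
      assume eq: "infinitesimal L h \<cdot> u \<triangleleft> H = \<beta>'"
      have "h \<cdot> u \<triangleleft> H = \<eta> \<cdot> infinitesimal X (h \<cdot> u \<triangleleft> H)"
        using u counit_infinitesimal[of X "h \<cdot> u \<triangleleft> H"] by simp
      then show "h \<cdot> u \<triangleleft> H = \<eta> \<cdot> \<beta>'" using infinitesimal_comp[of L h u X] u eq by simp
    qed
    then show ?thesis using * by blast
  qed
  then show ?thesis using inf by (simp add: represents_derivations_def)
qed

text \<open>\<open>aug_ideal_power\<close> allows any kernels of \<eta> in the two factors. These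
  and \<open>j\<close> factor through each other, so the product maps have the same
  cokernel.\<close>

lemma cokernel_square:
  assumes "aug_ideal_power V R \<eta> 1 i"
  obtains c where "is_cokernel V (amul R \<cdot> j \<boxdot> j) c" "is_kernel V c i"
proof -
  obtain i' j' c where i': "is_kernel V \<eta> i'" and j': "is_kernel V \<eta> j'"
    and c: "is_cokernel V (amul R \<cdot> i' \<boxdot> j') c" "is_kernel V c i"
    using assms by (auto simp: is_image_def)
  note [simp] = kernel_arr[OF i'] kernel_arr[OF j']
  have fac: "\<exists>u \<in> mor V (Dom V b) (Dom V a). b = a \<cdot> u" if "is_kernel V \<eta> a" "is_kernel V \<eta> b" for a b
    using kernel_factor[OF that(1), of b "Dom V b"] kernel_arr[OF that(2)] by auto
  obtain u u' v v' where u: "u \<in> mor V M (Dom V i')" "j = i' \<cdot> u" "u' \<in> mor V (Dom V i') M" "i' = j \<cdot> u'"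
    and v: "v \<in> mor V M (Dom V j')" "j = j' \<cdot> v" "v' \<in> mor V (Dom V j') M" "j' = j \<cdot> v'"
    using fac[OF i' ker] fac[OF ker i'] fac[OF j' ker] fac[OF ker j'] by blast
  have "j \<boxdot> j = i' \<boxdot> j' \<cdot> u \<boxdot> v"
    using u(1) v(1) arg_cong2[OF u(2) v(2), of "(\<boxdot>)"] by (simp add: tens_comp_arr)
  moreover have "i' \<boxdot> j' = j \<boxdot> j \<cdot> u' \<boxdot> v'"
    using u(3) v(3) arg_cong2[OF u(4) v(4), of "(\<boxdot>)"] by (simp add: tens_comp_arr)
  ultimately have "is_cokernel V (amul R \<cdot> j \<boxdot> j) c"
    using u(1,3) v(1,3) by (intro cokernel_cong[OF c(1), of _ "u \<boxdot> v" "u' \<boxdot> v'"]) simp_all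
  then show ?thesis using that c(2) by blast
qed

end

section \<open>Tangent space and distributions as representing objects\<close>

locale right_exact_augmentation = augmentation +
  assumes right_exact: "is_cokernel V f q \<Longrightarrow> X \<in> Obj V \<Longrightarrow> is_cokernel V (X \<triangleright> f) (X \<triangleright> q)"
begin

text \<open>\<open>c\<close> is a cokernel both of the product map and of its image
  \<open>i\<close>, and \<open>X \<triangleright> -\<close> preserves both; either condition says
  that \<open>h\<close> factors through \<open>X \<triangleright> c\<close>.\<close>

lemma vanish_square:
  assumes i: "aug_ideal_power V R \<eta> 1 i" and h: "h \<in> mor V (X \<boxtimes> H) W" "X \<in> Obj V"
  shows "h \<cdot> X \<triangleright> i = Zero V (X \<boxtimes> Dom V i) W \<longleftrightarrow> h \<cdot> X \<triangleright> (amul R \<cdot> j \<boxdot> j) = Zero V (X \<boxtimes> (M \<boxtimes> M)) W"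
proof -
  obtain c where c: "is_cokernel V (amul R \<cdot> j \<boxdot> j) c" "is_kernel V c i"
    using cokernel_square[OF i] .
  note [simp] = is_cokernel_arr[OF c(1)] kernel_arr[OF c(2)]
  have ci: "is_cokernel V i c" using c by (rule cokernel_of_kernel)
  have W: "W \<in> Obj V" using h by auto
  note ex = right_exact[OF c(1) h(2)] right_exact[OF ci h(2)]
  show ?thesis
  proof
    assume "h \<cdot> X \<triangleright> i = Zero V (X \<boxtimes> Dom V i) W"
    then obtain u where u: "u \<in> mor V (X \<boxtimes> Cod V c) W" "u \<cdot> X \<triangleright> c = h"
      using cokernel_factor[OF ex(2), of h W] h by auto
    have "h \<cdot> X \<triangleright> (amul R \<cdot> j \<boxdot> j) = u \<cdot> X \<triangleright> (c \<cdot> amul R \<cdot> j \<boxdot> j)"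
      using u(1) h(2) unfolding u(2)[symmetric] by (simp add: lwhisker_merge)
    also have "c \<cdot> amul R \<cdot> j \<boxdot> j = Zero V (M \<boxtimes> M) (Cod V c)" using is_cokernel_arr(4)[OF c(1)] by simp
    finally show "h \<cdot> X \<triangleright> (amul R \<cdot> j \<boxdot> j) = Zero V (X \<boxtimes> (M \<boxtimes> M)) W" using u(1) h(2) by simp
  next
    assume "h \<cdot> X \<triangleright> (amul R \<cdot> j \<boxdot> j) = Zero V (X \<boxtimes> (M \<boxtimes> M)) W"
    then obtain u where u: "u \<in> mor V (X \<boxtimes> Cod V c) W" "u \<cdot> X \<triangleright> c = h"
      using cokernel_factor[OF ex(1), of h W] h by auto
    have "h \<cdot> X \<triangleright> i = u \<cdot> X \<triangleright> (c \<cdot> i)"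
      using u(1) h(2) unfolding u(2)[symmetric] by (simp add: lwhisker_merge)
    then show "h \<cdot> X \<triangleright> i = Zero V (X \<boxtimes> Dom V i) W" using u(1) h(2) by simp
  qed
qed

lemma aug_ideal_arr:
  assumes "aug_ideal_power V R \<eta> 1 i"
  shows "i \<in> Arr V" "Cod V i = H"
proof -
  obtain c where c: "is_cokernel V (amul R \<cdot> j \<boxdot> j) c" "is_kernel V c i"
    using cokernel_square[OF assms] .
  show "i \<in> Arr V" "Cod V i = H" using is_cokernel_arr[OF c(1)] kernel_arr[OF c(2)] by simp_all
qed

text \<open>Maps into \<open>T\<close> are pairings with \<mm>/\<mm>^2. By right exactness these are
  the pairings with \<mm> that vanish on \<mm>^2, and the splitting extends them by 0 on the unit;
  hence the projection \<open>q \<cdot> \<pi>\<close> in the universal pairing.\<close>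

lemma tangent_space_represents:
  assumes tangent: "is_tangent_space V R \<eta> j q T ev"
  shows "represents_pd T (ev \<cdot> T \<triangleright> (q \<cdot> \<pi>))"
proof -
  obtain i t where i: "aug_ideal_power V R \<eta> 1 i" and t: "t \<in> mor V (Dom V i) M" "j \<cdot> t = i"
    and q: "is_cokernel V t q" and dual: "is_dual V (Cod V q) T ev"
    using tangent by (auto simp: is_tangent_space_def)
  have tarr [simp]: "t \<in> Arr V" "Dom V t = Dom V i" "Cod V t = M" using t by simp_all
  note [simp] = is_cokernel_arr[OF q, simplified]
  have [simp]: "T \<in> Obj V" "ev \<in> Arr V" "Dom V ev = T \<boxtimes> Cod V q" "Cod V ev = \<I>"
    using dual by (simp_all add: is_dual_def)
  have iarr [simp]: "i \<in> Arr V" "Cod V i = H" unfolding t(2)[symmetric] by simp_all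
  have pi_i: "\<pi> \<cdot> i = t" unfolding t(2)[symmetric] using reassoc[OF pi_j, of t] by simp
  have "(ev \<cdot> T \<triangleright> (q \<cdot> \<pi>)) \<cdot> T \<triangleright> i = Zero V (T \<boxtimes> Dom V i) \<I>"
    by (simp add: lwhisker_merge pi_i)
  then have pd: "point_derivation T (ev \<cdot> T \<triangleright> (q \<cdot> \<pi>))"
    using vanish_square[OF i, of "ev \<cdot> T \<triangleright> (q \<cdot> \<pi>)" T \<I>] by (simp add: point_derivation_def lwhisker_merge)
  have "\<exists>!u. u \<in> mor V X T \<and> (ev \<cdot> T \<triangleright> (q \<cdot> \<pi>)) \<cdot> u \<triangleleft> H = h" if "point_derivation X h" for X h
  proof -
    have [simp]: "X \<in> Obj V" "h \<in> Arr V" "Dom V h = X \<boxtimes> H" "Cod V h = \<I>"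
      and h: "h \<cdot> X \<triangleright> aone R = Zero V (X \<boxtimes> \<I>) \<I>" "h \<cdot> X \<triangleright> (amul R \<cdot> j \<boxdot> j) = Zero V (X \<boxtimes> (M \<boxtimes> M)) \<I>"
      using that by (simp_all add: point_derivation_def)
    have hi: "h \<cdot> X \<triangleright> i = Zero V (X \<boxtimes> Dom V i) \<I>"
      using vanish_square[OF i, of h X \<I>] h(2) by simp
    have "(h \<cdot> X \<triangleright> j) \<cdot> X \<triangleright> t = Zero V (X \<boxtimes> Dom V i) \<I>"
      using hi by (simp add: lwhisker_merge t(2))
    then obtain w where w: "w \<in> mor V (X \<boxtimes> Cod V q) \<I>" "w \<cdot> X \<triangleright> q = h \<cdot> X \<triangleright> j"
      using cokernel_factor[OF right_exact[OF q, of X], of "h \<cdot> X \<triangleright> j" \<I>] by auto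
    obtain u where u: "u \<in> mor V X T" "ev \<cdot> u \<triangleleft> Cod V q = w"
      using dual_factor[OF dual, of X w] w(1) by auto
    \<comment> \<open>A point derivation kills the unit, hence is determined by its restriction to
      \<mm>.\<close>
    have split: "h = h \<cdot> X \<triangleright> (j \<cdot> \<pi>)"
    proof -
      have "h = h \<cdot> X \<triangleright> (j \<cdot> \<pi> \<boxplus> aone R \<cdot> \<eta>)" unfolding splitting by simp
      also have "\<dots> = h \<cdot> X \<triangleright> (j \<cdot> \<pi>) \<boxplus> h \<cdot> X \<triangleright> (aone R \<cdot> \<eta>)" by (simp add: tens_Add comp_Add)
      also have "h \<cdot> X \<triangleright> (aone R \<cdot> \<eta>) = Zero V (X \<boxtimes> H) \<I>"
        using whisker_cont[OF h(1), of \<eta>] by simp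
      finally show ?thesis by simp
    qed
    have comp: "(ev \<cdot> T \<triangleright> (q \<cdot> \<pi>)) \<cdot> v \<triangleleft> H = (ev \<cdot> v \<triangleleft> Cod V q) \<cdot> X \<triangleright> (q \<cdot> \<pi>)" if "v \<in> mor V X T" for v
      using that by (simp add: rwhisker_natr)
    show ?thesis
    proof (rule ex1I[of _ u])
      have "(ev \<cdot> T \<triangleright> (q \<cdot> \<pi>)) \<cdot> u \<triangleleft> H = (w \<cdot> X \<triangleright> q) \<cdot> X \<triangleright> \<pi>"
        unfolding comp[OF u(1)] u(2) using w(1) by (simp add: lwhisker_comp)
      also have "\<dots> = h" unfolding w(2) using split by (simp add: lwhisker_merge)
      finally show "u \<in> mor V X T \<and> (ev \<cdot> T \<triangleright> (q \<cdot> \<pi>)) \<cdot> u \<triangleleft> H = h" using u(1) by blast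
    next
      fix v assume "v \<in> mor V X T \<and> (ev \<cdot> T \<triangleright> (q \<cdot> \<pi>)) \<cdot> v \<triangleleft> H = h"
      then have v: "v \<in> mor V X T" "(ev \<cdot> v \<triangleleft> Cod V q) \<cdot> X \<triangleright> (q \<cdot> \<pi>) = h" using comp by auto
      \<comment> \<open>Restriction along \<open>j\<close> undoes the extension along \<pi>, after
        which \<open>X \<triangleright> q\<close> can be cancelled.\<close>
      have "(ev \<cdot> v \<triangleleft> Cod V q) \<cdot> X \<triangleright> q = ((ev \<cdot> v \<triangleleft> Cod V q) \<cdot> X \<triangleright> (q \<cdot> \<pi>)) \<cdot> X \<triangleright> j"
        using v(1) by (simp add: lwhisker_merge)
      then have "(ev \<cdot> v \<triangleleft> Cod V q) \<cdot> X \<triangleright> q = w \<cdot> X \<triangleright> q" unfolding v(2) w(2) .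
      from cokernel_epi[OF right_exact[OF q] _ _ this] have "ev \<cdot> v \<triangleleft> Cod V q = ev \<cdot> u \<triangleleft> Cod V q"
        unfolding u(2) using v(1) w(1) by simp
      then show "v = u" by (rule dual_unique[OF dual v(1) u(1)])
    qed
  qed
  then show ?thesis using pd by (simp add: represents_pd_def)
qed

text \<open>Maps into \<open>E\<close> are the pairings with \<open>H\<close> that vanish on
  \<mm>^2; those that land in the kernel \<open>D\<close> are the ones that also vanish on the
  unit.\<close>

lemma dist_plus_represents:
  assumes dist: "is_dist_plus V R \<eta> 1 p E ev D e"
  shows "represents_pd D (ev \<cdot> e \<boxdot> p)"
proof -
  obtain i where i: "aug_ideal_power V R \<eta> 1 i" and p: "is_cokernel V i p" and dual: "is_dual V (Cod V p) E ev"
    and e: "e \<in> mor V D E" "is_kernel V (ev \<cdot> E \<triangleright> (p \<cdot> aone R) \<cdot> ru' E) e"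
    using dist by (auto simp: is_dist_plus_def is_dist_def)
  note [simp] = aug_ideal_arr[OF i]
  note [simp] = is_cokernel_arr[OF p, simplified]
  have [simp]: "E \<in> Obj V" "ev \<in> Arr V" "Dom V ev = E \<boxtimes> Cod V p" "Cod V ev = \<I>"
    using dual by (simp_all add: is_dual_def)
  have D [simp]: "D \<in> Obj V" using e(1) by auto
  have [simp]: "e \<in> Arr V" "Dom V e = D" "Cod V e = E" using e(1) by simp_all
  let ?d = "ev \<cdot> e \<boxdot> p"
  \<comment> \<open>A map \<open>v\<close> into \<open>E\<close>, followed by evaluation at the
    unit, is the restriction to \<open>aone R\<close> of the pairing that \<open>v\<close>
    defines.\<close>
  have res: "(ev \<cdot> E \<triangleright> (p \<cdot> aone R) \<cdot> ru' E) \<cdot> v = ((ev \<cdot> v \<boxdot> p) \<cdot> X \<triangleright> aone R) \<cdot> ru' X"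
    if "v \<in> mor V X E" "X \<in> Obj V" for v X
    using that by (simp add: ru'_nat reassoc[OF tens_comp_arr])
  have "?d \<cdot> D \<triangleright> i = Zero V (D \<boxtimes> Dom V i) \<I>" by (simp add: tens_comp_arr)
  moreover have "?d \<cdot> D \<triangleright> aone R = Zero V (D \<boxtimes> \<I>) \<I>"
  proof -
    have "((ev \<cdot> e \<boxdot> p) \<cdot> D \<triangleright> aone R) \<cdot> ru' D = Zero V D \<I>"
      using kernel_arr(4)[OF e(2)] unfolding res[OF e(1) D] by simp
    then have "(((ev \<cdot> e \<boxdot> p) \<cdot> D \<triangleright> aone R) \<cdot> ru' D) \<cdot> ru D = Zero V D \<I> \<cdot> ru D" by simp
    then show ?thesis by simp
  qed
  ultimately have pd: "point_derivation D ?d"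
    using vanish_square[OF i, of ?d D \<I>] by (simp add: point_derivation_def)
  have "\<exists>!u. u \<in> mor V X D \<and> ?d \<cdot> u \<triangleleft> H = h" if "point_derivation X h" for X h
  proof -
    have X [simp]: "X \<in> Obj V" and [simp]: "h \<in> Arr V" "Dom V h = X \<boxtimes> H" "Cod V h = \<I>"
      and h: "h \<cdot> X \<triangleright> aone R = Zero V (X \<boxtimes> \<I>) \<I>" "h \<cdot> X \<triangleright> (amul R \<cdot> j \<boxdot> j) = Zero V (X \<boxtimes> (M \<boxtimes> M)) \<I>"
      using that by (simp_all add: point_derivation_def)
    have hi: "h \<cdot> X \<triangleright> i = Zero V (X \<boxtimes> Dom V i) \<I>"
      using vanish_square[OF i, of h X \<I>] h(2) by simp
    then obtain w where w: "w \<in> mor V (X \<boxtimes> Cod V p) \<I>" "w \<cdot> X \<triangleright> p = h"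
      using cokernel_factor[OF right_exact[OF p, of X], of h \<I>] by auto
    obtain v where v: "v \<in> mor V X E" "ev \<cdot> v \<triangleleft> Cod V p = w"
      using dual_factor[OF dual, of X w] w(1) by auto
    have vp: "ev \<cdot> v' \<boxdot> p = (ev \<cdot> v' \<triangleleft> Cod V p) \<cdot> X \<triangleright> p" if "v' \<in> mor V X E" for v'
      using that by (simp add: tens_comp_arr)
    have vh: "ev \<cdot> v \<boxdot> p = h" unfolding vp[OF v(1)] v(2) by (rule w(2))
    have "(ev \<cdot> E \<triangleright> (p \<cdot> aone R) \<cdot> ru' E) \<cdot> v = Zero V X \<I>"
      unfolding res[OF v(1) X] vh h(1) by simp
    then obtain u where u: "u \<in> mor V X D" "e \<cdot> u = v"
      using kernel_factor[OF e(2), of v X] v(1) by auto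
    have comp: "?d \<cdot> u' \<triangleleft> H = ev \<cdot> (e \<cdot> u') \<boxdot> p" if "u' \<in> mor V X D" for u'
      using that by (simp add: tens_comp_arr)
    show ?thesis
    proof (rule ex1I[of _ u])
      show "u \<in> mor V X D \<and> ?d \<cdot> u \<triangleleft> H = h" using u(1) unfolding comp[OF u(1)] u(2) vh by blast
    next
      fix u' assume "u' \<in> mor V X D \<and> ?d \<cdot> u' \<triangleleft> H = h"
      then have u': "u' \<in> mor V X D" "ev \<cdot> (e \<cdot> u') \<boxdot> p = h" using comp by auto
      have eu': "e \<cdot> u' \<in> mor V X E" using u'(1) by simp
      have "(ev \<cdot> (e \<cdot> u') \<triangleleft> Cod V p) \<cdot> X \<triangleright> p = w \<cdot> X \<triangleright> p"
        using u'(2) unfolding vp[OF eu'] w(2) .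
      from cokernel_epi[OF right_exact[OF p] _ _ this] have "ev \<cdot> (e \<cdot> u') \<triangleleft> Cod V p = ev \<cdot> v \<triangleleft> Cod V p"
        unfolding v(2) using u'(1) w(1) by simp
      then have "e \<cdot> u' = e \<cdot> u"
        unfolding u(2) by (rule dual_unique[OF dual eu' v(1)])
      from kernel_mono[OF e(2) _ _ this] show "u' = u" using u'(1) u(1) by simp
    qed
  qed
  then show ?thesis using pd by (simp add: represents_pd_def)
qed

text \<open>The three universal point derivations are \<open>?t\<close>, \<open>?d\<close> and
  \<open>\<eta> \<cdot> \<beta>\<close>. The isomorphisms are the mediating maps between them, and
  \<open>\<phi> \<cdot> \<chi> = \<psi>\<close> because both sides mediate from
  \<open>\<eta> \<cdot> \<beta>\<close> to \<open>?t\<close>.\<close>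

lemma lie_comparison:
  assumes tangent: "is_tangent_space V R \<eta> j q T ev_T" and dist: "is_dist_plus V R \<eta> 1 p E ev_E D e"
  shows "\<exists>\<phi> \<in> isos V D T.
    ev_T \<cdot> (\<phi> \<boxdot> q) = ev_E \<cdot> (e \<boxdot> (p \<cdot> j)) \<and>
    (\<exists>L \<beta>. represents_derivations V R \<Delta> L \<beta>) \<and>
    (\<forall>L \<beta>. represents_derivations V R \<Delta> L \<beta> \<longrightarrow>
      (\<exists>\<psi> \<in> isos V L T. \<exists>\<chi> \<in> isos V L D.
         ev_T \<cdot> (\<psi> \<boxdot> q) = \<eta> \<cdot> \<beta> \<cdot> (L \<triangleright> j) \<and>
         ev_E \<cdot> ((e \<cdot> \<chi>) \<boxdot> p) = \<eta> \<cdot> \<beta> \<and> \<phi> \<cdot> \<chi> = \<psi>))"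
proof -
  let ?t = "ev_T \<cdot> T \<triangleright> (q \<cdot> \<pi>)" and ?d = "ev_E \<cdot> e \<boxdot> p"
  note T = tangent_space_represents[OF tangent] and D = dist_plus_represents[OF dist]
  have q [simp]: "q \<in> Arr V" "Dom V q = M"
    using tangent is_cokernel_arr(2,3) by (auto simp: is_tangent_space_def)
  have [simp]: "T \<in> Obj V" "ev_T \<in> Arr V" "Dom V ev_T = T \<boxtimes> Cod V q"
    using tangent by (auto simp: is_tangent_space_def is_dual_def)
  have [simp]: "ev_E \<in> Arr V" "Dom V ev_E = E \<boxtimes> Cod V p" "e \<in> Arr V" "Dom V e = D" "Cod V e = E"
    using dist by (simp_all add: is_dist_plus_def is_dist_def is_dual_def)
  obtain i where "aug_ideal_power V R \<eta> 1 i" "is_cokernel V i p"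
    using dist by (auto simp: is_dist_plus_def is_dist_def)
  then have [simp]: "p \<in> Arr V" "Dom V p = H" using is_cokernel_arr aug_ideal_arr by metis+
  have "point_derivation D ?d" using D by (simp add: represents_pd_def)
  then have dom: "D \<in> Obj V" "?d \<in> mor V (D \<boxtimes> H) \<I>" by (simp_all add: point_derivation_def)
  \<comment> \<open>The conclusion speaks of the pairing with \<mm> through \<open>q\<close>; it is
    obtained from the pairing with \<open>H\<close> by restriction along \<open>j\<close>, since
    \<pi> retracts \<open>j\<close>.\<close>
  have tq: "ev_T \<cdot> \<psi> \<boxdot> q = (?t \<cdot> \<psi> \<triangleleft> H) \<cdot> X \<triangleright> j" if "\<psi> \<in> mor V X T" for \<psi> X
  proof -
    have "X \<in> Obj V" using that by auto
    then show ?thesis using that by (simp add: tens_comp_arr)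
  qed
  obtain \<phi> where \<phi>: "\<phi> \<in> isos V D T" "?t \<cdot> \<phi> \<triangleleft> H = ?d" using represents_pd_iso[OF D T] .
  have \<phi>m: "\<phi> \<in> mor V D T" using iso_inverse[OF \<phi>(1)] by simp
  show ?thesis
  proof (rule bexI[of _ \<phi>], intro conjI allI impI)
    show "\<phi> \<in> isos V D T" by (fact \<phi>)
    show "ev_T \<cdot> \<phi> \<boxdot> q = ev_E \<cdot> e \<boxdot> (p \<cdot> j)"
      unfolding tq[OF \<phi>m] \<phi>(2) using dom(1) by (simp add: tens_comp_arr)
    show "\<exists>L \<beta>. represents_derivations V R \<Delta> L \<beta>"
      using represents_derivations_infinitesimal[OF T] by blast
    fix L \<beta> assume rep: "represents_derivations V R \<Delta> L \<beta>"
    then have \<beta> [simp]: "L \<in> Obj V" "\<beta> \<in> Arr V" "Dom V \<beta> = L \<boxtimes> H" "Cod V \<beta> = H"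
      by (simp_all add: represents_derivations_def derivation_action_def)
    have L: "represents_pd L (\<eta> \<cdot> \<beta>)" using represents_pd_counit[OF _ _ rep] by simp
    obtain \<psi> where \<psi>: "\<psi> \<in> isos V L T" "?t \<cdot> \<psi> \<triangleleft> H = \<eta> \<cdot> \<beta>" using represents_pd_iso[OF L T] .
    obtain \<chi> where \<chi>: "\<chi> \<in> isos V L D" "?d \<cdot> \<chi> \<triangleleft> H = \<eta> \<cdot> \<beta>" using represents_pd_iso[OF L D] .
    note [simp] = iso_inverse(1-3)[OF \<phi>(1)] iso_inverse(1-3)[OF \<psi>(1)] iso_inverse(1-3)[OF \<chi>(1)]
    have "ev_T \<cdot> \<psi> \<boxdot> q = \<eta> \<cdot> \<beta> \<cdot> L \<triangleright> j"
      using tq[of \<psi> L] unfolding \<psi>(2) by simp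
    moreover have "ev_E \<cdot> (e \<cdot> \<chi>) \<boxdot> p = \<eta> \<cdot> \<beta>" unfolding \<chi>(2)[symmetric] by (simp add: tens_comp_arr)
    moreover have "\<phi> \<cdot> \<chi> = \<psi>"
    proof (rule represents_pd_unique[OF T, of _ L])
      have "?t \<cdot> (\<phi> \<cdot> \<chi>) \<triangleleft> H = (?t \<cdot> \<phi> \<triangleleft> H) \<cdot> \<chi> \<triangleleft> H" by (simp add: rwhisker_comp)
      then show "?t \<cdot> (\<phi> \<cdot> \<chi>) \<triangleleft> H = ?t \<cdot> \<psi> \<triangleleft> H" unfolding \<phi>(2) \<chi>(2) \<psi>(2) .
    qed simp_all
    ultimately show "\<exists>\<psi> \<in> isos V L T. \<exists>\<chi> \<in> isos V L D.
         ev_T \<cdot> (\<psi> \<boxdot> q) = \<eta> \<cdot> \<beta> \<cdot> (L \<triangleright> j) \<and> ev_E \<cdot> ((e \<cdot> \<chi>) \<boxdot> p) = \<eta> \<cdot> \<beta> \<and> \<phi> \<cdot> \<chi> = \<psi>"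
      using \<psi>(1) \<chi>(1) by blast
  qed
qed

end

text \<open>Canonicity is expressed by the equations between pairings: evaluations are universal,
  and \<open>q\<close> and \<open>p\<close> stay epi after tensoring, so these equations determine
  the isomorphisms.\<close>

theorem theorem1p1:
  fixes C V :: "('o, 'a, 'k::alg_closed_field) sym_cat"
    and G :: "('o, 'a, 'g) alg_functor"
    and R :: "('o, 'a) alg"
    and \<Phi> :: "('o, 'a) alg \<Rightarrow> 'a \<Rightarrow> 'g"
    and T E D :: 'o
  assumes "finite_symmetric_tensor_category C"
    and "ind_completion TYPE('u) C V"
    and "affine_group_scheme V G"
    and "coordinate_ring V G R \<Phi>"
    and "is_tangent_space V R (counit V G R \<Phi>) j q T ev_T"
    and "is_dist_plus V R (counit V G R \<Phi>) 1 p E ev_E D e"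
  shows "\<exists>\<phi> \<in> isos V D T.
    ev_T \<cdot>\<^bsub>V\<^esub> (\<phi> \<boxdot>\<^bsub>V\<^esub> q) = ev_E \<cdot>\<^bsub>V\<^esub> (e \<boxdot>\<^bsub>V\<^esub> (p \<cdot>\<^bsub>V\<^esub> j)) \<and>
    (\<exists>L \<beta>. represents_derivations V R (comult V G R \<Phi>) L \<beta>) \<and>
    (\<forall>L \<beta>. represents_derivations V R (comult V G R \<Phi>) L \<beta> \<longrightarrow>
      (\<exists>\<psi> \<in> isos V L T. \<exists>\<chi> \<in> isos V L D.
         ev_T \<cdot>\<^bsub>V\<^esub> (\<psi> \<boxdot>\<^bsub>V\<^esub> q) = counit V G R \<Phi> \<cdot>\<^bsub>V\<^esub> \<beta> \<cdot>\<^bsub>V\<^esub> (Id V L \<boxdot>\<^bsub>V\<^esub> j) \<and>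
         ev_E \<cdot>\<^bsub>V\<^esub> ((e \<cdot>\<^bsub>V\<^esub> \<chi>) \<boxdot>\<^bsub>V\<^esub> p) = counit V G R \<Phi> \<cdot>\<^bsub>V\<^esub> \<beta> \<and>
         \<phi> \<cdot>\<^bsub>V\<^esub> \<chi> = \<psi>))"
proof -
  interpret ind_tensor_category "TYPE('u)" C V
    using assms(1,2) by (simp add: ind_tensor_category_def ind_tensor_category_axioms_def)
  interpret right_exact_augmentation V G R \<Phi> j
  proof unfold_locales
    show "group_functor V G" using assms(3) by (simp add: affine_group_scheme_def)
    show "coordinate_ring V G R \<Phi>" by fact
    show "is_kernel V (counit V G R \<Phi>) j" using assms(5) by (simp add: is_tangent_space_def)
  qed (rule right_exact)
  show ?thesis using lie_comparison[OF assms(5,6)] .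
qed

end
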